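(* The category $\mathsf{Var}_{\mathrm{fp}}(\mathsf{UMet})$, whose objects are the finitary varieties of ultra-quantitative algebras (for arbitrary finitary signatures $\Sigma$) and whose morphisms are the concrete functors over $\mathsf{UMet}$, is dually equivalent to the category $\mathsf{Mon}_{\mathrm{sf}}(\mathsf{UMet})$ of strongly finitary monads on $\mathsf{UMet}$ and monad morphisms; that is, there is an equivalence of categories $\mathsf{Var}_{\mathrm{fp}}(\mathsf{UMet})^{\mathrm{op}}\simeq \mathsf{Mon}_{\mathrm{sf}}(\mathsf{UMet})$.
   Context: Metric spaces are extended: distance $\infty$ is allowed. $\mathsf{UMet}$ is the category of (extended) ultrametric spaces ($d(x,z)\le\max\{d(x,y),d(y,z)\}$) and nonexpanding maps. It is cartesian closed (products carry the maximum metric; the hom-space $[A,B]$ is the set of nonexpanding maps with the supremum metric). All categories, functors and monads are enriched: hom-sets are (ultra)metric spaces, composition is nonexpanding, and functors are nonexpanding on hom-spaces (a monad is enriched iff its underlying endofunctor is). Every set is regarded as a discrete space (distances $0$ or $\infty$). Strongly finitary monads: let $K:\mathsf{Set}_{\mathrm{fp}}\hookrightarrow\mathsf{UMet}$ be the full embedding of finite discrete spaces. An enriched endofunctor $T$ is strongly finitary if it is the enriched left Kan extension of its restriction along $K$, $T=\mathrm{Lan}_K(T\circ K)$. A monad is strongly finitary if its endofunctor is. Ultra-quantitative algebras: a finitary signature $\Sigma$ is a set of operation symbols with arities in $\mathbb N$. An ultra-quantitative $\Sigma$-algebra is an ultrametric space $A$ with a nonexpanding operation $\sigma_A:A^n\to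 A$ ($A^n$ with the maximum metric) for every $n$-ary $\sigma\in\Sigma$; homomorphisms are nonexpanding maps preserving operations. They form $\Sigma\text{-}\mathsf{UMet}$ (hom-sets with the supremum metric). Let $V$ be a countably infinite set of variables and $T_\Sigma V$ the (discrete) algebra of terms. A quantitative equation is an expression $l=_\varepsilon r$ with $l,r\in T_\Sigma V$ and $\varepsilon\ge 0$ rational. An algebra $A$ satisfies it if for every map $f:V\to |A|$ with homomorphic extension $f^\sharp:T_\Sigma V\to A$ one has $d(f^\sharp(l),f^\sharp(r))\le\varepsilon$. A finitary variety of ultra-quantitative algebras is a full subcategory of some $\Sigma\text{-}\mathsf{UMet}$ ($\Sigma$ finitary) consisting of all algebras satisfying a given set of quantitative equations. Concrete functors: each variety $\mathcal V$ is considered with its forgetful functor $U_{\mathcal V}:\mathcal V\to\mathsf{UMet}$. A concrete functor $\mathcal V\to\mathcal W$ is an (enriched) functor $F$ with $U_{\mathcal W}\circ F=U_{\mathcal V}$. *)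

theory Defs
  imports "HOL-Library.FuncSet" "HOL-Library.Countable_Set"
    "HOL-Library.Extended_Nonnegative_Real"
begin

unbundle cardinal_syntax

text \<open>
  Conventions. Spaces, functors and natural transformations are compared by HOL equality, so
  every function belonging to such a structure is required to be extensional
  (\<^const>\<open>undefined\<close> outside its intended domain).

  Size. A type \<open>'u\<close> plays the role of the universe: a set is small if it has fewer elements than
  \<open>'u\<close>. If the cardinality of \<open>'u\<close> is inaccessible, then the small sets are, up to bijection, the
  members of a Grothendieck universe. Hom-spaces live in function types over \<open>'u\<close>, so they need
  not be re-encoded as small subsets of \<open>'u\<close>; hence strong limitness is never needed, and the
  results are stated for every \<open>'u\<close> of uncountable regular cardinality.
\<close>

definition small :: "'u set \<Rightarrow> bool"
  where "small A \<longleftrightarrow> |A| <o |UNIV :: 'u set|"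


subsection \<open>Extended ultrametric spaces\<close>

record 'a emetric =
  pts :: "'a set"
  dst :: "'a \<Rightarrow> 'a \<Rightarrow> ennreal"

definition ultrametric_space :: "'a emetric \<Rightarrow> bool"
  where "ultrametric_space X \<longleftrightarrow>
    dst X \<in> extensional (pts X) \<and> (\<forall>x\<in>pts X. dst X x \<in> extensional (pts X)) \<and>
    (\<forall>x\<in>pts X. \<forall>y\<in>pts X. dst X x y = 0 \<longleftrightarrow> x = y) \<and>
    (\<forall>x\<in>pts X. \<forall>y\<in>pts X. dst X x y = dst X y x) \<and>
    (\<forall>x\<in>pts X. \<forall>y\<in>pts X. \<forall>z\<in>pts X. dst X x z \<le> max (dst X x y) (dst X y z))"

definition discrete_space :: "'a emetric \<Rightarrow> bool"
  where "discrete_space X \<longleftrightarrow> ultrametric_space X \<and>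
    (\<forall>x\<in>pts X. \<forall>y\<in>pts X. x \<noteq> y \<longrightarrow> dst X x y = \<infinity>)"

definition nonexpanding :: "'a emetric \<Rightarrow> 'b emetric \<Rightarrow> ('a \<Rightarrow> 'b) set"
  where "nonexpanding X Y =
    {f \<in> pts X \<rightarrow>\<^sub>E pts Y. \<forall>x\<in>pts X. \<forall>y\<in>pts X. dst Y (f x) (f y) \<le> dst X x y}"

definition sup_dist :: "'a emetric \<Rightarrow> 'b emetric \<Rightarrow> ('a \<Rightarrow> 'b) \<Rightarrow> ('a \<Rightarrow> 'b) \<Rightarrow> ennreal"
  where "sup_dist X Y f g = (SUP x\<in>pts X. dst Y (f x) (g x))"

definition isometric_iso :: "'a emetric \<Rightarrow> 'b emetric \<Rightarrow> ('a \<Rightarrow> 'b) \<Rightarrow> bool"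
  where "isometric_iso X Y f \<longleftrightarrow> bij_betw f (pts X) (pts Y) \<and>
    (\<forall>x\<in>pts X. \<forall>y\<in>pts X. dst Y (f x) (f y) = dst X x y)"

text \<open>The power \<open>X\<^sup>n\<close> with the maximum metric; for \<open>n = 0\<close> the supremum over the empty set is \<open>0\<close>.\<close>

definition power_space :: "'a emetric \<Rightarrow> nat \<Rightarrow> 'a list emetric"
  where "power_space X n =
    (let P = {xs. length xs = n \<and> set xs \<subseteq> pts X}
     in \<lparr>pts = P, dst = (\<lambda>xs\<in>P. \<lambda>ys\<in>P. SUP i\<in>{..<n}. dst X (xs ! i) (ys ! i))\<rparr>)"


subsection \<open>Categories, functors and natural transformations\<close>

text \<open>Arrows are indexed by domain and codomain, so hom-sets need not be disjoint, and
  \<open>Cmp C a b c g f\<close> is the composite of \<open>f : a \<rightarrow> b\<close> and \<open>g : b \<rightarrow> c\<close>.\<close>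

record ('o, 'm) cat =
  Ob :: "'o set"
  Hom :: "'o \<Rightarrow> 'o \<Rightarrow> 'm set"
  Idt :: "'o \<Rightarrow> 'm"
  Cmp :: "'o \<Rightarrow> 'o \<Rightarrow> 'o \<Rightarrow> 'm \<Rightarrow> 'm \<Rightarrow> 'm"

definition category :: "('o, 'm, 'z) cat_scheme \<Rightarrow> bool"
  where "category C \<longleftrightarrow>
    (\<forall>a\<in>Ob C. Idt C a \<in> Hom C a a) \<and>
    (\<forall>a\<in>Ob C. \<forall>b\<in>Ob C. \<forall>c\<in>Ob C. \<forall>f\<in>Hom C a b. \<forall>g\<in>Hom C b c. Cmp C a b c g f \<in> Hom C a c) \<and>
    (\<forall>a\<in>Ob C. \<forall>b\<in>Ob C. \<forall>f\<in>Hom C a b.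
       Cmp C a a b f (Idt C a) = f \<and> Cmp C a b b (Idt C b) f = f) \<and>
    (\<forall>a\<in>Ob C. \<forall>b\<in>Ob C. \<forall>c\<in>Ob C. \<forall>d\<in>Ob C. \<forall>f\<in>Hom C a b. \<forall>g\<in>Hom C b c. \<forall>h\<in>Hom C c d.
       Cmp C a b d (Cmp C b c d h g) f = Cmp C a c d h (Cmp C a b c g f))"

definition op_cat :: "('o, 'm) cat \<Rightarrow> ('o, 'm) cat"
  where "op_cat C = \<lparr>Ob = Ob C, Hom = (\<lambda>a b. Hom C b a), Idt = Idt C,
    Cmp = (\<lambda>a b c g f. Cmp C c b a f g)\<rparr>"

record ('o, 'm, 'p, 'n) fctr =
  FO :: "'o \<Rightarrow> 'p"
  FM :: "'o \<Rightarrow> 'o \<Rightarrow> 'm \<Rightarrow> 'n"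

definition is_functor ::
  "('o, 'm, 'y) cat_scheme \<Rightarrow> ('p, 'n, 'z) cat_scheme \<Rightarrow> ('o, 'm, 'p, 'n) fctr \<Rightarrow> bool"
  where "is_functor C D F \<longleftrightarrow>
    FO F \<in> Ob C \<rightarrow>\<^sub>E Ob D \<and>
    FM F \<in> extensional (Ob C) \<and> (\<forall>a\<in>Ob C. FM F a \<in> extensional (Ob C)) \<and>
    (\<forall>a\<in>Ob C. \<forall>b\<in>Ob C. FM F a b \<in> Hom C a b \<rightarrow>\<^sub>E Hom D (FO F a) (FO F b)) \<and>
    (\<forall>a\<in>Ob C. FM F a a (Idt C a) = Idt D (FO F a)) \<and>
    (\<forall>a\<in>Ob C. \<forall>b\<in>Ob C. \<forall>c\<in>Ob C. \<forall>f\<in>Hom C a b. \<forall>g\<in>Hom C b c.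
       FM F a c (Cmp C a b c g f) = Cmp D (FO F a) (FO F b) (FO F c) (FM F b c g) (FM F a b f))"

text \<open>The inclusion of a full subcategory \<open>C\<close> into a larger category has the same components as
  the identity functor of \<open>C\<close>.\<close>

definition id_functor :: "('o, 'm, 'y) cat_scheme \<Rightarrow> ('o, 'm, 'o, 'm) fctr"
  where "id_functor C = \<lparr>FO = (\<lambda>a\<in>Ob C. a), FM = (\<lambda>a\<in>Ob C. \<lambda>b\<in>Ob C. \<lambda>f\<in>Hom C a b. f)\<rparr>"

definition comp_functor ::
  "('o, 'm, 'y) cat_scheme \<Rightarrow> ('p, 'n, 'q, 'k) fctr \<Rightarrow> ('o, 'm, 'p, 'n) fctr
    \<Rightarrow> ('o, 'm, 'q, 'k) fctr"
  where "comp_functor C G F = \<lparr>FO = (\<lambda>a\<in>Ob C. FO G (FO F a)),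
    FM = (\<lambda>a\<in>Ob C. \<lambda>b\<in>Ob C. \<lambda>f\<in>Hom C a b. FM G (FO F a) (FO F b) (FM F a b f))\<rparr>"

definition natural_transformation ::
  "('o, 'm, 'y) cat_scheme \<Rightarrow> ('p, 'n, 'z) cat_scheme \<Rightarrow> ('o, 'm, 'p, 'n) fctr
    \<Rightarrow> ('o, 'm, 'p, 'n) fctr \<Rightarrow> ('o \<Rightarrow> 'n) \<Rightarrow> bool"
  where "natural_transformation C D F G \<alpha> \<longleftrightarrow>
    \<alpha> \<in> (\<Pi>\<^sub>E a\<in>Ob C. Hom D (FO F a) (FO G a)) \<and>
    (\<forall>a\<in>Ob C. \<forall>b\<in>Ob C. \<forall>f\<in>Hom C a b.
       Cmp D (FO F a) (FO G a) (FO G b) (FM G a b f) (\<alpha> a) =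
       Cmp D (FO F a) (FO F b) (FO G b) (\<alpha> b) (FM F a b f))"

definition id_transformation ::
  "('o, 'm, 'y) cat_scheme \<Rightarrow> ('p, 'n, 'z) cat_scheme \<Rightarrow> ('o, 'm, 'p, 'n) fctr \<Rightarrow> 'o \<Rightarrow> 'n"
  where "id_transformation C D F = (\<lambda>a\<in>Ob C. Idt D (FO F a))"

definition is_iso :: "('o, 'm, 'y) cat_scheme \<Rightarrow> 'o \<Rightarrow> 'o \<Rightarrow> 'm \<Rightarrow> bool"
  where "is_iso C a b f \<longleftrightarrow> f \<in> Hom C a b \<and>
    (\<exists>g\<in>Hom C b a. Cmp C a b a g f = Idt C a \<and> Cmp C b a b f g = Idt C b)"

definition natural_iso ::
  "('o, 'm, 'y) cat_scheme \<Rightarrow> ('p, 'n, 'z) cat_scheme \<Rightarrow> ('o, 'm, 'p, 'n) fctr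
    \<Rightarrow> ('o, 'm, 'p, 'n) fctr \<Rightarrow> ('o \<Rightarrow> 'n) \<Rightarrow> bool"
  where "natural_iso C D F G \<alpha> \<longleftrightarrow> natural_transformation C D F G \<alpha> \<and>
    (\<forall>a\<in>Ob C. is_iso D (FO F a) (FO G a) (\<alpha> a))"

definition equivalent_categories ::
  "('o, 'm, 'y) cat_scheme \<Rightarrow> ('p, 'n, 'z) cat_scheme \<Rightarrow> bool"
  where "equivalent_categories C D \<longleftrightarrow> category C \<and> category D \<and>
    (\<exists>F G \<alpha> \<beta>. is_functor C D F \<and> is_functor D C G \<and>
       natural_iso C C (id_functor C) (comp_functor C G F) \<alpha> \<and>
       natural_iso D D (comp_functor D F G) (id_functor D) \<beta>)"


subsection \<open>Enrichment over ultrametric spaces\<close>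

record ('o, 'm) ecat = "('o, 'm) cat" +
  Hdist :: "'o \<Rightarrow> 'o \<Rightarrow> 'm \<Rightarrow> 'm \<Rightarrow> ennreal"

definition hom_space :: "('o, 'm, 'z) ecat_scheme \<Rightarrow> 'o \<Rightarrow> 'o \<Rightarrow> 'm emetric"
  where "hom_space C a b = \<lparr>pts = Hom C a b,
    dst = (\<lambda>f\<in>Hom C a b. \<lambda>g\<in>Hom C a b. Hdist C a b f g)\<rparr>"

definition full_subcategory :: "('o, 'm, 'z) ecat_scheme \<Rightarrow> 'o set \<Rightarrow> ('o, 'm, 'z) ecat_scheme"
  where "full_subcategory C S = C\<lparr>Ob := Ob C \<inter> S\<rparr>"

definition enriched_functor ::
  "('o, 'm, 'y) ecat_scheme \<Rightarrow> ('p, 'n, 'z) ecat_scheme \<Rightarrow> ('o, 'm, 'p, 'n) fctr \<Rightarrow> bool"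
  where "enriched_functor C D F \<longleftrightarrow> is_functor C D F \<and>
    (\<forall>a\<in>Ob C. \<forall>b\<in>Ob C.
       FM F a b \<in> nonexpanding (hom_space C a b) (hom_space D (FO F a) (FO F b)))"

text \<open>The hom-space \<open>[A\<^sup>o\<^sup>p, V](C(K-, c), B(G-, b))\<close> of enriched natural transformations between
  presheaves on \<open>A\<close>, with the supremum metric.\<close>

definition presheaf_hom ::
  "('a, 'm, 'x) ecat_scheme \<Rightarrow> ('c, 'k, 'y) ecat_scheme \<Rightarrow> ('b, 'n, 'z) ecat_scheme
    \<Rightarrow> ('a, 'm, 'c, 'k) fctr \<Rightarrow> ('a, 'm, 'b, 'n) fctr \<Rightarrow> 'c \<Rightarrow> 'b \<Rightarrow> ('a \<Rightarrow> 'k \<Rightarrow> 'n) emetric"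
  where "presheaf_hom A C B K G c b =
    (let P = {\<theta> \<in> (\<Pi>\<^sub>E a\<in>Ob A. nonexpanding (hom_space C (FO K a) c) (hom_space B (FO G a) b)).
           \<forall>a\<in>Ob A. \<forall>a'\<in>Ob A. \<forall>f\<in>Hom A a a'. \<forall>\<phi>\<in>Hom C (FO K a') c.
             \<theta> a (Cmp C (FO K a) (FO K a') c \<phi> (FM K a a' f)) =
             Cmp B (FO G a) (FO G a') b (\<theta> a' \<phi>) (FM G a a' f)}
     in \<lparr>pts = P, dst = (\<lambda>\<theta>\<in>P. \<lambda>\<theta>'\<in>P.
           SUP a\<in>Ob A. sup_dist (hom_space C (FO K a) c) (hom_space B (FO G a) b) (\<theta> a) (\<theta>' a))\<rparr>)"

text \<open>\<open>L\<close> with unit \<open>\<alpha> : G \<rightarrow> L K\<close> is the enriched left Kan extension of \<open>G\<close> along \<open>K\<close> (Kelly): for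
  all \<open>c\<close>, the object \<open>L c\<close> is the colimit of \<open>G\<close> weighted by \<open>C(K-, c)\<close>, i.e. the map
  \<open>B(L c, b) \<rightarrow> [A\<^sup>o\<^sup>p, V](C(K-, c), B(G-, b))\<close> induced by \<open>\<alpha>\<close> is an isomorphism of spaces for
  all \<open>b\<close>.\<close>

definition is_left_Kan_extension ::
  "('a, 'm, 'x) ecat_scheme \<Rightarrow> ('c, 'k, 'y) ecat_scheme \<Rightarrow> ('b, 'n, 'z) ecat_scheme
    \<Rightarrow> ('a, 'm, 'c, 'k) fctr \<Rightarrow> ('a, 'm, 'b, 'n) fctr \<Rightarrow> ('c, 'k, 'b, 'n) fctr \<Rightarrow> ('a \<Rightarrow> 'n) \<Rightarrow> bool"
  where "is_left_Kan_extension A C B K G L \<alpha> \<longleftrightarrow>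
    enriched_functor A C K \<and> enriched_functor A B G \<and> enriched_functor C B L \<and>
    natural_transformation A B G (comp_functor A L K) \<alpha> \<and>
    (\<forall>c\<in>Ob C. \<forall>b\<in>Ob B. isometric_iso (hom_space B (FO L c) b) (presheaf_hom A C B K G c b)
       (\<lambda>u. \<lambda>a\<in>Ob A. \<lambda>\<phi>\<in>Hom C (FO K a) c.
          Cmp B (FO G a) (FO L c) b u
            (Cmp B (FO G a) (FO L (FO K a)) (FO L c) (FM L (FO K a) c \<phi>) (\<alpha> a))))"


subsection \<open>Strongly finitary monads on UMet\<close>

definition UMet :: "('u emetric, 'u \<Rightarrow> 'u) ecat"
  where "UMet = \<lparr>Ob = {X. ultrametric_space X \<and> small (pts X)},
    Hom = nonexpanding,
    Idt = (\<lambda>X. \<lambda>x\<in>pts X. x),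
    Cmp = (\<lambda>X Y Z g f. compose (pts X) g f),
    Hdist = sup_dist\<rparr>"

definition Set_fp :: "('u emetric, 'u \<Rightarrow> 'u) ecat"
  where "Set_fp = full_subcategory UMet {X. discrete_space X \<and> finite (pts X)}"

definition strongly_finitary :: "('u emetric, 'u \<Rightarrow> 'u, 'u emetric, 'u \<Rightarrow> 'u) fctr \<Rightarrow> bool"
  where "strongly_finitary T \<longleftrightarrow>
    (let K = id_functor Set_fp; G = comp_functor Set_fp T K
     in is_left_Kan_extension Set_fp UMet UMet K G T (id_transformation Set_fp UMet G))"

record ('o, 'm) mnd =
  endo :: "('o, 'm, 'o, 'm) fctr"
  eta :: "'o \<Rightarrow> 'm"
  mu :: "'o \<Rightarrow> 'm"

definition enriched_monad :: "('o, 'm, 'z) ecat_scheme \<Rightarrow> ('o, 'm) mnd \<Rightarrow> bool"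
  where "enriched_monad C M \<longleftrightarrow>
    (let T = FO (endo M); TM = FM (endo M) in
     enriched_functor C C (endo M) \<and>
     natural_transformation C C (id_functor C) (endo M) (eta M) \<and>
     natural_transformation C C (comp_functor C (endo M) (endo M)) (endo M) (mu M) \<and>
     (\<forall>a\<in>Ob C.
        Cmp C (T a) (T (T a)) (T a) (mu M a) (eta M (T a)) = Idt C (T a) \<and>
        Cmp C (T a) (T (T a)) (T a) (mu M a) (TM a (T a) (eta M a)) = Idt C (T a) \<and>
        Cmp C (T (T (T a))) (T (T a)) (T a) (mu M a) (mu M (T a)) =
        Cmp C (T (T (T a))) (T (T a)) (T a) (mu M a) (TM (T (T a)) (T a) (mu M a))))"

definition monad_morphism ::
  "('o, 'm, 'z) ecat_scheme \<Rightarrow> ('o, 'm) mnd \<Rightarrow> ('o, 'm) mnd \<Rightarrow> ('o \<Rightarrow> 'm) \<Rightarrow> bool"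
  where "monad_morphism C M N \<phi> \<longleftrightarrow>
    (let S = FO (endo M); T = FO (endo N); TM = FM (endo N) in
     natural_transformation C C (endo M) (endo N) \<phi> \<and>
     (\<forall>a\<in>Ob C.
        Cmp C a (S a) (T a) (\<phi> a) (eta M a) = eta N a \<and>
        Cmp C (S (S a)) (S a) (T a) (\<phi> a) (mu M a) =
        Cmp C (S (S a)) (T (T a)) (T a) (mu N a)
          (Cmp C (S (S a)) (T (S a)) (T (T a)) (TM (S a) (T a) (\<phi> a)) (\<phi> (S a)))))"

definition Mon_sf :: "(('u emetric, 'u \<Rightarrow> 'u) mnd, 'u emetric \<Rightarrow> 'u \<Rightarrow> 'u) cat"
  where "Mon_sf = \<lparr>Ob = {M. enriched_monad UMet M \<and> strongly_finitary (endo M)},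
    Hom = (\<lambda>M N. {\<phi>. monad_morphism UMet M N \<phi>}),
    Idt = (\<lambda>M. id_transformation UMet UMet (endo M)),
    Cmp = (\<lambda>L M N \<psi> \<phi>. \<lambda>X\<in>Ob UMet.
      Cmp UMet (FO (endo L) X) (FO (endo M) X) (FO (endo N) X) (\<psi> X) (\<phi> X))\<rparr>"


subsection \<open>Varieties of ultra-quantitative algebras\<close>

record 's sig =
  symbols :: "'s set"
  arity :: "'s \<Rightarrow> nat"

definition signature :: "'s sig \<Rightarrow> bool"
  where "signature \<Sigma> \<longleftrightarrow> small (symbols \<Sigma>) \<and> arity \<Sigma> \<in> extensional (symbols \<Sigma>)"

record ('s, 'a) alg =
  underlying :: "'a emetric"
  opn :: "'s \<Rightarrow> 'a list \<Rightarrow> 'a"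

definition ultra_algebra :: "'s sig \<Rightarrow> ('s, 'a) alg \<Rightarrow> bool"
  where "ultra_algebra \<Sigma> A \<longleftrightarrow> ultrametric_space (underlying A) \<and>
    opn A \<in> (\<Pi>\<^sub>E \<sigma>\<in>symbols \<Sigma>. nonexpanding (power_space (underlying A) (arity \<Sigma> \<sigma>)) (underlying A))"

definition homomorphisms :: "'s sig \<Rightarrow> ('s, 'a) alg \<Rightarrow> ('s, 'b) alg \<Rightarrow> ('a \<Rightarrow> 'b) set"
  where "homomorphisms \<Sigma> A B = {h \<in> nonexpanding (underlying A) (underlying B).
    \<forall>\<sigma>\<in>symbols \<Sigma>. \<forall>xs\<in>pts (power_space (underlying A) (arity \<Sigma> \<sigma>)).
      h (opn A \<sigma> xs) = opn B \<sigma> (map h xs)}"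

definition Sigma_UMet :: "'s sig \<Rightarrow> (('s, 'u) alg, 'u \<Rightarrow> 'u) ecat"
  where "Sigma_UMet \<Sigma> = \<lparr>Ob = {A. ultra_algebra \<Sigma> A \<and> small (pts (underlying A))},
    Hom = homomorphisms \<Sigma>,
    Idt = (\<lambda>A. \<lambda>x\<in>pts (underlying A). x),
    Cmp = (\<lambda>A B C g f. compose (pts (underlying A)) g f),
    Hdist = (\<lambda>A B. sup_dist (underlying A) (underlying B))\<rparr>"

text \<open>Terms over the countably infinite set \<^typ>\<open>nat\<close> of variables.\<close>

datatype 's trm = Vr nat | Fn 's "'s trm list"

inductive_set terms :: "'s sig \<Rightarrow> 's trm set" for \<Sigma>
  where
    Vr: "Vr x \<in> terms \<Sigma>"
  | Fn: "\<sigma> \<in> symbols \<Sigma> \<Longrightarrow> length ts = arity \<Sigma> \<sigma> \<Longrightarrow> \<forall>t\<in>set ts. t \<in> terms \<Sigma> \<Longrightarrow> Fn \<sigma> ts \<in> terms \<Sigma>"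

text \<open>\<open>term_ext A f\<close> is the homomorphic extension of a valuation \<open>f\<close> of the variables.\<close>

primrec term_ext :: "('s, 'a) alg \<Rightarrow> (nat \<Rightarrow> 'a) \<Rightarrow> 's trm \<Rightarrow> 'a"
  where
    "term_ext A f (Vr x) = f x"
  | "term_ext A f (Fn \<sigma> ts) = opn A \<sigma> (map (term_ext A f) ts)"

text \<open>The triple \<open>(l, \<epsilon>, r)\<close> stands for the quantitative equation \<open>l =\<^sub>\<epsilon> r\<close>.\<close>

type_synonym 's quant_eq = "'s trm \<times> rat \<times> 's trm"

definition quant_eqs :: "'s sig \<Rightarrow> 's quant_eq set"
  where "quant_eqs \<Sigma> = {(l, \<epsilon>, r). l \<in> terms \<Sigma> \<and> r \<in> terms \<Sigma> \<and> 0 \<le> \<epsilon>}"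

definition satisfies :: "('s, 'a) alg \<Rightarrow> 's quant_eq \<Rightarrow> bool"
  where "satisfies A = (\<lambda>(l, \<epsilon>, r). \<forall>f. range f \<subseteq> pts (underlying A) \<longrightarrow>
    dst (underlying A) (term_ext A f l) (term_ext A f r) \<le> ennreal (real_of_rat \<epsilon>))"

text \<open>A variety is given by its signature and its class of algebras.\<close>

type_synonym 'u variety = "'u sig \<times> ('u, 'u) alg set"

definition finitary_variety :: "'u variety \<Rightarrow> bool"
  where "finitary_variety = (\<lambda>(\<Sigma>, V). signature \<Sigma> \<and>
    (\<exists>E. E \<subseteq> quant_eqs \<Sigma> \<and> V = {A \<in> Ob (Sigma_UMet \<Sigma>). \<forall>e\<in>E. satisfies A e}))"

definition variety_cat :: "'u variety \<Rightarrow> (('u, 'u) alg, 'u \<Rightarrow> 'u) ecat"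
  where "variety_cat = (\<lambda>(\<Sigma>, V). full_subcategory (Sigma_UMet \<Sigma>) V)"

definition forgetful :: "'u variety \<Rightarrow> (('u, 'u) alg, 'u \<Rightarrow> 'u, 'u emetric, 'u \<Rightarrow> 'u) fctr"
  where "forgetful V = \<lparr>FO = (\<lambda>A\<in>Ob (variety_cat V). underlying A),
    FM = (\<lambda>A\<in>Ob (variety_cat V). \<lambda>B\<in>Ob (variety_cat V). \<lambda>h\<in>Hom (variety_cat V) A B. h)\<rparr>"

type_synonym 'u alg_functor = "(('u, 'u) alg, 'u \<Rightarrow> 'u, ('u, 'u) alg, 'u \<Rightarrow> 'u) fctr"

definition concrete_functor :: "'u variety \<Rightarrow> 'u variety \<Rightarrow> 'u alg_functor \<Rightarrow> bool"
  where "concrete_functor V W F \<longleftrightarrow> enriched_functor (variety_cat V) (variety_cat W) F \<and>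
    comp_functor (variety_cat V) (forgetful W) F = forgetful V"

definition Var_fp :: "('u variety, 'u alg_functor) cat"
  where "Var_fp = \<lparr>Ob = {V. finitary_variety V},
    Hom = (\<lambda>V W. {F. concrete_functor V W F}),
    Idt = (\<lambda>V. id_functor (variety_cat V)),
    Cmp = (\<lambda>U V W G F. comp_functor (variety_cat U) G F)\<rparr>"

end

theory Submission
  imports Defs
begin

text \<open>
  A monad \<open>M\<close> represents a variety \<open>V\<close> if the algebras of \<open>V\<close> are, concretely over the category of
  spaces, the Eilenberg--Moore algebras of \<open>M\<close>. If \<open>M\<close> represents \<open>V\<close> and \<open>N\<close> represents \<open>W\<close>, then
  concrete functors \<open>V \<rightarrow> W\<close> correspond to monad morphisms \<open>N \<rightarrow> M\<close> by precomposition of structure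
  maps, so it suffices that every variety is represented by a strongly finitary monad and that every
  strongly finitary monad represents a variety.

  For a variety, the free algebra on \<open>X\<close> is the set of terms over \<open>X\<close> modulo the supremum of the
  pseudometrics induced by all nonexpanding maps from \<open>X\<close> to algebras of the variety. A cocone on finite
  discrete spaces gives a map on terms, and strong finitariness says that this map is nonexpanding. The
  supremum of the pseudometrics induced by all cocones is itself a model of the equations, because
  fixing all arguments but one of an operation turns a cocone into a cocone and, by the ultrametric
  inequality, the arguments may be changed one at a time. Hence it lies below the free metric.

  For a strongly finitary monad \<open>M\<close>, take the elements of \<open>M n\<close> as \<open>n\<close>-ary operations and all equations
  valid in all \<open>M\<close>-algebras. The operations of a model \<open>X\<close> form a cocone, and the Kan extension property
  turns it into a structure map \<open>M X \<rightarrow> X\<close>; the monad laws follow since every point of \<open>M X\<close> comes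
  from some \<open>M n\<close>.
\<close>


section \<open>Small sets\<close>

text \<open>With the ordinary triangle inequality, changing n arguments of an operation one after
  the other would add up n errors; the ultrametric inequality keeps one bound throughout. A single
  cocone offers no control over how its pseudometric behaves under operations. The supremum over all
  cocones does, since fixing arguments does not lead out of the class. The fixed arguments bring in
  finitely many variables of their own, so a finite discrete space has to be enlarged by them, after
  being copied to a place disjoint from them. For a monad, distances in \<open>M n\<close> are
  arbitrary elements of [0, \<infinity>], while equations carry rational bounds; density of the
  rationals closes this gap. Concrete functors keep underlying spaces strictly, hence a variety is
  matched with Eilenberg-Moore algebras by a bijection and not just by an equivalence. The type
  \<open>'u\<close> both supplies points and measures size: classes of terms and operations of a
  monad must be coded as elements of \<open>'u\<close>, and regularity together with uncountability
  keeps the resulting sets small.\<close>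

locale universe =
  fixes u :: "'u itself"
  assumes uncountable_UNIV: "uncountable (UNIV :: 'u set)"
    and regular_UNIV: "regularCard |UNIV :: 'u set|"
begin

text \<open>\<open>small\<close> speaks about subsets of \<open>'u\<close> only. Terms, lists and
  pairs live in other types, so their sets are compared with \<open>'u\<close> by this
  variant.\<close>

definition lessU :: "'b set \<Rightarrow> bool"
  where "lessU A \<longleftrightarrow> |A| <o |UNIV :: 'u set|"

lemma small_iff_lessU: "small (A :: 'u set) \<longleftrightarrow> lessU A"
  by (simp add: small_def lessU_def)

lemma infinite_UNIV_u: "infinite (UNIV :: 'u set)"
  using uncountable_UNIV countable_finite by blast

lemma stable_UNIV: "stable |UNIV :: 'u set|"
  using regularCard_stable[OF card_of_Card_order _ regular_UNIV] infinite_UNIV_u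
  by (simp add: Field_card_of)

text \<open>Uncountability of \<open>'u\<close>, as opposed to mere infinity, enters here. Combined
  with regularity it makes countable unions of small sets small, as needed for lists of all lengths
  and terms of all heights.\<close>

lemma lessU_countable:
  assumes "countable A" shows "lessU A"
proof (rule ccontr)
  assume "\<not> lessU A"
  then have "|UNIV :: 'u set| \<le>o |A|"
    unfolding lessU_def using ordLess_or_ordLeq[OF card_of_Well_order card_of_Well_order] by blast
  moreover from assms obtain f :: "_ \<Rightarrow> nat" where "inj_on f A"
    unfolding countable_def by blast
  then have "|A| \<le>o |UNIV :: nat set|" using card_of_ordLeq[of A UNIV] by blast
  ultimately have "|UNIV :: 'u set| \<le>o |UNIV :: nat set|"
    using ordLeq_transitive by blast
  then obtain g :: "'u \<Rightarrow> nat" where "inj_on g UNIV"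
    using card_of_ordLeq[of "UNIV :: 'u set" "UNIV :: nat set"] by blast
  then show False using uncountable_UNIV unfolding countable_def by blast
qed

lemma lessU_finite: "finite A \<Longrightarrow> lessU A"
  using lessU_countable countable_finite by blast

lemma lessU_image: "lessU A \<Longrightarrow> lessU (f ` A)"
  unfolding lessU_def using card_of_image ordLeq_ordLess_trans by blast

lemma lessU_subset: "lessU B \<Longrightarrow> A \<subseteq> B \<Longrightarrow> lessU A"
  unfolding lessU_def using card_of_mono1 ordLeq_ordLess_trans by blast

lemma lessU_UN: "lessU I \<Longrightarrow> (\<And>i. i \<in> I \<Longrightarrow> lessU (A i)) \<Longrightarrow> lessU (\<Union>i\<in>I. A i)"
  unfolding lessU_def using stable_UNION[OF stable_UNIV] by blast

lemma lessU_Sigma: "lessU A \<Longrightarrow> (\<And>a. a \<in> A \<Longrightarrow> lessU (B a)) \<Longrightarrow> lessU (SIGMA a:A. B a)"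
proof -
  assume A: "lessU A" and B: "\<And>a. a \<in> A \<Longrightarrow> lessU (B a)"
  have "(SIGMA a:A. B a) = (\<Union>a\<in>A. Pair a ` B a)" by auto
  then show ?thesis using lessU_UN[OF A, of "\<lambda>a. Pair a ` B a"] B lessU_image by metis
qed

lemma lessU_Un: "lessU A \<Longrightarrow> lessU B \<Longrightarrow> lessU (A \<union> B)"
proof -
  assume "lessU A" "lessU B"
  moreover have "A \<union> B = (\<Union>b\<in>{True, False}. if b then A else B)" by auto
  ultimately show ?thesis
    using lessU_UN[OF lessU_finite, of "{True, False}" "\<lambda>b. if b then A else B"] by simp
qed

lemma lessU_lists:
  assumes "lessU A" shows "lessU (lists A)"
proof -
  have len: "lessU {xs. length xs = n \<and> set xs \<subseteq> A}" for n
  proof (induction n)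
    case 0
    have "{xs. length xs = 0 \<and> set xs \<subseteq> A} = {[]}" by auto
    then show ?case using lessU_finite[of "{[]}"] by simp
  next
    case (Suc n)
    have "{xs. length xs = Suc n \<and> set xs \<subseteq> A}
        \<subseteq> (\<lambda>(x, xs). x # xs) ` (A \<times> {xs. length xs = n \<and> set xs \<subseteq> A})"
      by (force simp: length_Suc_conv image_iff)
    then show ?case by (rule lessU_subset[rotated]) (intro lessU_image lessU_Sigma assms Suc)
  qed
  have "lists A = (\<Union>n\<in>UNIV. {xs. length xs = n \<and> set xs \<subseteq> A})" by (auto simp: in_lists_conv_set)
  then show ?thesis using lessU_UN[OF lessU_countable len, of UNIV "\<lambda>n. n"] by simp
qed

text \<open>This is how objects built outside \<open>'u\<close>, such as equivalence classes of
  terms or pairs of an arity and an operation, become points or symbols of type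
  \<open>'u\<close>.\<close>

lemma lessU_inject:
  assumes "lessU (A :: 'b set)" obtains f :: "'b \<Rightarrow> 'u" where "inj_on f A" "small (f ` A)"
proof -
  from assms have "|A| \<le>o |UNIV :: 'u set|" unfolding lessU_def using ordLess_imp_ordLeq by blast
  then obtain f :: "'b \<Rightarrow> 'u" where "inj_on f A"
    using card_of_ordLeq[of A "UNIV :: 'u set"] by auto
  then show ?thesis using that lessU_image[OF assms] small_iff_lessU by metis
qed

end


section \<open>Ultrametric spaces and nonexpanding maps\<close>

lemma ultrametric_spaceD:
  assumes "ultrametric_space X"
  shows ultra_eq_0: "x \<in> pts X \<Longrightarrow> y \<in> pts X \<Longrightarrow> dst X x y = 0 \<longleftrightarrow> x = y"
    and ultra_sym: "x \<in> pts X \<Longrightarrow> y \<in> pts X \<Longrightarrow> dst X x y = dst X y x"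
    and ultra_tri: "x \<in> pts X \<Longrightarrow> y \<in> pts X \<Longrightarrow> z \<in> pts X \<Longrightarrow>
      dst X x z \<le> max (dst X x y) (dst X y z)"
    and ultra_refl: "x \<in> pts X \<Longrightarrow> dst X x x = 0"
  using assms unfolding ultrametric_space_def by blast+

lemma ultra_tri3:
  assumes "ultrametric_space X" "x \<in> pts X" "y \<in> pts X" "z \<in> pts X"
    and "dst X x y \<le> c" "dst X y z \<le> c"
  shows "dst X x z \<le> c"
  using ultra_tri[OF assms(1-4)] assms(5,6) by (meson max.bounded_iff order_trans)

text \<open>The distance is cut down to \<open>P\<close> because spaces are compared by HOL
  equality.\<close>

definition mk_space :: "'a set \<Rightarrow> ('a \<Rightarrow> 'a \<Rightarrow> ennreal) \<Rightarrow> 'a emetric"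
  where "mk_space P d = \<lparr>pts = P, dst = (\<lambda>x\<in>P. \<lambda>y\<in>P. d x y)\<rparr>"

lemma pts_mk_space [simp]: "pts (mk_space P d) = P"
  by (simp add: mk_space_def)

lemma dst_mk_space [simp]: "x \<in> P \<Longrightarrow> y \<in> P \<Longrightarrow> dst (mk_space P d) x y = d x y"
  by (simp add: mk_space_def)

lemma ultrametric_mk_space:
  assumes "\<And>x y. x \<in> P \<Longrightarrow> y \<in> P \<Longrightarrow> d x y = 0 \<longleftrightarrow> x = y"
    and "\<And>x y. x \<in> P \<Longrightarrow> y \<in> P \<Longrightarrow> d x y = d y x"
    and "\<And>x y z. x \<in> P \<Longrightarrow> y \<in> P \<Longrightarrow> z \<in> P \<Longrightarrow> d x z \<le> max (d x y) (d y z)"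
  shows "ultrametric_space (mk_space P d)"
  unfolding ultrametric_space_def using assms by (auto simp: mk_space_def)

lemma nonexpandingI:
  assumes "f \<in> extensional (pts X)" "\<And>x. x \<in> pts X \<Longrightarrow> f x \<in> pts Y"
    and "\<And>x y. x \<in> pts X \<Longrightarrow> y \<in> pts X \<Longrightarrow> dst Y (f x) (f y) \<le> dst X x y"
  shows "f \<in> nonexpanding X Y"
  using assms unfolding nonexpanding_def by (auto simp: PiE_def)

lemma nonexpanding_pts: "f \<in> nonexpanding X Y \<Longrightarrow> x \<in> pts X \<Longrightarrow> f x \<in> pts Y"
  unfolding nonexpanding_def by auto

lemma nonexpanding_ext: "f \<in> nonexpanding X Y \<Longrightarrow> f \<in> extensional (pts X)"
  unfolding nonexpanding_def by (auto simp: PiE_def)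

lemma nonexpanding_le:
  "f \<in> nonexpanding X Y \<Longrightarrow> x \<in> pts X \<Longrightarrow> y \<in> pts X \<Longrightarrow> dst Y (f x) (f y) \<le> dst X x y"
  unfolding nonexpanding_def by auto

lemma nonexpanding_eqI:
  "f \<in> nonexpanding X Y \<Longrightarrow> g \<in> nonexpanding X Z \<Longrightarrow> (\<And>x. x \<in> pts X \<Longrightarrow> f x = g x) \<Longrightarrow> f = g"
  using nonexpanding_ext extensionalityI by metis

lemma nonexpanding_id: "(\<lambda>x\<in>pts X. x) \<in> nonexpanding X X"
  by (rule nonexpandingI) auto

lemma nonexpanding_compose:
  assumes "f \<in> nonexpanding X Y" "g \<in> nonexpanding Y Z"
  shows "compose (pts X) g f \<in> nonexpanding X Z"
  using assms
  by (intro nonexpandingI)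
    (auto simp: compose_eq intro: nonexpanding_pts order_trans[OF nonexpanding_le nonexpanding_le])

lemma compose_eqI: "(\<And>x. x \<in> S \<Longrightarrow> g (f x) = g' (f' x)) \<Longrightarrow> compose S g f = compose S g' f'"
  unfolding compose_def by (rule restrict_ext)

lemma sup_dist_le: "(\<And>x. x \<in> pts X \<Longrightarrow> dst Y (f x) (g x) \<le> c) \<Longrightarrow> sup_dist X Y f g \<le> c"
  unfolding sup_dist_def by (rule SUP_least)

lemma le_sup_dist: "x \<in> pts X \<Longrightarrow> dst Y (f x) (g x) \<le> sup_dist X Y f g"
  unfolding sup_dist_def by (rule SUP_upper)

section \<open>Discrete spaces and the categories \<open>UMet\<close> and
  \<open>Set_fp\<close>\<close>

definition disc :: "'a set \<Rightarrow> 'a emetric"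
  where "disc D = mk_space D (\<lambda>x y. if x = y then 0 else \<infinity>)"

lemma pts_disc [simp]: "pts (disc D) = D"
  by (simp add: disc_def)

lemma ultrametric_disc: "ultrametric_space (disc D)"
  unfolding disc_def by (rule ultrametric_mk_space) auto

lemma discrete_disc: "discrete_space (disc D)"
  unfolding discrete_space_def using ultrametric_disc by (auto simp: disc_def)

text \<open>Distinct points are at distance \<infinity>, so the nonexpanding condition only has
  content for \<open>x = y\<close>, where the distance in \<open>X\<close> vanishes.\<close>

lemma nonexpanding_discrete:
  assumes "discrete_space N" "ultrametric_space X"
  shows "nonexpanding N X = pts N \<rightarrow>\<^sub>E pts X"
proof
  show "nonexpanding N X \<subseteq> pts N \<rightarrow>\<^sub>E pts X" unfolding nonexpanding_def by auto
  show "pts N \<rightarrow>\<^sub>E pts X \<subseteq> nonexpanding N X"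
  proof
    fix f assume f: "f \<in> pts N \<rightarrow>\<^sub>E pts X"
    show "f \<in> nonexpanding N X"
    proof (rule nonexpandingI)
      fix x y assume "x \<in> pts N" "y \<in> pts N"
      then show "dst X (f x) (f y) \<le> dst N x y"
        using assms ultra_refl[OF assms(2), of "f x"] PiE_mem[OF f, of x]
        by (cases "x = y") (auto simp: discrete_space_def)
    qed (use f in \<open>auto simp: PiE_def\<close>)
  qed
qed

lemma Ob_UMet: "X \<in> Ob UMet \<longleftrightarrow> ultrametric_space X \<and> small (pts X)"
  and Hom_UMet [simp]: "Hom UMet = nonexpanding"
  and Idt_UMet [simp]: "Idt UMet X = (\<lambda>x\<in>pts X. x)"
  and Cmp_UMet [simp]: "Cmp UMet X Y Z g f = compose (pts X) g f"
  by (simp_all add: UMet_def)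

lemma Ob_UMetD: "X \<in> Ob UMet \<Longrightarrow> ultrametric_space X"
  by (simp add: Ob_UMet)

lemma Ob_Set_fp: "N \<in> Ob Set_fp \<longleftrightarrow> N \<in> Ob UMet \<and> discrete_space N \<and> finite (pts N)"
  and Hom_Set_fp [simp]: "Hom Set_fp = nonexpanding"
  and Idt_Set_fp [simp]: "Idt Set_fp X = (\<lambda>x\<in>pts X. x)"
  and Cmp_Set_fp [simp]: "Cmp Set_fp X Y Z g f = compose (pts X) g f"
  by (auto simp: UMet_def Set_fp_def full_subcategory_def)

lemma hom_space_UMet: "hom_space UMet X Y = mk_space (nonexpanding X Y) (sup_dist X Y)"
  and hom_space_Set_fp: "hom_space Set_fp X Y = mk_space (nonexpanding X Y) (sup_dist X Y)"
  by (auto simp: UMet_def Set_fp_def full_subcategory_def hom_space_def mk_space_def)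

lemma (in universe) disc_Ob_Set_fp: "finite D \<Longrightarrow> disc (D :: 'u set) \<in> Ob Set_fp"
  by (simp add: Ob_Set_fp Ob_UMet ultrametric_disc discrete_disc small_iff_lessU lessU_finite)

lemma nonexpanding_Set_fp: "N \<in> Ob Set_fp \<Longrightarrow> X \<in> Ob UMet \<Longrightarrow> nonexpanding N X = pts N \<rightarrow>\<^sub>E pts X"
  using nonexpanding_discrete by (auto simp: Ob_Set_fp Ob_UMet)

lemma nonexpanding_disc: "X \<in> Ob UMet \<Longrightarrow> nonexpanding (disc D) X = D \<rightarrow>\<^sub>E pts X"
  using nonexpanding_discrete[OF discrete_disc] by (auto simp: Ob_UMet)


section \<open>Fully faithful and essentially surjective functors\<close>

text \<open>The inverse functor picks for each \<open>d\<close> an object whose image is isomorphic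
  to \<open>d\<close> and sends a morphism to the preimage of its conjugate by the chosen
  isomorphisms. Equations in \<open>C\<close> are tested after applying the faithful
  \<open>F\<close>, equations in \<open>D\<close> after composing with an isomorphism
  \<open>ep d\<close>.\<close>

lemma full_faithful_equivalence:
  assumes C: "category C" and D: "category D" and F: "is_functor C D F"
    and ff: "\<And>a b. a \<in> Ob C \<Longrightarrow> b \<in> Ob C \<Longrightarrow>
      bij_betw (FM F a b) (Hom C a b) (Hom D (FO F a) (FO F b))"
    and es: "\<And>d. d \<in> Ob D \<Longrightarrow> \<exists>c\<in>Ob C. \<exists>f. is_iso D (FO F c) d f"
  shows "equivalent_categories C D"
proof -
  define fo where "fo = FO F"
  define fm where "fm = FM F"
  have FO: "a \<in> Ob C \<Longrightarrow> fo a \<in> Ob D" for a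
    using F unfolding is_functor_def fo_def by auto
  have FMH: "a \<in> Ob C \<Longrightarrow> b \<in> Ob C \<Longrightarrow> f \<in> Hom C a b \<Longrightarrow> fm a b f \<in> Hom D (fo a) (fo b)" for a b f
    using F unfolding is_functor_def fo_def fm_def by blast
  have FMi: "a \<in> Ob C \<Longrightarrow> fm a a (Idt C a) = Idt D (fo a)" for a
    using F unfolding is_functor_def fo_def fm_def by blast
  have FMc: "\<lbrakk>a \<in> Ob C; b \<in> Ob C; c \<in> Ob C; f \<in> Hom C a b; g \<in> Hom C b c\<rbrakk> \<Longrightarrow>
      fm a c (Cmp C a b c g f) = Cmp D (fo a) (fo b) (fo c) (fm b c g) (fm a b f)" for a b c f g
    using F unfolding is_functor_def fo_def fm_def by blast
  have Ci: "a \<in> Ob C \<Longrightarrow> Idt C a \<in> Hom C a a" for a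
    using C unfolding category_def by blast
  have Cc: "\<lbrakk>a \<in> Ob C; b \<in> Ob C; c \<in> Ob C; f \<in> Hom C a b; g \<in> Hom C b c\<rbrakk> \<Longrightarrow>
      Cmp C a b c g f \<in> Hom C a c" for a b c f g
    using C unfolding category_def by blast
  have Di: "a \<in> Ob D \<Longrightarrow> Idt D a \<in> Hom D a a" for a
    using D unfolding category_def by blast
  have Dc: "\<lbrakk>a \<in> Ob D; b \<in> Ob D; c \<in> Ob D; f \<in> Hom D a b; g \<in> Hom D b c\<rbrakk> \<Longrightarrow>
      Cmp D a b c g f \<in> Hom D a c" for a b c f g
    using D unfolding category_def by blast
  have Dr: "\<lbrakk>a \<in> Ob D; b \<in> Ob D; f \<in> Hom D a b\<rbrakk> \<Longrightarrow> Cmp D a a b f (Idt D a) = f" for a b f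
    using D unfolding category_def by blast
  have Dl: "\<lbrakk>a \<in> Ob D; b \<in> Ob D; f \<in> Hom D a b\<rbrakk> \<Longrightarrow> Cmp D a b b (Idt D b) f = f" for a b f
    using D unfolding category_def by blast
  have Da: "\<lbrakk>a \<in> Ob D; b \<in> Ob D; c \<in> Ob D; d \<in> Ob D; f \<in> Hom D a b; g \<in> Hom D b c; h \<in> Hom D c d\<rbrakk> \<Longrightarrow>
       Cmp D a b d (Cmp D b c d h g) f = Cmp D a c d h (Cmp D a b c g f)" for a b c d f g h
    using D unfolding category_def by blast
  \<comment> \<open>Hom-sets need not be disjoint, so preimages under \<open>F\<close> are taken
    separately for each pair of objects.\<close>
  define inv where "inv a b = inv_into (Hom C a b) (fm a b)" for a b
  have invH: "\<lbrakk>a \<in> Ob C; b \<in> Ob C; g \<in> Hom D (fo a) (fo b)\<rbrakk> \<Longrightarrow> inv a b g \<in> Hom C a b" for a b g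
    using ff[of a b] unfolding inv_def fm_def fo_def by (metis bij_betw_def inv_into_into)
  have Finv: "\<lbrakk>a \<in> Ob C; b \<in> Ob C; g \<in> Hom D (fo a) (fo b)\<rbrakk> \<Longrightarrow> fm a b (inv a b g) = g" for a b g
    using ff[of a b] unfolding inv_def fm_def fo_def by (metis bij_betw_inv_into_right)
  have inj: "\<lbrakk>a \<in> Ob C; b \<in> Ob C; f \<in> Hom C a b; g \<in> Hom C a b; fm a b f = fm a b g\<rbrakk> \<Longrightarrow> f = g" for a b f g
    using ff[of a b] unfolding fm_def by (metis bij_betw_def inj_onD)
  have "\<forall>d\<in>Ob D. \<exists>c e k. c \<in> Ob C \<and> e \<in> Hom D (fo c) d \<and> k \<in> Hom D d (fo c) \<and>
      Cmp D (fo c) d (fo c) k e = Idt D (fo c) \<and> Cmp D d (fo c) d e k = Idt D d"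
    using es unfolding is_iso_def fo_def by blast
  then obtain go ep ki where
    go: "\<And>d. d \<in> Ob D \<Longrightarrow> go d \<in> Ob C" and
    ep: "\<And>d. d \<in> Ob D \<Longrightarrow> ep d \<in> Hom D (fo (go d)) d" and
    ki: "\<And>d. d \<in> Ob D \<Longrightarrow> ki d \<in> Hom D d (fo (go d))" and
    ke: "\<And>d. d \<in> Ob D \<Longrightarrow> Cmp D (fo (go d)) d (fo (go d)) (ki d) (ep d) = Idt D (fo (go d))" and
    ek: "\<And>d. d \<in> Ob D \<Longrightarrow> Cmp D d (fo (go d)) d (ep d) (ki d) = Idt D d"
    by metis
  \<comment> \<open>The conjugate of \<open>g : d \<rightarrow> d'\<close> by the chosen
    isomorphisms: \<open>ep d\<close>, followed by \<open>g\<close>, followed by the inverse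
    \<open>ki d'\<close> of \<open>ep d'\<close>.\<close>
  define gd where "gd d d' g = Cmp D (fo (go d)) d' (fo (go d')) (ki d') (Cmp D (fo (go d)) d d' g (ep d))"
    for d d' g
  have gdH: "\<lbrakk>d \<in> Ob D; d' \<in> Ob D; g \<in> Hom D d d'\<rbrakk> \<Longrightarrow> gd d d' g \<in> Hom D (fo (go d)) (fo (go d'))" for d d' g
    unfolding gd_def by (intro Dc[of _ d'] Dc[of _ d] FO go ep ki)
  have gd_ep: "Cmp D (fo (go d)) (fo (go d')) d' (ep d') (gd d d' g) = Cmp D (fo (go d)) d d' g (ep d)"
    if "d \<in> Ob D" "d' \<in> Ob D" "g \<in> Hom D d d'" for d d' g
  proof -
    have 1: "Cmp D (fo (go d)) d d' g (ep d) \<in> Hom D (fo (go d)) d'"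
      using that by (intro Dc[of _ d] FO go ep)
    have "Cmp D (fo (go d)) (fo (go d')) d' (ep d') (gd d d' g) =
      Cmp D (fo (go d)) d' d' (Cmp D d' (fo (go d')) d' (ep d') (ki d')) (Cmp D (fo (go d)) d d' g (ep d))"
      unfolding gd_def using that 1 by (intro Da[symmetric] FO go ep ki)
    then show ?thesis using that 1 ek FO go Dl by simp
  qed
  \<comment> \<open>\<open>ep d\<close> has the left inverse \<open>ki d\<close>, hence is a
    monomorphism.\<close>
  have ep_cancel: "x = y" if "d \<in> Ob D" "a \<in> Ob D" "x \<in> Hom D a (fo (go d))" "y \<in> Hom D a (fo (go d))"
    "Cmp D a (fo (go d)) d (ep d) x = Cmp D a (fo (go d)) d (ep d) y" for d a x y
  proof -
    have "z = Cmp D a d (fo (go d)) (ki d) (Cmp D a (fo (go d)) d (ep d) z)"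
      if "z \<in> Hom D a (fo (go d))" for z
      using Da[of a "fo (go d)" d "fo (go d)" z "ep d" "ki d"] that \<open>d \<in> Ob D\<close> \<open>a \<in> Ob D\<close>
        FO go ep ki ke Dl by simp
    then show ?thesis using that by metis
  qed
  define G where "G = \<lparr>FO = (\<lambda>d\<in>Ob D. go d),
    FM = (\<lambda>d\<in>Ob D. \<lambda>d'\<in>Ob D. \<lambda>g\<in>Hom D d d'. inv (go d) (go d') (gd d d' g))\<rparr>"
  have GO: "d \<in> Ob D \<Longrightarrow> FO G d = go d" for d by (simp add: G_def)
  have GM: "\<lbrakk>d \<in> Ob D; d' \<in> Ob D; g \<in> Hom D d d'\<rbrakk> \<Longrightarrow> FM G d d' g = inv (go d) (go d') (gd d d' g)" for d d' g
    by (simp add: G_def)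
  have G: "is_functor D C G"
    unfolding is_functor_def
  proof (intro conjI ballI)
    show "FO G \<in> Ob D \<rightarrow>\<^sub>E Ob C" using go by (auto simp: G_def)
    show "FM G \<in> extensional (Ob D)" by (auto simp: G_def)
    fix a assume a: "a \<in> Ob D"
    show "FM G a \<in> extensional (Ob D)" using a by (auto simp: G_def)
    show "FM G a a (Idt D a) = Idt C (FO G a)"
    proof -
      have "gd a a (Idt D a) = Idt D (fo (go a))"
        unfolding gd_def using a Dl[of "fo (go a)" a "ep a"] FO go ep ke by simp
      then show ?thesis
        using a GM[OF a a Di] GO inj[of "go a" "go a"] Finv[of "go a" "go a"] invH[of "go a" "go a"]
          FMi Di FO go Ci by simp
    qed
    fix b assume b: "b \<in> Ob D"
    show "FM G a b \<in> Hom D a b \<rightarrow>\<^sub>E Hom C (FO G a) (FO G b)"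
      using a b by (auto simp: G_def intro!: invH gdH go)
    fix c f g assume c: "c \<in> Ob D" and f: "f \<in> Hom D a b" and g: "g \<in> Hom D b c"
    have 1: "gd a c (Cmp D a b c g f) = Cmp D (fo (go a)) (fo (go b)) (fo (go c)) (gd b c g) (gd a b f)"
    proof (rule ep_cancel[OF c, of "fo (go a)"])
      have "Cmp D (fo (go a)) (fo (go c)) c (ep c) (Cmp D (fo (go a)) (fo (go b)) (fo (go c)) (gd b c g) (gd a b f))
        = Cmp D (fo (go a)) (fo (go b)) c (Cmp D (fo (go b)) (fo (go c)) c (ep c) (gd b c g)) (gd a b f)"
        using a b c f g by (intro Da[symmetric] FO go gdH ep)
      also have "\<dots> = Cmp D (fo (go a)) (fo (go b)) c (Cmp D (fo (go b)) b c g (ep b)) (gd a b f)"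
        using gd_ep b c g by simp
      also have "\<dots> = Cmp D (fo (go a)) b c g (Cmp D (fo (go a)) (fo (go b)) b (ep b) (gd a b f))"
        using a b c f g by (intro Da FO go gdH ep)
      also have "\<dots> = Cmp D (fo (go a)) b c g (Cmp D (fo (go a)) a b f (ep a))"
        using gd_ep a b f by simp
      also have "\<dots> = Cmp D (fo (go a)) a c (Cmp D a b c g f) (ep a)"
        using a b c f g by (intro Da[symmetric] FO go ep)
      also have "\<dots> = Cmp D (fo (go a)) (fo (go c)) c (ep c) (gd a c (Cmp D a b c g f))"
        using gd_ep a c Dc[OF a b c f g] by simp
      finally show "Cmp D (fo (go a)) (fo (go c)) c (ep c) (gd a c (Cmp D a b c g f)) =
        Cmp D (fo (go a)) (fo (go c)) c (ep c) (Cmp D (fo (go a)) (fo (go b)) (fo (go c)) (gd b c g) (gd a b f))"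
        by simp
    qed (use a b c f g in \<open>auto intro!: gdH Dc[OF a b c] FO go Dc[of _ "fo (go b)"]\<close>)
    have gH: "gd b c g \<in> Hom D (fo (go b)) (fo (go c))" "gd a b f \<in> Hom D (fo (go a)) (fo (go b))"
      "gd a c (Cmp D a b c g f) \<in> Hom D (fo (go a)) (fo (go c))"
      using a b c f g by (auto intro!: gdH Dc[OF a b c])
    show "FM G a c (Cmp D a b c g f) = Cmp C (FO G a) (FO G b) (FO G c) (FM G b c g) (FM G a b f)"
      unfolding GM[OF a c Dc[OF a b c f g]] GM[OF b c g] GM[OF a b f] GO[OF a] GO[OF b] GO[OF c]
      using a b c gH
      by (intro inj[of "go a" "go c"])
        (auto simp: Finv FMc[of "go a" "go b" "go c"] go invH 1 intro!: invH Cc[of _ "go b"])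
  qed
  \<comment> \<open>The unit at \<open>c\<close> has to become, under \<open>F\<close>, the inverse
    of the counit at \<open>F c\<close>; this inverse is \<open>ki (fo c)\<close>, and fullness
    lifts it to \<open>C\<close>.\<close>
  define al where "al = (\<lambda>c\<in>Ob C. inv c (go (fo c)) (ki (fo c)))"
  have alE: "c \<in> Ob C \<Longrightarrow> al c = inv c (go (fo c)) (ki (fo c))" for c by (simp add: al_def)
  have alH: "c \<in> Ob C \<Longrightarrow> al c \<in> Hom C c (go (fo c))" for c
    using FO go ki by (auto simp: alE intro!: invH)
  have Fal: "c \<in> Ob C \<Longrightarrow> fm c (go (fo c)) (al c) = ki (fo c)" for c
    using FO go ki Finv by (auto simp: alE)
  have A: "natural_iso C C (id_functor C) (comp_functor C G F) al"
    unfolding natural_iso_def natural_transformation_def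
  proof (intro conjI ballI)
    show "al \<in> (\<Pi>\<^sub>E a\<in>Ob C. Hom C (FO (id_functor C) a) (FO (comp_functor C G F) a))"
      using alH GO FO by (auto simp: id_functor_def comp_functor_def fo_def[symmetric] al_def)
    fix a assume a: "a \<in> Ob C"
    show "is_iso C (FO (id_functor C) a) (FO (comp_functor C G F) a) (al a)"
    proof -
      let ?g = "inv (go (fo a)) a (ep (fo a))"
      have gH: "?g \<in> Hom C (go (fo a)) a" using a FO go ep by (auto intro!: invH)
      have Fg: "fm (go (fo a)) a ?g = ep (fo a)" using a FO go ep Finv by auto
      have "Cmp C a (go (fo a)) a ?g (al a) = Idt C a"
        using a FO go gH alH Fg Fal ek by (intro inj[of a a]) (auto intro!: Cc Ci simp: FMc FMi)
      moreover have "Cmp C (go (fo a)) a (go (fo a)) (al a) ?g = Idt C (go (fo a))"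
        using a FO go gH alH Fg Fal ke
        by (intro inj[of "go (fo a)" "go (fo a)"]) (auto intro!: Cc Ci simp: FMc FMi)
      ultimately show ?thesis unfolding is_iso_def using a gH alH GO FO
        by (auto simp: id_functor_def comp_functor_def fo_def[symmetric])
    qed
    fix b f assume b: "b \<in> Ob C" and f: "f \<in> Hom C a b"
    have f': "FM (id_functor C) a b f \<in> Hom C a b" using a b f by (simp add: id_functor_def)
    have Ff: "fm a b f \<in> Hom D (fo a) (fo b)" using FMH a b f by simp
    have gH: "gd (fo a) (fo b) (fm a b f) \<in> Hom D (fo (go (fo a))) (fo (go (fo b)))"
      using FO a b Ff by (intro gdH)
    have "Cmp C a (go (fo a)) (go (fo b)) (inv (go (fo a)) (go (fo b)) (gd (fo a) (fo b) (fm a b f))) (al a)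
      = Cmp C a b (go (fo b)) (al b) f"
    proof (rule inj[of a "go (fo b)"])
      have "fm a (go (fo b)) (Cmp C a (go (fo a)) (go (fo b)) (inv (go (fo a)) (go (fo b)) (gd (fo a) (fo b) (fm a b f))) (al a))
        = Cmp D (fo a) (fo (go (fo a))) (fo (go (fo b))) (gd (fo a) (fo b) (fm a b f)) (ki (fo a))"
        using a b FO go gH alH by (simp add: FMc invH Fal Finv)
      also have "\<dots> = Cmp D (fo a) (fo b) (fo (go (fo b))) (ki (fo b)) (fm a b f)"
      proof (rule ep_cancel[of "fo b" "fo a"])
        have "Cmp D (fo a) (fo (go (fo b))) (fo b) (ep (fo b)) (Cmp D (fo a) (fo (go (fo a))) (fo (go (fo b))) (gd (fo a) (fo b) (fm a b f)) (ki (fo a)))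
          = Cmp D (fo a) (fo (go (fo a))) (fo b) (Cmp D (fo (go (fo a))) (fo (go (fo b))) (fo b) (ep (fo b)) (gd (fo a) (fo b) (fm a b f))) (ki (fo a))"
          using a b gH by (intro Da[symmetric] FO go ep ki)
        also have "\<dots> = Cmp D (fo a) (fo (go (fo a))) (fo b) (Cmp D (fo (go (fo a))) (fo a) (fo b) (fm a b f) (ep (fo a))) (ki (fo a))"
          using gd_ep FO a b Ff by simp
        also have "\<dots> = Cmp D (fo a) (fo a) (fo b) (fm a b f) (Cmp D (fo a) (fo (go (fo a))) (fo a) (ep (fo a)) (ki (fo a)))"
          using a b Ff by (intro Da FO go ep ki)
        also have "\<dots> = fm a b f" using ek FO a b Ff Dr by simp
        also have "\<dots> = Cmp D (fo a) (fo b) (fo b) (Cmp D (fo b) (fo (go (fo b))) (fo b) (ep (fo b)) (ki (fo b))) (fm a b f)"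
          using ek FO a b Ff Dl by simp
        also have "\<dots> = Cmp D (fo a) (fo (go (fo b))) (fo b) (ep (fo b)) (Cmp D (fo a) (fo b) (fo (go (fo b))) (ki (fo b)) (fm a b f))"
          using a b Ff by (intro Da FO go ep ki)
        finally show "Cmp D (fo a) (fo (go (fo b))) (fo b) (ep (fo b)) (Cmp D (fo a) (fo (go (fo a))) (fo (go (fo b))) (gd (fo a) (fo b) (fm a b f)) (ki (fo a)))
          = Cmp D (fo a) (fo (go (fo b))) (fo b) (ep (fo b)) (Cmp D (fo a) (fo b) (fo (go (fo b))) (ki (fo b)) (fm a b f))" .
      next
        show "Cmp D (fo a) (fo (go (fo a))) (fo (go (fo b))) (gd (fo a) (fo b) (fm a b f)) (ki (fo a)) \<in> Hom D (fo a) (fo (go (fo b)))"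
          using a b gH by (intro Dc[of _ "fo (go (fo a))"] FO go ki)
        show "Cmp D (fo a) (fo b) (fo (go (fo b))) (ki (fo b)) (fm a b f) \<in> Hom D (fo a) (fo (go (fo b)))"
          using a b Ff by (intro Dc[of _ "fo b"] FO go ki)
      qed (use a b FO in auto)
      also have "\<dots> = fm a (go (fo b)) (Cmp C a b (go (fo b)) (al b) f)"
        using a b FO go f alH by (simp add: FMc Fal)
      finally show "fm a (go (fo b)) (Cmp C a (go (fo a)) (go (fo b)) (inv (go (fo a)) (go (fo b)) (gd (fo a) (fo b) (fm a b f))) (al a))
        = fm a (go (fo b)) (Cmp C a b (go (fo b)) (al b) f)" .
    qed (use a b f gH FO go alH in \<open>auto intro!: Cc[of a "go (fo a)"] Cc[of a b] invH\<close>)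
    then show "Cmp C (FO (id_functor C) a) (FO (comp_functor C G F) a) (FO (comp_functor C G F) b)
        (FM (comp_functor C G F) a b f) (al a) =
      Cmp C (FO (id_functor C) a) (FO (id_functor C) b) (FO (comp_functor C G F) b) (al b) (FM (id_functor C) a b f)"
      using a b f FO Ff by (simp add: id_functor_def comp_functor_def fo_def[symmetric] fm_def[symmetric] GO GM)
  qed
  define be where "be = (\<lambda>d\<in>Ob D. ep d)"
  have B: "natural_iso D D (comp_functor D F G) (id_functor D) be"
    unfolding natural_iso_def natural_transformation_def
  proof (intro conjI ballI)
    show "be \<in> (\<Pi>\<^sub>E a\<in>Ob D. Hom D (FO (comp_functor D F G) a) (FO (id_functor D) a))"
      using ep GO by (auto simp: be_def id_functor_def comp_functor_def fo_def[symmetric])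
    fix a assume a: "a \<in> Ob D"
    show "is_iso D (FO (comp_functor D F G) a) (FO (id_functor D) a) (be a)"
      unfolding is_iso_def using a ep[OF a] ki[OF a] ke[OF a] ek[OF a]
      by (auto simp: be_def id_functor_def comp_functor_def fo_def[symmetric] GO intro!: bexI[of _ "ki a"])
    fix b f assume b: "b \<in> Ob D" and f: "f \<in> Hom D a b"
    show "Cmp D (FO (comp_functor D F G) a) (FO (id_functor D) a) (FO (id_functor D) b) (FM (id_functor D) a b f) (be a) =
      Cmp D (FO (comp_functor D F G) a) (FO (comp_functor D F G) b) (FO (id_functor D) b) (be b) (FM (comp_functor D F G) a b f)"
      using a b f gd_ep[OF a b f] Finv[OF go go gdH] gdH
      by (simp add: be_def id_functor_def comp_functor_def fo_def[symmetric] fm_def[symmetric] GO GM)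
  qed
  show ?thesis unfolding equivalent_categories_def using C D F G A B by blast
qed


section \<open>Monads on ultrametric spaces and their algebras\<close>

lemma enriched_functor_UMet:
  "enriched_functor UMet UMet F \<longleftrightarrow> is_functor UMet UMet F \<and>
    (\<forall>X\<in>Ob UMet. \<forall>Y\<in>Ob UMet. \<forall>f\<in>nonexpanding X Y. \<forall>g\<in>nonexpanding X Y.
      sup_dist (FO F X) (FO F Y) (FM F X Y f) (FM F X Y g) \<le> sup_dist X Y f g)"
proof -
  have P: "FM F X Y \<in> nonexpanding X Y \<rightarrow>\<^sub>E nonexpanding (FO F X) (FO F Y)"
    if "is_functor UMet UMet F" "X \<in> Ob UMet" "Y \<in> Ob UMet" for X Y
    using that unfolding is_functor_def by simp
  have "FM F X Y \<in> nonexpanding (hom_space UMet X Y) (hom_space UMet (FO F X) (FO F Y)) \<longleftrightarrow>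
      (\<forall>f\<in>nonexpanding X Y. \<forall>g\<in>nonexpanding X Y.
        sup_dist (FO F X) (FO F Y) (FM F X Y f) (FM F X Y g) \<le> sup_dist X Y f g)"
    if "is_functor UMet UMet F" "X \<in> Ob UMet" "Y \<in> Ob UMet" for X Y
    using P[OF that] PiE_mem[OF P[OF that]]
    unfolding hom_space_UMet nonexpanding_def[of "mk_space _ _"] by simp
  then show ?thesis unfolding enriched_functor_def by auto
qed

lemma FO_id_functor [simp]: "a \<in> Ob C \<Longrightarrow> FO (id_functor C) a = a"
  and FM_id_functor [simp]: "\<lbrakk>a \<in> Ob C; b \<in> Ob C; f \<in> Hom C a b\<rbrakk> \<Longrightarrow> FM (id_functor C) a b f = f"
  by (simp_all add: id_functor_def)

lemma FO_comp_functor [simp]: "a \<in> Ob C \<Longrightarrow> FO (comp_functor C G F) a = FO G (FO F a)"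
  and FM_comp_functor [simp]: "\<lbrakk>a \<in> Ob C; b \<in> Ob C; f \<in> Hom C a b\<rbrakk> \<Longrightarrow>
    FM (comp_functor C G F) a b f = FM G (FO F a) (FO F b) (FM F a b f)"
  by (simp_all add: comp_functor_def)

lemma natural_transformation_UMetI:
  assumes "\<alpha> \<in> extensional (Ob UMet)"
    and "\<And>X. X \<in> Ob UMet \<Longrightarrow> \<alpha> X \<in> nonexpanding (FO F X) (FO G X)"
    and "\<And>X Y f x. \<lbrakk>X \<in> Ob UMet; Y \<in> Ob UMet; f \<in> nonexpanding X Y; x \<in> pts (FO F X)\<rbrakk> \<Longrightarrow>
      FM G X Y f (\<alpha> X x) = \<alpha> Y (FM F X Y f x)"
  shows "natural_transformation UMet UMet F G \<alpha>"
  unfolding natural_transformation_def using assms by (auto simp: PiE_def intro!: compose_eqI)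

lemma natural_transformation_UMetD:
  assumes "natural_transformation UMet UMet F G \<alpha>"
  shows "\<alpha> \<in> extensional (Ob UMet)"
    and "X \<in> Ob UMet \<Longrightarrow> \<alpha> X \<in> nonexpanding (FO F X) (FO G X)"
    and "\<lbrakk>X \<in> Ob UMet; Y \<in> Ob UMet; f \<in> nonexpanding X Y; x \<in> pts (FO F X)\<rbrakk> \<Longrightarrow>
      FM G X Y f (\<alpha> X x) = \<alpha> Y (FM F X Y f x)"
proof -
  show "\<alpha> \<in> extensional (Ob UMet)" using assms by (auto simp: natural_transformation_def PiE_def)
  show "X \<in> Ob UMet \<Longrightarrow> \<alpha> X \<in> nonexpanding (FO F X) (FO G X)"
    using assms by (auto simp: natural_transformation_def)
  assume *: "X \<in> Ob UMet" "Y \<in> Ob UMet" "f \<in> nonexpanding X Y" "x \<in> pts (FO F X)"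
  then have "compose (pts (FO F X)) (FM G X Y f) (\<alpha> X) = compose (pts (FO F X)) (\<alpha> Y) (FM F X Y f)"
    using assms by (auto simp: natural_transformation_def)
  from fun_cong[OF this, of x] show "FM G X Y f (\<alpha> X x) = \<alpha> Y (FM F X Y f x)"
    using * by (simp add: compose_eq)
qed

section \<open>Enriched endofunctors and monads, evaluated at points\<close>

locale endofunctor =
  fixes F :: "('u emetric, 'u \<Rightarrow> 'u, 'u emetric, 'u \<Rightarrow> 'u) fctr"
  assumes enriched: "enriched_functor UMet UMet F"
begin

lemma is_functor: "is_functor UMet UMet F"
  using enriched by (simp add: enriched_functor_UMet)

lemma FO_Ob: "X \<in> Ob UMet \<Longrightarrow> FO F X \<in> Ob UMet"
  using is_functor by (auto simp: is_functor_def)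

lemma FM_in: "\<lbrakk>X \<in> Ob UMet; Y \<in> Ob UMet; f \<in> nonexpanding X Y\<rbrakk> \<Longrightarrow>
    FM F X Y f \<in> nonexpanding (FO F X) (FO F Y)"
  using is_functor unfolding is_functor_def Hom_UMet by (blast intro: PiE_mem)

lemma FM_pts: "\<lbrakk>X \<in> Ob UMet; Y \<in> Ob UMet; f \<in> nonexpanding X Y; t \<in> pts (FO F X)\<rbrakk> \<Longrightarrow>
    FM F X Y f t \<in> pts (FO F Y)"
  by (rule nonexpanding_pts[OF FM_in])

lemma FM_id: "\<lbrakk>X \<in> Ob UMet; t \<in> pts (FO F X)\<rbrakk> \<Longrightarrow> FM F X X (\<lambda>x\<in>pts X. x) t = t"
  using is_functor unfolding is_functor_def by simp

lemma FM_comp: "\<lbrakk>X \<in> Ob UMet; Y \<in> Ob UMet; Z \<in> Ob UMet; f \<in> nonexpanding X Y; g \<in> nonexpanding Y Z;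
    t \<in> pts (FO F X)\<rbrakk> \<Longrightarrow> FM F X Z (compose (pts X) g f) t = FM F Y Z g (FM F X Y f t)"
  using is_functor unfolding is_functor_def by (simp add: compose_eq)

text \<open>The pointwise content of enrichment. For a monad this inequality later makes the
  operations on an Eilenberg-Moore algebra nonexpanding.\<close>

lemma FM_le:
  assumes "X \<in> Ob UMet" "Y \<in> Ob UMet" "f \<in> nonexpanding X Y" "g \<in> nonexpanding X Y" "t \<in> pts (FO F X)"
  shows "dst (FO F Y) (FM F X Y f t) (FM F X Y g t) \<le> sup_dist X Y f g"
  using enriched assms le_sup_dist[of t "FO F X" "FO F Y"] unfolding enriched_functor_UMet
  by (meson order_trans)

end

locale umonad =
  fixes M :: "('u emetric, 'u \<Rightarrow> 'u) mnd"
  assumes enriched_monad: "enriched_monad UMet M"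
begin

abbreviation T where "T \<equiv> FO (endo M)"
abbreviation TM where "TM \<equiv> FM (endo M)"

sublocale endofunctor "endo M"
  using enriched_monad by unfold_locales (simp add: enriched_monad_def Let_def)

lemma eta_nt: "natural_transformation UMet UMet (id_functor UMet) (endo M) (eta M)"
  and mu_nt: "natural_transformation UMet UMet (comp_functor UMet (endo M) (endo M)) (endo M) (mu M)"
  using enriched_monad unfolding enriched_monad_def Let_def by blast+

lemma eta_in: "X \<in> Ob UMet \<Longrightarrow> eta M X \<in> nonexpanding X (T X)"
  using natural_transformation_UMetD(2)[OF eta_nt] by simp

lemma eta_nat: "\<lbrakk>X \<in> Ob UMet; Y \<in> Ob UMet; f \<in> nonexpanding X Y; x \<in> pts X\<rbrakk> \<Longrightarrow>
    TM X Y f (eta M X x) = eta M Y (f x)"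
  using natural_transformation_UMetD(3)[OF eta_nt] by simp

lemma mu_in: "X \<in> Ob UMet \<Longrightarrow> mu M X \<in> nonexpanding (T (T X)) (T X)"
  using natural_transformation_UMetD(2)[OF mu_nt] by simp

lemma mu_nat: "\<lbrakk>X \<in> Ob UMet; Y \<in> Ob UMet; f \<in> nonexpanding X Y; t \<in> pts (T (T X))\<rbrakk> \<Longrightarrow>
    TM X Y f (mu M X t) = mu M Y (TM (T X) (T Y) (TM X Y f) t)"
  using natural_transformation_UMetD(3)[OF mu_nt, of X Y f t] by simp

lemma eta_pts: "X \<in> Ob UMet \<Longrightarrow> x \<in> pts X \<Longrightarrow> eta M X x \<in> pts (T X)"
  by (rule nonexpanding_pts[OF eta_in])

lemma mu_pts: "X \<in> Ob UMet \<Longrightarrow> t \<in> pts (T (T X)) \<Longrightarrow> mu M X t \<in> pts (T X)"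
  by (rule nonexpanding_pts[OF mu_in])

lemma monad_laws:
  assumes "X \<in> Ob UMet"
  shows "compose (pts (T X)) (mu M X) (eta M (T X)) = (\<lambda>x\<in>pts (T X). x)"
    and "compose (pts (T X)) (mu M X) (TM X (T X) (eta M X)) = (\<lambda>x\<in>pts (T X). x)"
    and "compose (pts (T (T (T X)))) (mu M X) (mu M (T X)) =
      compose (pts (T (T (T X)))) (mu M X) (TM (T (T X)) (T X) (mu M X))"
  using enriched_monad assms unfolding enriched_monad_def Let_def by auto

lemma mu_eta: "\<lbrakk>X \<in> Ob UMet; t \<in> pts (T X)\<rbrakk> \<Longrightarrow> mu M X (eta M (T X) t) = t"
  using fun_cong[OF monad_laws(1), of X t] by (simp add: compose_eq)

lemma mu_TM_eta: "\<lbrakk>X \<in> Ob UMet; t \<in> pts (T X)\<rbrakk> \<Longrightarrow> mu M X (TM X (T X) (eta M X) t) = t"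
  using fun_cong[OF monad_laws(2), of X t] by (simp add: compose_eq)

lemma mu_assoc: "\<lbrakk>X \<in> Ob UMet; t \<in> pts (T (T (T X)))\<rbrakk> \<Longrightarrow>
    mu M X (mu M (T X) t) = mu M X (TM (T (T X)) (T X) (mu M X) t)"
  using fun_cong[OF monad_laws(3), of X t] by (simp add: compose_eq)

end

section \<open>Eilenberg-Moore algebras and monad morphisms\<close>

definition EM :: "('u emetric, 'u \<Rightarrow> 'u) mnd \<Rightarrow> ('u emetric \<times> ('u \<Rightarrow> 'u)) set"
  where "EM M = {(X, a). X \<in> Ob UMet \<and> a \<in> nonexpanding (FO (endo M) X) X \<and>
    (\<forall>x\<in>pts X. a (eta M X x) = x) \<and>
    (\<forall>t\<in>pts (FO (endo M) (FO (endo M) X)). a (mu M X t) = a (FM (endo M) (FO (endo M) X) X a t))}"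

definition EM_hom :: "('u emetric, 'u \<Rightarrow> 'u) mnd \<Rightarrow> 'u emetric \<times> ('u \<Rightarrow> 'u) \<Rightarrow> 'u emetric \<times> ('u \<Rightarrow> 'u)
    \<Rightarrow> ('u \<Rightarrow> 'u) set"
  where "EM_hom M = (\<lambda>(X, a) (Y, b). {h \<in> nonexpanding X Y.
    \<forall>t\<in>pts (FO (endo M) X). h (a t) = b (FM (endo M) X Y h t)})"

lemma (in umonad) free_EM: "X \<in> Ob UMet \<Longrightarrow> (T X, mu M X) \<in> EM M"
  by (simp add: EM_def FO_Ob mu_in mu_eta mu_assoc)

lemma monad_morphismD:
  assumes "monad_morphism UMet M N \<phi>"
  shows "natural_transformation UMet UMet (endo M) (endo N) \<phi>"
    and "\<phi> \<in> extensional (Ob UMet)"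
    and "X \<in> Ob UMet \<Longrightarrow> \<phi> X \<in> nonexpanding (FO (endo M) X) (FO (endo N) X)"
    and "\<lbrakk>X \<in> Ob UMet; Y \<in> Ob UMet; f \<in> nonexpanding X Y; x \<in> pts (FO (endo M) X)\<rbrakk> \<Longrightarrow>
      FM (endo N) X Y f (\<phi> X x) = \<phi> Y (FM (endo M) X Y f x)"
    and "\<lbrakk>enriched_monad UMet M; X \<in> Ob UMet; x \<in> pts X\<rbrakk> \<Longrightarrow> \<phi> X (eta M X x) = eta N X x"
    and "\<lbrakk>enriched_monad UMet M; X \<in> Ob UMet; x \<in> pts (FO (endo M) (FO (endo M) X))\<rbrakk> \<Longrightarrow>
      \<phi> X (mu M X x) = mu N X (FM (endo N) (FO (endo M) X) (FO (endo N) X) (\<phi> X) (\<phi> (FO (endo M) X) x))"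
proof -
  show nt: "natural_transformation UMet UMet (endo M) (endo N) \<phi>"
    using assms by (simp add: monad_morphism_def Let_def)
  show "\<phi> \<in> extensional (Ob UMet)" using natural_transformation_UMetD(1)[OF nt] .
  show "X \<in> Ob UMet \<Longrightarrow> \<phi> X \<in> nonexpanding (FO (endo M) X) (FO (endo N) X)"
    using natural_transformation_UMetD(2)[OF nt] .
  show "\<lbrakk>X \<in> Ob UMet; Y \<in> Ob UMet; f \<in> nonexpanding X Y; x \<in> pts (FO (endo M) X)\<rbrakk> \<Longrightarrow>
      FM (endo N) X Y f (\<phi> X x) = \<phi> Y (FM (endo M) X Y f x)"
    using natural_transformation_UMetD(3)[OF nt] .
  show "\<phi> X (eta M X x) = eta N X x" if "enriched_monad UMet M" "X \<in> Ob UMet" "x \<in> pts X"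
  proof -
    have "compose (pts X) (\<phi> X) (eta M X) = eta N X"
      using assms that by (simp add: monad_morphism_def Let_def)
    from fun_cong[OF this, of x] show ?thesis using that by (simp add: compose_eq)
  qed
  show "\<phi> X (mu M X x) = mu N X (FM (endo N) (FO (endo M) X) (FO (endo N) X) (\<phi> X) (\<phi> (FO (endo M) X) x))"
    if "enriched_monad UMet M" "X \<in> Ob UMet" "x \<in> pts (FO (endo M) (FO (endo M) X))"
  proof -
    let ?S = "FO (endo M)"
    have "compose (pts (?S (?S X))) (\<phi> X) (mu M X) =
      compose (pts (?S (?S X))) (mu N X) (compose (pts (?S (?S X)))
        (FM (endo N) (?S X) (FO (endo N) X) (\<phi> X)) (\<phi> (?S X)))"
      using assms that by (simp add: monad_morphism_def Let_def)
    from fun_cong[OF this, of x] show ?thesis using that by (simp add: compose_eq)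
  qed
qed

lemma monad_morphismI:
  assumes "umonad M" "umonad N" "\<phi> \<in> extensional (Ob UMet)"
    and "\<And>X. X \<in> Ob UMet \<Longrightarrow> \<phi> X \<in> nonexpanding (FO (endo M) X) (FO (endo N) X)"
    and "\<And>X Y f x. \<lbrakk>X \<in> Ob UMet; Y \<in> Ob UMet; f \<in> nonexpanding X Y; x \<in> pts (FO (endo M) X)\<rbrakk> \<Longrightarrow>
      FM (endo N) X Y f (\<phi> X x) = \<phi> Y (FM (endo M) X Y f x)"
    and "\<And>X x. \<lbrakk>X \<in> Ob UMet; x \<in> pts X\<rbrakk> \<Longrightarrow> \<phi> X (eta M X x) = eta N X x"
    and "\<And>X x. \<lbrakk>X \<in> Ob UMet; x \<in> pts (FO (endo M) (FO (endo M) X))\<rbrakk> \<Longrightarrow>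
      \<phi> X (mu M X x) = mu N X (FM (endo N) (FO (endo M) X) (FO (endo N) X) (\<phi> X) (\<phi> (FO (endo M) X) x))"
  shows "monad_morphism UMet M N \<phi>"
proof -
  interpret N: umonad N by fact
  have "compose (pts X) (\<phi> X) (eta M X) = eta N X" if "X \<in> Ob UMet" for X
    by (rule extensionalityI[of _ "pts X"])
      (use assms(6) that nonexpanding_ext[OF N.eta_in] in \<open>auto simp: compose_eq\<close>)
  moreover have "compose (pts (FO (endo M) (FO (endo M) X))) (\<phi> X) (mu M X) =
      compose (pts (FO (endo M) (FO (endo M) X))) (mu N X) (compose (pts (FO (endo M) (FO (endo M) X)))
        (FM (endo N) (FO (endo M) X) (FO (endo N) X) (\<phi> X)) (\<phi> (FO (endo M) X)))" if "X \<in> Ob UMet" for X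
    using assms(7)[OF that] by (intro compose_eqI) (simp add: compose_eq)
  ultimately show ?thesis
    unfolding monad_morphism_def Let_def
    using natural_transformation_UMetI[of \<phi> "endo M" "endo N", OF assms(3-5)] by simp
qed

section \<open>Algebras, homomorphisms and concrete functors\<close>

lemma Hom_Sigma_UMet [simp]: "Hom (Sigma_UMet \<Sigma>) = homomorphisms \<Sigma>"
  and Ob_Sigma_UMet: "A \<in> Ob (Sigma_UMet \<Sigma>) \<longleftrightarrow> ultra_algebra \<Sigma> A \<and> small (pts (underlying A))"
  by (auto simp: Sigma_UMet_def)

lemma Ob_variety_cat: "Ob (variety_cat V) = Ob (Sigma_UMet (fst V)) \<inter> snd V"
  and Hom_variety_cat [simp]: "Hom (variety_cat V) = homomorphisms (fst V)"
  and Idt_variety_cat [simp]: "Idt (variety_cat V) A = (\<lambda>x\<in>pts (underlying A). x)"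
  and Cmp_variety_cat [simp]: "Cmp (variety_cat V) A B C g f = compose (pts (underlying A)) g f"
  and hom_space_variety_cat: "hom_space (variety_cat V) A B =
    mk_space (homomorphisms (fst V) A B) (sup_dist (underlying A) (underlying B))"
  by (cases V; simp add: variety_cat_def full_subcategory_def Sigma_UMet_def hom_space_def mk_space_def)+

lemma underlying_Ob: "A \<in> Ob (variety_cat V) \<Longrightarrow> underlying A \<in> Ob UMet"
  by (auto simp: Ob_variety_cat Ob_Sigma_UMet ultra_algebra_def Ob_UMet)

lemma pts_power_space: "xs \<in> pts (power_space X n) \<longleftrightarrow> length xs = n \<and> set xs \<subseteq> pts X"
  by (simp add: power_space_def Let_def)

lemma opn_pts:
  "\<lbrakk>ultra_algebra \<Sigma> A; \<sigma> \<in> symbols \<Sigma>; length xs = arity \<Sigma> \<sigma>; set xs \<subseteq> pts (underlying A)\<rbrakk> \<Longrightarrow>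
    opn A \<sigma> xs \<in> pts (underlying A)"
  by (rule nonexpanding_pts[of "opn A \<sigma>" "power_space (underlying A) (arity \<Sigma> \<sigma>)"])
    (auto simp: pts_power_space ultra_algebra_def)

lemma homomorphism_nonexpanding: "h \<in> homomorphisms \<Sigma> A B \<Longrightarrow> h \<in> nonexpanding (underlying A) (underlying B)"
  by (simp add: homomorphisms_def)

lemma homomorphism_opn:
  "\<lbrakk>h \<in> homomorphisms \<Sigma> A B; \<sigma> \<in> symbols \<Sigma>; length xs = arity \<Sigma> \<sigma>; set xs \<subseteq> pts (underlying A)\<rbrakk> \<Longrightarrow>
    h (opn A \<sigma> xs) = opn B \<sigma> (map h xs)"
  by (simp add: homomorphisms_def pts_power_space)

lemma homomorphismI:
  assumes "h \<in> nonexpanding (underlying A) (underlying B)"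
    and "\<And>\<sigma> xs. \<lbrakk>\<sigma> \<in> symbols \<Sigma>; length xs = arity \<Sigma> \<sigma>; set xs \<subseteq> pts (underlying A)\<rbrakk> \<Longrightarrow>
      h (opn A \<sigma> xs) = opn B \<sigma> (map h xs)"
  shows "h \<in> homomorphisms \<Sigma> A B"
  using assms by (simp add: homomorphisms_def pts_power_space)

lemma homomorphism_id: "ultra_algebra \<Sigma> A \<Longrightarrow> (\<lambda>x\<in>pts (underlying A). x) \<in> homomorphisms \<Sigma> A A"
  by (intro homomorphismI nonexpanding_id)
    (auto simp: opn_pts subset_iff intro!: arg_cong[where f = "opn A _"] map_idI[symmetric])

lemma homomorphism_compose:
  assumes "ultra_algebra \<Sigma> A" "f \<in> homomorphisms \<Sigma> A B" "g \<in> homomorphisms \<Sigma> B C"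
  shows "compose (pts (underlying A)) g f \<in> homomorphisms \<Sigma> A C"
proof (rule homomorphismI)
  show "compose (pts (underlying A)) g f \<in> nonexpanding (underlying A) (underlying C)"
    using nonexpanding_compose[OF assms(2,3)[THEN homomorphism_nonexpanding]] .
  fix \<sigma> xs assume xs: "\<sigma> \<in> symbols \<Sigma>" "length xs = arity \<Sigma> \<sigma>" "set xs \<subseteq> pts (underlying A)"
  have "set (map f xs) \<subseteq> pts (underlying B)"
    using xs nonexpanding_pts[OF homomorphism_nonexpanding[OF assms(2)]] by auto
  then have 1: "g (f (opn A \<sigma> xs)) = opn C \<sigma> (map g (map f xs))"
    using homomorphism_opn[OF assms(2) xs] homomorphism_opn[OF assms(3)] xs by simp
  have 2: "map (compose (pts (underlying A)) g f) xs = map g (map f xs)"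
    using xs by (auto simp: compose_eq subset_iff)
  show "compose (pts (underlying A)) g f (opn A \<sigma> xs) =
      opn C \<sigma> (map (compose (pts (underlying A)) g f) xs)"
    unfolding 2 1[symmetric] using opn_pts[OF assms(1) xs] by (rule compose_eq)
qed

text \<open>The forgetful functors leave maps unchanged, so commuting with them forces
  \<open>FM H\<close> to be the identity on each hom-set, and a concrete functor amounts to its
  action on objects. Conversely enrichment is automatic: the hom-spaces on both sides carry the
  supremum metric of the same underlying spaces.\<close>

lemma concrete_functor_iff:
  "concrete_functor V W H \<longleftrightarrow> FO H \<in> extensional (Ob (variety_cat V)) \<and>
    (\<forall>A\<in>Ob (variety_cat V). FO H A \<in> Ob (variety_cat W) \<and> underlying (FO H A) = underlying A) \<and>
    FM H = (\<lambda>A\<in>Ob (variety_cat V). \<lambda>B\<in>Ob (variety_cat V). \<lambda>h\<in>homomorphisms (fst V) A B. h) \<and>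
    (\<forall>A\<in>Ob (variety_cat V). \<forall>B\<in>Ob (variety_cat V). \<forall>h\<in>homomorphisms (fst V) A B.
      h \<in> homomorphisms (fst W) (FO H A) (FO H B))" (is "?L \<longleftrightarrow> ?R")
proof
  assume L: ?L
  then have F: "is_functor (variety_cat V) (variety_cat W) H"
    and c: "comp_functor (variety_cat V) (forgetful W) H = forgetful V"
    by (auto simp: concrete_functor_def enriched_functor_def)
  have FOH: "FO H \<in> Ob (variety_cat V) \<rightarrow>\<^sub>E Ob (variety_cat W)"
    using F by (simp add: is_functor_def)
  have und: "underlying (FO H A) = underlying A" if "A \<in> Ob (variety_cat V)" for A
    using arg_cong[OF c, of "\<lambda>F. FO F A"] that PiE_mem[OF FOH that] by (simp add: forgetful_def)
  have FMH: "FM H A B \<in> homomorphisms (fst V) A B \<rightarrow>\<^sub>E homomorphisms (fst W) (FO H A) (FO H B)"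
    if "A \<in> Ob (variety_cat V)" "B \<in> Ob (variety_cat V)" for A B
    using F that by (simp add: is_functor_def)
  have FMid: "FM H A B h = h"
    if "A \<in> Ob (variety_cat V)" "B \<in> Ob (variety_cat V)" "h \<in> homomorphisms (fst V) A B" for A B h
  proof -
    have "FM (comp_functor (variety_cat V) (forgetful W) H) A B h = FM (forgetful V) A B h" by (simp add: c)
    then show ?thesis using that PiE_mem[OF FMH[OF that(1,2)] that(3)] PiE_mem[OF FOH]
      by (simp add: forgetful_def)
  qed
  have "FM H = (\<lambda>A\<in>Ob (variety_cat V). \<lambda>B\<in>Ob (variety_cat V). \<lambda>h\<in>homomorphisms (fst V) A B. h)"
  proof (rule extensionalityI[of _ "Ob (variety_cat V)"])
    fix A assume A: "A \<in> Ob (variety_cat V)"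
    have "FM H A = (\<lambda>B\<in>Ob (variety_cat V). \<lambda>h\<in>homomorphisms (fst V) A B. h)"
    proof (rule extensionalityI[of _ "Ob (variety_cat V)"])
      fix B assume B: "B \<in> Ob (variety_cat V)"
      have "FM H A B = (\<lambda>h\<in>homomorphisms (fst V) A B. h)"
        by (intro extensionalityI[of _ "homomorphisms (fst V) A B"])
          (use A B FMH[OF A B] FMid in \<open>auto simp: PiE_def\<close>)
      then show "FM H A B = (\<lambda>B\<in>Ob (variety_cat V). \<lambda>h\<in>homomorphisms (fst V) A B. h) B"
        using B by simp
    qed (use F A in \<open>auto simp: is_functor_def\<close>)
    then show "FM H A = (\<lambda>A\<in>Ob (variety_cat V). \<lambda>B\<in>Ob (variety_cat V). \<lambda>h\<in>homomorphisms (fst V) A B. h) A"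
      using A by simp
  qed (use F in \<open>auto simp: is_functor_def\<close>)
  moreover have "h \<in> homomorphisms (fst W) (FO H A) (FO H B)"
    if "A \<in> Ob (variety_cat V)" "B \<in> Ob (variety_cat V)" "h \<in> homomorphisms (fst V) A B" for A B h
    using FMid[OF that] PiE_mem[OF FMH[OF that(1,2)] that(3)] by simp
  ultimately show ?R using FOH und by (auto simp: PiE_def)
next
  assume R: ?R
  have alg: "ultra_algebra (fst V) A" if "A \<in> Ob (variety_cat V)" for A
    using that by (simp add: Ob_variety_cat Ob_Sigma_UMet)
  have F: "is_functor (variety_cat V) (variety_cat W) H"
    unfolding is_functor_def using R by (auto simp: homomorphism_id homomorphism_compose alg PiE_def)
  have E: "FM H A B \<in> nonexpanding (hom_space (variety_cat V) A B) (hom_space (variety_cat W) (FO H A) (FO H B))"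
    if "A \<in> Ob (variety_cat V)" "B \<in> Ob (variety_cat V)" for A B
    using R that unfolding hom_space_variety_cat by (intro nonexpandingI) auto
  have "comp_functor (variety_cat V) (forgetful W) H = forgetful V"
    unfolding comp_functor_def forgetful_def using R
    by (auto intro!: restrict_ext)
  then show ?L using F E by (simp add: concrete_functor_def enriched_functor_def)
qed

lemma concrete_functor_eqI:
  assumes "concrete_functor V W H" "concrete_functor V W K"
    and "\<And>A. A \<in> Ob (variety_cat V) \<Longrightarrow> FO H A = FO K A"
  shows "H = K"
proof -
  have "FO H = FO K"
    using assms by (intro extensionalityI[of _ "Ob (variety_cat V)"]) (auto simp: concrete_functor_iff)
  then show ?thesis using assms(1,2) by (intro fctr.equality) (auto simp: concrete_functor_iff)
qed


section \<open>Concrete functors and monad morphisms\<close>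

text \<open>\<open>s A\<close> is the structure map belonging to the algebra \<open>A\<close>. The
  correspondence is strict on objects and hom-sets, since concrete functors are compared by equality
  over \<open>UMet\<close>.\<close>

definition represents :: "'u variety \<Rightarrow> ('u emetric, 'u \<Rightarrow> 'u) mnd \<Rightarrow> (('u, 'u) alg \<Rightarrow> 'u \<Rightarrow> 'u) \<Rightarrow> bool"
  where "represents V M s \<longleftrightarrow> enriched_monad UMet M \<and>
    bij_betw (\<lambda>A. (underlying A, s A)) (Ob (variety_cat V)) (EM M) \<and>
    (\<forall>A\<in>Ob (variety_cat V). \<forall>B\<in>Ob (variety_cat V).
      homomorphisms (fst V) A B = EM_hom M (underlying A, s A) (underlying B, s B))"

text \<open>The correspondence between a concrete functor \<open>H : V \<rightarrow> W\<close> and a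
  monad morphism \<phi> from \<open>N\<close> to \<open>M\<close>, in the opposite direction: the
  structure map of \<open>H A\<close> is that of \<open>A\<close> precomposed with \<phi>. As a
  relation it needs no formula for either direction; existence and uniqueness on both sides give a
  bijection.\<close>

definition matches :: "'u variety \<Rightarrow> ('u emetric, 'u \<Rightarrow> 'u) mnd \<Rightarrow> (('u, 'u) alg \<Rightarrow> 'u \<Rightarrow> 'u)
    \<Rightarrow> (('u, 'u) alg \<Rightarrow> 'u \<Rightarrow> 'u) \<Rightarrow> 'u alg_functor \<Rightarrow> ('u emetric \<Rightarrow> 'u \<Rightarrow> 'u) \<Rightarrow> bool"
  where "matches V N s t H \<phi> \<longleftrightarrow> (\<forall>A\<in>Ob (variety_cat V). \<forall>x\<in>pts (FO (endo N) (underlying A)).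
    t (FO H A) x = s A (\<phi> (underlying A) x))"

lemma representsD:
  assumes "represents V M s"
  shows represents_umonad: "umonad M"
    and represents_EM: "A \<in> Ob (variety_cat V) \<Longrightarrow> (underlying A, s A) \<in> EM M"
    and represents_surj: "(X, a) \<in> EM M \<Longrightarrow> \<exists>A\<in>Ob (variety_cat V). underlying A = X \<and> s A = a"
    and represents_inj: "\<lbrakk>A \<in> Ob (variety_cat V); B \<in> Ob (variety_cat V); underlying A = underlying B;
      s A = s B\<rbrakk> \<Longrightarrow> A = B"
    and represents_hom: "\<lbrakk>A \<in> Ob (variety_cat V); B \<in> Ob (variety_cat V)\<rbrakk> \<Longrightarrow>
      h \<in> homomorphisms (fst V) A B \<longleftrightarrow> h \<in> nonexpanding (underlying A) (underlying B) \<and>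
        (\<forall>t\<in>pts (FO (endo M) (underlying A)). h (s A t) = s B (FM (endo M) (underlying A) (underlying B) h t))"
proof -
  have b: "bij_betw (\<lambda>A. (underlying A, s A)) (Ob (variety_cat V)) (EM M)"
    using assms by (simp add: represents_def)
  show "umonad M" using assms by (simp add: represents_def umonad_def)
  show "A \<in> Ob (variety_cat V) \<Longrightarrow> (underlying A, s A) \<in> EM M" using bij_betwE[OF b] by blast
  show "(X, a) \<in> EM M \<Longrightarrow> \<exists>A\<in>Ob (variety_cat V). underlying A = X \<and> s A = a"
    using b unfolding bij_betw_def by force
  show "\<lbrakk>A \<in> Ob (variety_cat V); B \<in> Ob (variety_cat V); underlying A = underlying B; s A = s B\<rbrakk> \<Longrightarrow> A = B"
    using b unfolding bij_betw_def inj_on_def by blast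
  show "\<lbrakk>A \<in> Ob (variety_cat V); B \<in> Ob (variety_cat V)\<rbrakk> \<Longrightarrow>
      h \<in> homomorphisms (fst V) A B \<longleftrightarrow> h \<in> nonexpanding (underlying A) (underlying B) \<and>
        (\<forall>t\<in>pts (FO (endo M) (underlying A)). h (s A t) = s B (FM (endo M) (underlying A) (underlying B) h t))"
    using assms by (simp add: represents_def EM_hom_def)
qed

text \<open>The morphism can be read off from the free algebra on \<open>X\<close>, whose structure
  map is \<open>mu M X\<close>: by a unit law and naturality, \<chi> at \<open>X\<close> is
  \<open>mu M X\<close> after \<chi> at \<open>M.T X\<close> after the image of
  \<open>eta M X\<close> under \<open>N\<close>, and matching replaces the first two factors by the
  structure map of \<open>H\<close> at the free algebra.\<close>

lemma matches_unique_morphism: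
  assumes V: "represents V M s" and N: "umonad N"
    and \<phi>: "monad_morphism UMet N M \<phi>" "matches V N s t H \<phi>"
    and \<psi>: "monad_morphism UMet N M \<psi>" "matches V N s t H \<psi>"
  shows "\<phi> = \<psi>"
proof -
  interpret M: umonad M using represents_umonad[OF V] .
  interpret N: umonad N by fact
  have "\<chi> X x = t (FO H A) (N.TM X (M.T X) (eta M X) x)"
    if X: "X \<in> Ob UMet" and x: "x \<in> pts (N.T X)" and A: "A \<in> Ob (variety_cat V)"
      "underlying A = M.T X" "s A = mu M X"
      and \<chi>: "monad_morphism UMet N M \<chi>" "matches V N s t H \<chi>" for \<chi> X x A
  proof -
    \<comment> \<open>The unit law is inserted so that naturality can move \<chi> to the free
      algebra, where matching applies.\<close>
    have "\<chi> X x = mu M X (M.TM X (M.T X) (eta M X) (\<chi> X x))"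
      using M.mu_TM_eta[OF X nonexpanding_pts[OF monad_morphismD(3)[OF \<chi>(1) X] x]] by simp
    also have "\<dots> = mu M X (\<chi> (M.T X) (N.TM X (M.T X) (eta M X) x))"
      using monad_morphismD(4)[OF \<chi>(1) X M.FO_Ob[OF X] M.eta_in[OF X] x] by simp
    also have "\<dots> = t (FO H A) (N.TM X (M.T X) (eta M X) x)"
      using \<chi>(2) A x X N.FM_pts[OF X M.FO_Ob[OF X] M.eta_in[OF X] x] by (simp add: matches_def)
    finally show ?thesis .
  qed
  moreover have "\<exists>A\<in>Ob (variety_cat V). underlying A = M.T X \<and> s A = mu M X" if "X \<in> Ob UMet" for X
    using represents_surj[OF V M.free_EM[OF that]] .
  ultimately have "\<phi> X x = \<psi> X x" if "X \<in> Ob UMet" "x \<in> pts (N.T X)" for X x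
    using \<phi> \<psi> that by metis
  then have "\<phi> X = \<psi> X" if "X \<in> Ob UMet" for X
    using nonexpanding_eqI[OF monad_morphismD(3)[OF \<phi>(1) that] monad_morphismD(3)[OF \<psi>(1) that]] that
    by blast
  then show ?thesis
    using extensionalityI[OF monad_morphismD(2)[OF \<phi>(1)] monad_morphismD(2)[OF \<psi>(1)]] by blast
qed

lemma matches_unique_functor:
  assumes W: "represents W N t"
    and H: "concrete_functor V W H" "matches V N s t H \<phi>"
    and K: "concrete_functor V W K" "matches V N s t K \<phi>"
  shows "H = K"
proof -
  have "FO H A = FO K A" if A: "A \<in> Ob (variety_cat V)" for A
  proof -
    have o: "FO H A \<in> Ob (variety_cat W)" "FO K A \<in> Ob (variety_cat W)"
      "underlying (FO H A) = underlying A" "underlying (FO K A) = underlying A"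
      using H K A by (auto simp: concrete_functor_iff)
    have "t (FO H A) \<in> nonexpanding (FO (endo N) (underlying A)) (underlying A)"
      "t (FO K A) \<in> nonexpanding (FO (endo N) (underlying A)) (underlying A)"
      using represents_EM[OF W o(1)] represents_EM[OF W o(2)] o by (auto simp: EM_def)
    moreover have "t (FO H A) x = t (FO K A) x" if "x \<in> pts (FO (endo N) (underlying A))" for x
      using H K A that by (simp add: matches_def)
    ultimately have "t (FO H A) = t (FO K A)" by (rule nonexpanding_eqI)
    then show ?thesis using represents_inj[OF W o(1,2)] o by simp
  qed
  then show ?thesis by (rule concrete_functor_eqI[OF H(1) K(1)])
qed

text \<open>\<open>H\<close> turns the free algebra on \<open>M.T X\<close> into an
  \<open>N\<close>-algebra with structure map \<open>k X\<close>; composing with the image of the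
  unit under \<open>N\<close> gives \<phi>, the only candidate by the preceding uniqueness. All
  remaining identities come from homomorphisms of \<open>V\<close>-algebras, which \<open>H\<close>
  keeps homomorphisms.\<close>

lemma matches_exists_morphism:
  assumes V: "represents V M s" and W: "represents W N t" and H: "concrete_functor V W H"
  shows "\<exists>\<phi>. monad_morphism UMet N M \<phi> \<and> matches V N s t H \<phi>"
proof -
  interpret M: umonad M using represents_umonad[OF V] .
  interpret N: umonad N using represents_umonad[OF W] .
  have "\<forall>X\<in>Ob UMet. \<exists>A\<in>Ob (variety_cat V). underlying A = M.T X \<and> s A = mu M X"
    using represents_surj[OF V M.free_EM] by blast
  then obtain Fr where Fr: "\<And>X. X \<in> Ob UMet \<Longrightarrow> Fr X \<in> Ob (variety_cat V)"
    "\<And>X. X \<in> Ob UMet \<Longrightarrow> underlying (Fr X) = M.T X" "\<And>X. X \<in> Ob UMet \<Longrightarrow> s (Fr X) = mu M X"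
    by metis
  have HO: "FO H A \<in> Ob (variety_cat W)" "underlying (FO H A) = underlying A" if "A \<in> Ob (variety_cat V)" for A
    using H that by (auto simp: concrete_functor_iff)
  have tEM: "(underlying A, t (FO H A)) \<in> EM N" if "A \<in> Ob (variety_cat V)" for A
    using represents_EM[OF W HO(1)[OF that]] HO(2)[OF that] by simp
  have Hhom: "h (t (FO H A) y) = t (FO H B) (N.TM (underlying A) (underlying B) h y)"
    if "A \<in> Ob (variety_cat V)" "B \<in> Ob (variety_cat V)" "h \<in> homomorphisms (fst V) A B"
      "y \<in> pts (N.T (underlying A))" for A B h y
  proof -
    have "h \<in> homomorphisms (fst W) (FO H A) (FO H B)"
      using H that unfolding concrete_functor_iff by blast
    then show ?thesis using represents_hom[OF W HO(1) HO(1), OF that(1,2)] HO(2) that by simp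
  qed
  define k where "k X = t (FO H (Fr X))" for X
  have kin: "k X \<in> nonexpanding (N.T (M.T X)) (M.T X)"
    and keta: "\<And>x. x \<in> pts (M.T X) \<Longrightarrow> k X (eta N (M.T X) x) = x"
    and kmu: "\<And>y. y \<in> pts (N.T (N.T (M.T X))) \<Longrightarrow> k X (mu N (M.T X) y) = k X (N.TM (N.T (M.T X)) (M.T X) (k X) y)"
    if "X \<in> Ob UMet" for X
    using tEM[OF Fr(1)[OF that]] Fr(2)[OF that] by (auto simp: EM_def k_def)
  define \<phi> where "\<phi> = (\<lambda>X\<in>Ob UMet. compose (pts (N.T X)) (k X) (N.TM X (M.T X) (eta M X)))"
  have \<phi>: "\<phi> X x = k X (N.TM X (M.T X) (eta M X) x)" if "X \<in> Ob UMet" "x \<in> pts (N.T X)" for X x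
    using that by (simp add: \<phi>_def compose_eq)
  have \<phi>in: "\<phi> X \<in> nonexpanding (N.T X) (M.T X)" if "X \<in> Ob UMet" for X
    using that nonexpanding_compose[OF N.FM_in[OF that M.FO_Ob[OF that] M.eta_in[OF that]] kin[OF that]]
    by (simp add: \<phi>_def)
  note M.FO_Ob [simp] N.FO_Ob [simp] M.eta_in [simp] N.eta_in [simp] M.FM_in [simp] N.FM_in [simp]
    M.FM_pts [simp] N.FM_pts [simp]
  have nat: "M.TM X Y f (\<phi> X x) = \<phi> Y (N.TM X Y f x)"
    if X: "X \<in> Ob UMet" and Y: "Y \<in> Ob UMet" and f: "f \<in> nonexpanding X Y" and x: "x \<in> pts (N.T X)" for X Y f x
  proof -
    \<comment> \<open>Naturality of the multiplication says that \<open>M.TM X Y f\<close> is a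
      homomorphism of free algebras, so \<open>H\<close> makes it compatible with \<open>k X\<close>
      and \<open>k Y\<close>.\<close>
    have "M.TM X Y f \<in> homomorphisms (fst V) (Fr X) (Fr Y)"
      using represents_hom[OF V Fr(1) Fr(1)] Fr X Y f M.mu_nat by simp
    then have "M.TM X Y f (\<phi> X x) = k Y (N.TM (M.T X) (M.T Y) (M.TM X Y f) (N.TM X (M.T X) (eta M X) x))"
      using Hhom[OF Fr(1) Fr(1)] X Y f x by (simp add: \<phi> k_def Fr)
    also have "\<dots> = k Y (N.TM X (M.T Y) (compose (pts X) (M.TM X Y f) (eta M X)) x)"
      using X Y f x by (subst N.FM_comp[of X "M.T X" "M.T Y"]) auto
    also have "compose (pts X) (M.TM X Y f) (eta M X) = compose (pts X) (eta M Y) f"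
      using X Y f by (intro compose_eqI) (simp add: M.eta_nat)
    also have "k Y (N.TM X (M.T Y) (compose (pts X) (eta M Y) f) x) = \<phi> Y (N.TM X Y f x)"
      using X Y f x by (subst N.FM_comp[of X Y "M.T Y"]) (auto simp: \<phi>)
    finally show ?thesis .
  qed
  have mat: "s A (\<phi> (underlying A) x) = t (FO H A) x"
    if A: "A \<in> Ob (variety_cat V)" and x: "x \<in> pts (N.T (underlying A))" for A x
  proof -
    define X where "X = underlying A"
    have X: "X \<in> Ob UMet" using underlying_Ob[OF A] by (simp add: X_def)
    have sA: "s A \<in> nonexpanding (M.T X) X" "\<And>x. x \<in> pts X \<Longrightarrow> s A (eta M X x) = x"
      "\<And>y. y \<in> pts (M.T (M.T X)) \<Longrightarrow> s A (mu M X y) = s A (M.TM (M.T X) X (s A) y)"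
      using represents_EM[OF V A] by (auto simp: EM_def X_def)
    \<comment> \<open>The associativity law of \<open>A\<close> says that its structure map is a
      homomorphism from the free algebra on its underlying space.\<close>
    have "s A \<in> homomorphisms (fst V) (Fr X) A"
      using represents_hom[OF V Fr(1) A] Fr X sA by (simp add: X_def[symmetric])
    then have "s A (\<phi> X x) = t (FO H A) (N.TM (M.T X) X (s A) (N.TM X (M.T X) (eta M X) x))"
      using Hhom[OF Fr(1) A] X x by (simp add: \<phi> k_def Fr X_def[symmetric])
    also have "\<dots> = t (FO H A) (N.TM X X (compose (pts X) (s A) (eta M X)) x)"
      using X x sA by (subst N.FM_comp[of X "M.T X" X]) (auto simp: X_def[symmetric])
    also have "compose (pts X) (s A) (eta M X) = (\<lambda>x\<in>pts X. x)"
      using sA(2) by (auto simp: compose_def)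
    also have "N.TM X X (\<lambda>x\<in>pts X. x) x = x"
      using X x N.FM_id by (simp add: X_def[symmetric])
    finally show ?thesis by (simp add: X_def)
  qed
  have "monad_morphism UMet N M \<phi>"
  proof (rule monad_morphismI)
    show "umonad N" "umonad M" by unfold_locales
    show "\<phi> \<in> extensional (Ob UMet)" by (simp add: \<phi>_def)
    fix X :: "'a emetric" assume X: "X \<in> Ob UMet"
    show "\<phi> X \<in> nonexpanding (N.T X) (M.T X)" using \<phi>in[OF X] .
    show "\<phi> X (eta N X x) = eta M X x" if "x \<in> pts X" for x
      using X that by (simp add: \<phi> N.eta_pts N.eta_nat[of X "M.T X"] keta M.eta_pts)
    show "\<phi> X (mu N X x) = mu M X (M.TM (N.T X) (M.T X) (\<phi> X) (\<phi> (N.T X) x))"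
      if x: "x \<in> pts (N.T (N.T X))" for x
    proof -
      have "\<phi> X (mu N X x) = k X (mu N (M.T X) (N.TM (N.T X) (N.T (M.T X)) (N.TM X (M.T X) (eta M X)) x))"
        using X x by (simp add: \<phi> N.mu_pts N.mu_nat[of X "M.T X"])
      also have "\<dots> = k X (N.TM (N.T (M.T X)) (M.T X) (k X) (N.TM (N.T X) (N.T (M.T X)) (N.TM X (M.T X) (eta M X)) x))"
        using X x kmu by simp
      also have "\<dots> = k X (N.TM (N.T X) (M.T X) (compose (pts (N.T X)) (k X) (N.TM X (M.T X) (eta M X))) x)"
        using X x kin by (subst N.FM_comp[of "N.T X" "N.T (M.T X)" "M.T X"]) auto
      also have "compose (pts (N.T X)) (k X) (N.TM X (M.T X) (eta M X)) = \<phi> X"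
        using X by (simp add: \<phi>_def)
      \<comment> \<open>Matching at the free algebra, already proved, replaces \<open>k X\<close> by
        \<open>mu M X\<close> after \<phi>.\<close>
      also have "k X (N.TM (N.T X) (M.T X) (\<phi> X) x) = mu M X (\<phi> (M.T X) (N.TM (N.T X) (M.T X) (\<phi> X) x))"
        using mat[OF Fr(1)[OF X]] Fr(2,3)[OF X] X x \<phi>in by (simp add: k_def)
      also have "\<dots> = mu M X (M.TM (N.T X) (M.T X) (\<phi> X) (\<phi> (N.T X) x))"
        using nat[of "N.T X" "M.T X" "\<phi> X" x] X x \<phi>in by simp
      finally show ?thesis .
    qed
  qed (fact nat)
  then show ?thesis using mat by (auto simp: matches_def)
qed

text \<open>Precomposing structure maps with \<phi> turns \<open>M\<close>-algebras into
  \<open>N\<close>-algebras: the laws follow from those of \<phi>, and naturality of \<phi> gives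
  both associativity and compatibility with homomorphisms.\<close>

lemma matches_exists_functor:
  assumes V: "represents V M s" and W: "represents W N t" and \<phi>: "monad_morphism UMet N M \<phi>"
  shows "\<exists>H. concrete_functor V W H \<and> matches V N s t H \<phi>"
proof -
  interpret M: umonad M using represents_umonad[OF V] .
  interpret N: umonad N using represents_umonad[OF W] .
  note \<phi>in = monad_morphismD(3)[OF \<phi>] and \<phi>nat = monad_morphismD(4)[OF \<phi>]
    and \<phi>eta = monad_morphismD(5)[OF \<phi> N.enriched_monad] and \<phi>mu = monad_morphismD(6)[OF \<phi> N.enriched_monad]
  let ?r = "\<lambda>A. compose (pts (N.T (underlying A))) (s A) (\<phi> (underlying A))"
  have "(underlying A, ?r A) \<in> EM N" if A: "A \<in> Ob (variety_cat V)" for A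
  proof -
    define X where "X = underlying A"
    have X: "X \<in> Ob UMet" using underlying_Ob[OF A] by (simp add: X_def)
    have sA: "s A \<in> nonexpanding (M.T X) X" "\<And>x. x \<in> pts X \<Longrightarrow> s A (eta M X x) = x"
      "\<And>y. y \<in> pts (M.T (M.T X)) \<Longrightarrow> s A (mu M X y) = s A (M.TM (M.T X) X (s A) y)"
      using represents_EM[OF V A] by (auto simp: EM_def X_def)
    let ?a = "compose (pts (N.T X)) (s A) (\<phi> X)"
    have a: "?a \<in> nonexpanding (N.T X) X" using nonexpanding_compose[OF \<phi>in[OF X] sA(1)] .
    have "?a (eta N X x) = x" if "x \<in> pts X" for x
      using that X by (simp add: compose_eq N.eta_pts \<phi>eta sA)
    moreover have "?a (mu N X y) = ?a (N.TM (N.T X) X ?a y)" if y: "y \<in> pts (N.T (N.T X))" for y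
    proof -
      have y': "\<phi> (N.T X) y \<in> pts (M.T (N.T X))" using nonexpanding_pts[OF \<phi>in[OF N.FO_Ob[OF X]] y] .
      have "?a (mu N X y) = s A (mu M X (M.TM (N.T X) (M.T X) (\<phi> X) (\<phi> (N.T X) y)))"
        using X y by (simp add: compose_eq N.mu_pts \<phi>mu)
      also have "\<dots> = s A (M.TM (M.T X) X (s A) (M.TM (N.T X) (M.T X) (\<phi> X) (\<phi> (N.T X) y)))"
        using X y' by (intro sA M.FM_pts N.FO_Ob M.FO_Ob \<phi>in)
      also have "\<dots> = s A (M.TM (N.T X) X ?a (\<phi> (N.T X) y))"
        using X y' sA \<phi>in by (subst M.FM_comp[of "N.T X" "M.T X" X]) (auto simp: M.FO_Ob N.FO_Ob)
      also have "\<dots> = s A (\<phi> X (N.TM (N.T X) X ?a y))"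
        using X y a by (simp add: \<phi>nat N.FO_Ob)
      also have "\<dots> = ?a (N.TM (N.T X) X ?a y)"
        using N.FM_pts[OF N.FO_Ob[OF X] X a y] by (simp add: compose_eq)
      finally show ?thesis .
    qed
    ultimately show ?thesis using X a by (simp add: EM_def X_def[symmetric])
  qed
  then have "\<forall>A\<in>Ob (variety_cat V). \<exists>B\<in>Ob (variety_cat W). underlying B = underlying A \<and> t B = ?r A"
    using represents_surj[OF W] by blast
  then obtain h where h: "\<And>A. A \<in> Ob (variety_cat V) \<Longrightarrow> h A \<in> Ob (variety_cat W)"
    "\<And>A. A \<in> Ob (variety_cat V) \<Longrightarrow> underlying (h A) = underlying A"
    "\<And>A. A \<in> Ob (variety_cat V) \<Longrightarrow> t (h A) = ?r A" by metis
  define H :: "'a alg_functor" where "H = \<lparr>FO = (\<lambda>A\<in>Ob (variety_cat V). h A),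
    FM = (\<lambda>A\<in>Ob (variety_cat V). \<lambda>B\<in>Ob (variety_cat V). \<lambda>h\<in>homomorphisms (fst V) A B. h)\<rparr>"
  have "g \<in> homomorphisms (fst W) (h A) (h B)"
    if A: "A \<in> Ob (variety_cat V)" and B: "B \<in> Ob (variety_cat V)" and g: "g \<in> homomorphisms (fst V) A B" for A B g
  proof -
    have g': "g \<in> nonexpanding (underlying A) (underlying B)"
      and gs: "\<And>t. t \<in> pts (M.T (underlying A)) \<Longrightarrow> g (s A t) = s B (M.TM (underlying A) (underlying B) g t)"
      using g represents_hom[OF V A B] by auto
    have "g (t (h A) x) = t (h B) (N.TM (underlying A) (underlying B) g x)" if x: "x \<in> pts (N.T (underlying A))" for x
      using x A B g' N.FM_pts[OF underlying_Ob[OF A] underlying_Ob[OF B] g' x]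
        nonexpanding_pts[OF \<phi>in[OF underlying_Ob[OF A]] x]
      by (simp add: h compose_eq gs underlying_Ob \<phi>nat)
    then show ?thesis using represents_hom[OF W h(1) h(1), OF A B] h(2) A B g' by simp
  qed
  then have "concrete_functor V W H"
    unfolding concrete_functor_iff by (auto simp: H_def h)
  moreover have "matches V N s t H \<phi>" by (auto simp: matches_def H_def h compose_eq)
  ultimately show ?thesis by blast
qed

lemma matches_id: "represents V M s \<Longrightarrow>
    matches V M s s (id_functor (variety_cat V)) (id_transformation UMet UMet (endo M))"
  unfolding matches_def by (simp add: id_transformation_def underlying_Ob)

text \<open>Together with uniqueness of matching morphisms this gives functoriality of the passage
  from concrete functors to monad morphisms, without computing composites.\<close>

lemma matches_comp:
  assumes "concrete_functor U V H" and "matches U M r s H \<phi>" and "matches V N s t K \<psi>"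
    and "monad_morphism UMet N M \<psi>" and "umonad N"
  shows "matches U N r t (comp_functor (variety_cat U) K H)
    (\<lambda>X\<in>Ob UMet. compose (pts (FO (endo N) X)) (\<phi> X) (\<psi> X))"
  unfolding matches_def
proof (intro ballI)
  fix A x assume A: "A \<in> Ob (variety_cat U)" and x: "x \<in> pts (FO (endo N) (underlying A))"
  have HA: "FO H A \<in> Ob (variety_cat V)" "underlying (FO H A) = underlying A"
    using assms(1) A by (auto simp: concrete_functor_iff)
  have "\<psi> (underlying A) x \<in> pts (FO (endo M) (underlying A))"
    using nonexpanding_pts[OF monad_morphismD(3)[OF assms(4) underlying_Ob[OF A]] x] .
  then show "t (FO (comp_functor (variety_cat U) K H) A) x =
      r A ((\<lambda>X\<in>Ob UMet. compose (pts (FO (endo N) X)) (\<phi> X) (\<psi> X)) (underlying A) x)"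
    using assms(2,3) A x HA underlying_Ob[OF A] by (simp add: matches_def compose_eq)
qed

lemma monad_morphism_id: assumes "umonad M" shows "monad_morphism UMet M M (id_transformation UMet UMet (endo M))"
proof -
  interpret umonad M by fact
  show ?thesis
    by (rule monad_morphismI)
      (auto simp: assms id_transformation_def nonexpanding_id FM_pts eta_pts mu_pts FM_id FO_Ob)
qed

lemma monad_morphism_compose:
  fixes L M N :: "('u emetric, 'u \<Rightarrow> 'u) mnd"
  assumes "umonad L" "umonad M" "umonad N" and \<phi>: "monad_morphism UMet L M \<phi>" and \<psi>: "monad_morphism UMet M N \<psi>"
  shows "monad_morphism UMet L N (\<lambda>X\<in>Ob UMet. compose (pts (FO (endo L) X)) (\<psi> X) (\<phi> X))"
proof -
  interpret L: umonad L by fact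
  interpret M: umonad M by fact
  interpret N: umonad N by fact
  note \<phi>D = monad_morphismD[OF \<phi>] and \<psi>D = monad_morphismD[OF \<psi>]
  note \<phi>p = nonexpanding_pts[OF \<phi>D(3)] and \<psi>p = nonexpanding_pts[OF \<psi>D(3)]
  show ?thesis
  proof (rule monad_morphismI)
    fix X :: "'u emetric" assume X: "X \<in> Ob UMet"
    show "(\<lambda>X\<in>Ob UMet. compose (pts (L.T X)) (\<psi> X) (\<phi> X)) X \<in> nonexpanding (L.T X) (N.T X)"
      using X nonexpanding_compose[OF \<phi>D(3) \<psi>D(3)] by simp
    show "(\<lambda>X\<in>Ob UMet. compose (pts (L.T X)) (\<psi> X) (\<phi> X)) X (eta L X x) = eta N X x" if "x \<in> pts X" for x
      using X that by (simp add: compose_eq L.eta_pts \<phi>D(5)[OF L.enriched_monad] \<psi>D(5)[OF M.enriched_monad])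
    show "(\<lambda>X\<in>Ob UMet. compose (pts (L.T X)) (\<psi> X) (\<phi> X)) X (mu L X x) =
      mu N X (N.TM (L.T X) (N.T X) ((\<lambda>X\<in>Ob UMet. compose (pts (L.T X)) (\<psi> X) (\<phi> X)) X)
        ((\<lambda>X\<in>Ob UMet. compose (pts (L.T X)) (\<psi> X) (\<phi> X)) (L.T X) x))"
      if x: "x \<in> pts (L.T (L.T X))" for x
    proof -
      let ?y = "\<phi> (L.T X) x"
      have y: "?y \<in> pts (M.T (L.T X))" using \<phi>p[OF L.FO_Ob[OF X] x] .
      have "\<psi> X (\<phi> X (mu L X x)) = \<psi> X (mu M X (M.TM (L.T X) (M.T X) (\<phi> X) ?y))"
        using \<phi>D(6)[OF L.enriched_monad X x] by simp
      also have "\<dots> = mu N X (N.TM (M.T X) (N.T X) (\<psi> X) (\<psi> (M.T X) (M.TM (L.T X) (M.T X) (\<phi> X) ?y)))"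
        using X y by (intro \<psi>D(6)[OF M.enriched_monad X] M.FM_pts \<phi>D(3) L.FO_Ob M.FO_Ob)
      also have "\<psi> (M.T X) (M.TM (L.T X) (M.T X) (\<phi> X) ?y) = N.TM (L.T X) (M.T X) (\<phi> X) (\<psi> (L.T X) ?y)"
        using X y by (intro \<psi>D(4)[symmetric] \<phi>D(3) L.FO_Ob M.FO_Ob)
      also have "N.TM (M.T X) (N.T X) (\<psi> X) (N.TM (L.T X) (M.T X) (\<phi> X) (\<psi> (L.T X) ?y)) =
          N.TM (L.T X) (N.T X) (compose (pts (L.T X)) (\<psi> X) (\<phi> X)) (\<psi> (L.T X) ?y)"
        using X y by (intro N.FM_comp[symmetric] \<psi>D(3) \<phi>D(3) L.FO_Ob M.FO_Ob N.FO_Ob \<psi>p)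
      finally show ?thesis using X x by (simp add: compose_eq L.mu_pts L.FO_Ob)
    qed
    fix Y :: "'u emetric" and f x
    assume Y: "Y \<in> Ob UMet" and f: "f \<in> nonexpanding X Y" and x: "x \<in> pts (L.T X)"
    show "N.TM X Y f ((\<lambda>X\<in>Ob UMet. compose (pts (L.T X)) (\<psi> X) (\<phi> X)) X x) =
      (\<lambda>X\<in>Ob UMet. compose (pts (L.T X)) (\<psi> X) (\<phi> X)) Y (L.TM X Y f x)"
      using X Y f x by (simp add: compose_eq L.FM_pts \<phi>D(4)[symmetric] \<psi>D(4) \<phi>p)
  qed (auto simp: assms)
qed

section \<open>The two categories and the duality between them\<close>

lemma Mon_sf_simps:
  "M \<in> Ob Mon_sf \<longleftrightarrow> enriched_monad UMet M \<and> strongly_finitary (endo M)"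
  "\<phi> \<in> Hom Mon_sf M N \<longleftrightarrow> monad_morphism UMet M N \<phi>"
  "Idt Mon_sf M = id_transformation UMet UMet (endo M)"
  "Cmp Mon_sf L M N \<psi> \<phi> = (\<lambda>X\<in>Ob UMet. compose (pts (FO (endo L) X)) (\<psi> X) (\<phi> X))"
  by (auto simp: Mon_sf_def)

lemma Var_fp_simps:
  "V \<in> Ob Var_fp \<longleftrightarrow> finitary_variety V"
  "H \<in> Hom Var_fp V W \<longleftrightarrow> concrete_functor V W H"
  "Idt Var_fp V = id_functor (variety_cat V)"
  "Cmp Var_fp U V W K H = comp_functor (variety_cat U) K H"
  by (auto simp: Var_fp_def)

lemma category_Mon_sf: "category Mon_sf"
  unfolding category_def
proof (intro conjI ballI)
  have ext: "\<phi> = \<psi>" if "\<phi> \<in> extensional (Ob UMet)" "\<psi> \<in> extensional (Ob UMet)"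
    "\<And>X. X \<in> Ob UMet \<Longrightarrow> \<phi> X = \<psi> X" for \<phi> \<psi> :: "'a emetric \<Rightarrow> 'a \<Rightarrow> 'a"
    using extensionalityI that by metis
  fix L :: "('a emetric, 'a \<Rightarrow> 'a) mnd" assume "L \<in> Ob Mon_sf"
  then have L: "umonad L" by (simp add: Mon_sf_simps umonad_def)
  show "Idt Mon_sf L \<in> Hom Mon_sf L L" using monad_morphism_id[OF L] by (simp add: Mon_sf_simps)
  fix M :: "('a emetric, 'a \<Rightarrow> 'a) mnd" assume "M \<in> Ob Mon_sf"
  then have M: "umonad M" by (simp add: Mon_sf_simps umonad_def)
  { fix \<phi> assume "\<phi> \<in> Hom Mon_sf L M"
    then have \<phi>: "monad_morphism UMet L M \<phi>" by (simp add: Mon_sf_simps)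
    note \<phi>D = monad_morphismD[OF \<phi>]
    have \<phi>x: "(\<lambda>x\<in>pts (FO (endo L) X). \<phi> X x) = \<phi> X" if "X \<in> Ob UMet" for X
      using nonexpanding_ext[OF \<phi>D(3)[OF that]] by (simp add: extensional_restrict)
    show "Cmp Mon_sf L L M \<phi> (Idt Mon_sf L) = \<phi>"
      using \<phi>D(2)
      by (intro ext) (auto simp: Mon_sf_simps id_transformation_def compose_def \<phi>x cong: restrict_cong)
    show "Cmp Mon_sf L M M (Idt Mon_sf M) \<phi> = \<phi>"
      using \<phi>D(2) nonexpanding_pts[OF \<phi>D(3)]
      by (intro ext) (auto simp: Mon_sf_simps id_transformation_def compose_def \<phi>x cong: restrict_cong) }
  fix N :: "('a emetric, 'a \<Rightarrow> 'a) mnd" assume "N \<in> Ob Mon_sf"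
  then have N: "umonad N" by (simp add: Mon_sf_simps umonad_def)
  { fix \<phi> \<psi> assume "\<phi> \<in> Hom Mon_sf L M" "\<psi> \<in> Hom Mon_sf M N"
    then show "Cmp Mon_sf L M N \<psi> \<phi> \<in> Hom Mon_sf L N"
      using monad_morphism_compose[OF L M N] by (simp add: Mon_sf_simps) }
  fix P :: "('a emetric, 'a \<Rightarrow> 'a) mnd" and \<phi> \<psi> \<chi>
  assume "\<phi> \<in> Hom Mon_sf L M" "\<psi> \<in> Hom Mon_sf M N" "\<chi> \<in> Hom Mon_sf N P"
  then have "\<phi> X x \<in> pts (FO (endo M) X)" if "X \<in> Ob UMet" "x \<in> pts (FO (endo L) X)" for X x
    using that nonexpanding_pts[OF monad_morphismD(3)] unfolding Mon_sf_simps by metis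
  then show "Cmp Mon_sf L M P (Cmp Mon_sf M N P \<chi> \<psi>) \<phi> = Cmp Mon_sf L N P \<chi> (Cmp Mon_sf L M N \<psi> \<phi>)"
    by (auto simp: Mon_sf_simps compose_def intro!: ext restrict_ext)
qed

lemma concrete_functor_id: "concrete_functor V V (id_functor (variety_cat V))"
  by (auto simp: concrete_functor_iff id_functor_def)

lemma concrete_functor_comp:
  "concrete_functor U V H \<Longrightarrow> concrete_functor V W K \<Longrightarrow> concrete_functor U W (comp_functor (variety_cat U) K H)"
  unfolding concrete_functor_iff comp_functor_def by (auto intro!: restrict_ext)

lemma category_Var_fp: "category Var_fp"
  unfolding category_def
proof (intro conjI ballI)
  note simps = Var_fp_simps and cf = concrete_functor_id concrete_functor_comp
  fix U :: "'a variety"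
  show "Idt Var_fp U \<in> Hom Var_fp U U" by (simp add: simps cf)
  fix V :: "'a variety"
  { fix H assume "H \<in> Hom Var_fp U V"
    then have H: "concrete_functor U V H" by (simp add: simps)
    then have HO: "FO H A \<in> Ob (variety_cat V)" if "A \<in> Ob (variety_cat U)" for A
      using that by (simp add: concrete_functor_iff)
    show "Cmp Var_fp U U V H (Idt Var_fp U) = H"
      unfolding simps by (rule concrete_functor_eqI[OF concrete_functor_comp[OF concrete_functor_id H] H]) simp
    show "Cmp Var_fp U V V (Idt Var_fp V) H = H"
      unfolding simps using HO
      by (intro concrete_functor_eqI[OF concrete_functor_comp[OF H concrete_functor_id] H]) simp }
  fix W :: "'a variety"
  { fix H K assume "H \<in> Hom Var_fp U V" "K \<in> Hom Var_fp V W"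
    then show "Cmp Var_fp U V W K H \<in> Hom Var_fp U W" by (simp add: simps cf) }
  fix P :: "'a variety" and H K L
  assume "H \<in> Hom Var_fp U V" "K \<in> Hom Var_fp V W" "L \<in> Hom Var_fp W P"
  then have H: "concrete_functor U V H" and K: "concrete_functor V W K" and L: "concrete_functor W P L"
    by (simp_all add: simps)
  show "Cmp Var_fp U V P (Cmp Var_fp V W P L K) H = Cmp Var_fp U W P L (Cmp Var_fp U V W K H)"
    unfolding simps
  proof (rule concrete_functor_eqI)
    show "concrete_functor U P (comp_functor (variety_cat U) (comp_functor (variety_cat V) L K) H)"
      "concrete_functor U P (comp_functor (variety_cat U) L (comp_functor (variety_cat U) K H))"
      using H K L cf by blast+
  qed (use H in \<open>simp add: concrete_functor_iff\<close>)
qed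

lemma category_op_cat: "category C \<Longrightarrow> category (op_cat C)"
  unfolding category_def op_cat_def by simp

lemma op_cat_simps:
  "Ob (op_cat C) = Ob C" "Hom (op_cat C) a b = Hom C b a" "Idt (op_cat C) = Idt C"
  "Cmp (op_cat C) a b c g f = Cmp C c b a f g"
  by (simp_all add: op_cat_def)

text \<open>A representing monad is chosen for each variety, and a concrete functor goes to the
  unique monad morphism matching it. Full faithfulness is existence and uniqueness of matches on
  both sides. Essential surjectivity compares a given monad with the one chosen for a variety that
  it represents.\<close>

lemma duality_from_representations:
  assumes varieties: "\<And>V :: 'u variety. finitary_variety V \<Longrightarrow> \<exists>M\<in>Ob Mon_sf. \<exists>s. represents V M s"
    and monads: "\<And>M :: ('u emetric, 'u \<Rightarrow> 'u) mnd. M \<in> Ob Mon_sf \<Longrightarrow> \<exists>V s. finitary_variety V \<and> represents V M s"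
  shows "equivalent_categories (op_cat (Var_fp :: ('u variety, 'u alg_functor) cat))
    (Mon_sf :: (('u emetric, 'u \<Rightarrow> 'u) mnd, 'u emetric \<Rightarrow> 'u \<Rightarrow> 'u) cat)"
proof -
  have "\<forall>V::'u variety. \<exists>M s. finitary_variety V \<longrightarrow> M \<in> Ob Mon_sf \<and> represents V M s"
    using varieties by metis
  then obtain M s where M: "\<And>V::'u variety. finitary_variety V \<Longrightarrow> M V \<in> Ob Mon_sf"
    and rep: "\<And>V::'u variety. finitary_variety V \<Longrightarrow> represents V (M V) (s V)" by metis
  \<comment> \<open>The indices \<open>W V\<close> are those of the opposite category: a functor
    from \<open>V\<close> to \<open>W\<close> gives a morphism from \<open>M W\<close> to
    \<open>M V\<close>.\<close>
  define mm where "mm W V H = (THE \<phi>. monad_morphism UMet (M W) (M V) \<phi> \<and> matches V (M W) (s V) (s W) H \<phi>)"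
    for V W :: "'u variety" and H
  have mmI: "mm W V H = \<phi>" if "finitary_variety V" "finitary_variety W"
      "monad_morphism UMet (M W) (M V) \<phi>" "matches V (M W) (s V) (s W) H \<phi>" for V W H \<phi>
    unfolding mm_def using that matches_unique_morphism[OF rep represents_umonad[OF rep]]
    by (intro the_equality) blast+
  have mm: "monad_morphism UMet (M W) (M V) (mm W V H)" "matches V (M W) (s V) (s W) H (mm W V H)"
    if "finitary_variety V" "finitary_variety W" "concrete_functor V W H" for V W H
    using matches_exists_morphism[OF rep rep that(3)] that(1,2) mmI by blast+
  define F where "F = \<lparr>FO = (\<lambda>V\<in>Ob (op_cat Var_fp). M V),
    FM = (\<lambda>W\<in>Ob (op_cat Var_fp). \<lambda>V\<in>Ob (op_cat Var_fp). \<lambda>H\<in>Hom (op_cat Var_fp) W V. mm W V H)\<rparr>"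
  note simps = op_cat_simps Mon_sf_simps Var_fp_simps
  have um: "finitary_variety V \<Longrightarrow> umonad (M V)" for V using rep represents_umonad by blast
  have "is_functor (op_cat Var_fp) Mon_sf F"
    unfolding is_functor_def
  proof (intro conjI ballI)
    fix U :: "'u variety" assume U: "U \<in> Ob (op_cat Var_fp)"
    then have U': "finitary_variety U" by (simp add: simps)
    show "FM F U U (Idt (op_cat Var_fp) U) = Idt Mon_sf (FO F U)"
      using U U' mmI[OF U' U' monad_morphism_id[OF um[OF U']] matches_id[OF rep[OF U']]]
      by (simp add: F_def simps concrete_functor_id)
    fix V :: "'u variety" assume V: "V \<in> Ob (op_cat Var_fp)"
    then have V': "finitary_variety V" by (simp add: simps)
    show "FM F U V \<in> Hom (op_cat Var_fp) U V \<rightarrow>\<^sub>E Hom Mon_sf (FO F U) (FO F V)"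
      using U V mm[OF V' U'] by (auto simp: F_def simps)
    fix W :: "'u variety" and H K assume W: "W \<in> Ob (op_cat Var_fp)"
      and H: "H \<in> Hom (op_cat Var_fp) U V" and K: "K \<in> Hom (op_cat Var_fp) V W"
    then have W': "finitary_variety W" and H': "concrete_functor V U H" and K': "concrete_functor W V K"
      by (simp_all add: simps)
    have "mm U W (comp_functor (variety_cat W) H K) =
        (\<lambda>X\<in>Ob UMet. compose (pts (FO (endo (M U)) X)) (mm V W K X) (mm U V H X))"
      using matches_comp[OF K' mm(2)[OF W' V' K'] mm(2)[OF V' U' H'] mm(1)[OF V' U' H'] um[OF U']]
        monad_morphism_compose[OF um[OF U'] um[OF V'] um[OF W'] mm(1)[OF V' U' H'] mm(1)[OF W' V' K']]
      by (intro mmI W' U')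
    then show "FM F U W (Cmp (op_cat Var_fp) U V W K H) =
        Cmp Mon_sf (FO F U) (FO F V) (FO F W) (FM F V W K) (FM F U V H)"
      using U V W H K by (simp add: F_def simps concrete_functor_comp)
  qed (use M in \<open>auto simp: F_def simps\<close>)
  moreover have "bij_betw (FM F W V) (Hom (op_cat Var_fp) W V) (Hom Mon_sf (FO F W) (FO F V))"
    if W: "W \<in> Ob (op_cat Var_fp)" and V: "V \<in> Ob (op_cat Var_fp)" for V W
  proof -
    have V': "finitary_variety V" and W': "finitary_variety W" using V W by (simp_all add: simps)
    have "bij_betw (mm W V) {H. concrete_functor V W H} {\<phi>. monad_morphism UMet (M W) (M V) \<phi>}"
      unfolding bij_betw_def
    proof
      show "inj_on (mm W V) {H. concrete_functor V W H}"
        using mm(2)[OF V' W'] matches_unique_functor[OF rep[OF W']] by (intro inj_onI) (metis mem_Collect_eq)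
      show "mm W V ` {H. concrete_functor V W H} = {\<phi>. monad_morphism UMet (M W) (M V) \<phi>}"
        using mm(1)[OF V' W'] matches_exists_functor[OF rep[OF V'] rep[OF W']] mmI[OF V' W']
        by (auto simp: image_iff) metis
    qed
    moreover have "Hom (op_cat Var_fp) W V = {H. concrete_functor V W H}"
      and "Hom Mon_sf (FO F W) (FO F V) = {\<phi>. monad_morphism UMet (M W) (M V) \<phi>}"
      using V W by (auto simp: F_def simps)
    moreover have "FM F W V H = mm W V H" if "H \<in> {H. concrete_functor V W H}" for H
      using V W that by (simp add: F_def simps)
    ultimately show ?thesis
      using bij_betw_cong[of "{H. concrete_functor V W H}" "FM F W V" "mm W V"] by simp
  qed
  moreover have "\<exists>V\<in>Ob (op_cat Var_fp). \<exists>\<phi>. is_iso Mon_sf (FO F V) N \<phi>" if N: "N \<in> Ob Mon_sf" for N :: "('u emetric, 'u \<Rightarrow> 'u) mnd"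
  proof -
    obtain V t where V: "finitary_variety V" and t: "represents V N t" using monads[OF N] by blast
    \<comment> \<open>Both \<open>N\<close> and \<open>M V\<close> represent \<open>V\<close>. The
      identity functor of \<open>V\<close> matches a morphism in each direction, and both composites
      match the identity functor again, so by uniqueness they are identities.\<close>
    let ?I = "id_functor (variety_cat V)"
    note rV = rep[OF V] and u = um[OF V] and uN = represents_umonad[OF t]
    obtain \<phi> where \<phi>: "monad_morphism UMet (M V) N \<phi>" "matches V (M V) t (s V) ?I \<phi>"
      using matches_exists_morphism[OF t rV concrete_functor_id] by blast
    obtain \<psi> where \<psi>: "monad_morphism UMet N (M V) \<psi>" "matches V N (s V) t ?I \<psi>"
      using matches_exists_morphism[OF rV t concrete_functor_id] by blast
    have II: "comp_functor (variety_cat V) ?I ?I = ?I"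
      by (auto simp: comp_functor_def id_functor_def intro!: restrict_ext)
    have "Cmp Mon_sf (M V) N (M V) \<psi> \<phi> = Idt Mon_sf (M V)"
      unfolding Mon_sf_simps
      using matches_comp[OF concrete_functor_id \<psi>(2) \<phi>(2) \<phi>(1) u]
      by (intro matches_unique_morphism[OF rV u monad_morphism_compose[OF u uN u \<phi>(1) \<psi>(1)] _
            monad_morphism_id[OF u] matches_id[OF rV]]) (simp add: II)
    moreover have "Cmp Mon_sf N (M V) N \<phi> \<psi> = Idt Mon_sf N"
      unfolding Mon_sf_simps
      using matches_comp[OF concrete_functor_id \<phi>(2) \<psi>(2) \<psi>(1) uN]
      by (intro matches_unique_morphism[OF t uN monad_morphism_compose[OF uN u uN \<psi>(1) \<phi>(1)] _
            monad_morphism_id[OF uN] matches_id[OF t]]) (simp add: II)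
    ultimately have "is_iso Mon_sf (FO F V) N \<phi>"
      using V \<phi> \<psi> unfolding is_iso_def by (auto simp: F_def simps)
    then show ?thesis using V by (auto simp: simps)
  qed
  ultimately show ?thesis
    by (intro full_faithful_equivalence category_op_cat category_Var_fp category_Mon_sf)
qed


section \<open>Strongly finitary functors\<close>

lemma small_subset: "small B \<Longrightarrow> A \<subseteq> B \<Longrightarrow> small A"
  unfolding small_def using card_of_mono1 ordLeq_ordLess_trans by blast

lemma sup_dist_mk_space:
  "(\<And>x. x \<in> P \<Longrightarrow> f x \<in> Q) \<Longrightarrow> (\<And>x. x \<in> P \<Longrightarrow> g x \<in> Q) \<Longrightarrow>
    sup_dist (mk_space P d) (mk_space Q e) f g = (SUP x\<in>P. e (f x) (g x))"
  unfolding sup_dist_def by (intro SUP_cong) auto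

lemma ultrametric_subspace:
  assumes U: "ultrametric_space U" and S: "S \<subseteq> pts U"
  shows "ultrametric_space (mk_space S (dst U))"
proof (rule ultrametric_mk_space)
  fix x y assume "x \<in> S" "y \<in> S"
  then have xy: "x \<in> pts U" "y \<in> pts U" using S by auto
  show "dst U x y = 0 \<longleftrightarrow> x = y" using ultra_eq_0[OF U xy] .
  show "dst U x y = dst U y x" using ultra_sym[OF U xy] .
  fix z assume "z \<in> S"
  then show "dst U x z \<le> max (dst U x y) (dst U y z)" using ultra_tri[OF U xy] S by auto
qed

text \<open>The enriched natural transformations from \<open>UMet(K-, X)\<close> to
  \<open>UMet(FK-, B)\<close> in elementary terms: each component takes nonexpanding maps as values,
  is itself nonexpanding, and is natural in \<open>N\<close>. Extensionality is left out, so that a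
  family may be given by a formula.\<close>

definition cocone :: "('u emetric, 'u \<Rightarrow> 'u, 'u emetric, 'u \<Rightarrow> 'u) fctr \<Rightarrow> 'u emetric \<Rightarrow> 'u emetric
    \<Rightarrow> ('u emetric \<Rightarrow> ('u \<Rightarrow> 'u) \<Rightarrow> 'u \<Rightarrow> 'u) \<Rightarrow> bool"
  where "cocone F X B \<theta> \<longleftrightarrow>
    (\<forall>N\<in>Ob Set_fp. \<forall>\<phi>\<in>nonexpanding N X. \<theta> N \<phi> \<in> nonexpanding (FO F N) B) \<and>
    (\<forall>N\<in>Ob Set_fp. \<forall>\<phi>\<in>nonexpanding N X. \<forall>\<psi>\<in>nonexpanding N X. \<forall>t\<in>pts (FO F N).
      dst B (\<theta> N \<phi> t) (\<theta> N \<psi> t) \<le> sup_dist N X \<phi> \<psi>) \<and>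
    (\<forall>N\<in>Ob Set_fp. \<forall>N'\<in>Ob Set_fp. \<forall>f\<in>nonexpanding N N'. \<forall>\<phi>\<in>nonexpanding N' X. \<forall>t\<in>pts (FO F N).
      \<theta> N (compose (pts N) \<phi> f) t = \<theta> N' \<phi> (FM F N N' f t))"

lemma Set_fp_UMet: "N \<in> Ob Set_fp \<Longrightarrow> N \<in> Ob UMet"
  by (simp add: Ob_Set_fp)

lemma enriched_inclusion: "enriched_functor Set_fp UMet (id_functor Set_fp)"
  unfolding enriched_functor_def is_functor_def
  by (auto simp: id_functor_def Set_fp_UMet nonexpanding_compose nonexpanding_id
      hom_space_UMet hom_space_Set_fp intro!: nonexpandingI)

context endofunctor
begin

abbreviation "GF \<equiv> comp_functor Set_fp F (id_functor Set_fp)"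
text \<open>The comparison map of the Kan extension. At \<open>N\<close> and \<phi> it is
  \<open>u\<close> after \<open>FM F N X \<phi>\<close>; the identity unit is still present so that
  the term agrees literally with the unfolded definition.\<close>

abbreviation "Kan X u \<equiv> (\<lambda>N\<in>Ob Set_fp. \<lambda>\<phi>\<in>nonexpanding (FO (id_functor Set_fp) N) X.
  compose (pts (FO GF N)) u (compose (pts (FO GF N)) (FM F (FO (id_functor Set_fp) N) X \<phi>)
    (id_transformation Set_fp UMet GF N)))"

lemma enriched_restriction: "enriched_functor Set_fp UMet GF"
proof -
  have "is_functor Set_fp UMet GF"
    using is_functor unfolding is_functor_def
    by (auto simp: comp_functor_def Set_fp_UMet id_functor_def nonexpanding_compose nonexpanding_id PiE_mem
        intro!: FM_in)
  moreover have "FM GF M N \<in> nonexpanding (hom_space Set_fp M N) (hom_space UMet (FO GF M) (FO GF N))"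
    if "M \<in> Ob Set_fp" "N \<in> Ob Set_fp" for M N
  proof (rule nonexpandingI)
    fix f g assume fg: "f \<in> pts (hom_space Set_fp M N)" "g \<in> pts (hom_space Set_fp M N)"
    then have "sup_dist (FO F M) (FO F N) (FM F M N f) (FM F M N g) \<le> sup_dist M N f g"
      using that by (intro sup_dist_le FM_le Set_fp_UMet) (auto simp: hom_space_Set_fp)
    then show "dst (hom_space UMet (FO GF M) (FO GF N)) (FM GF M N f) (FM GF M N g) \<le> dst (hom_space Set_fp M N) f g"
      using fg that by (simp add: hom_space_Set_fp hom_space_UMet FM_in Set_fp_UMet)
  qed (use that in \<open>auto simp: hom_space_Set_fp hom_space_UMet FM_in Set_fp_UMet comp_functor_def\<close>)
  ultimately show ?thesis unfolding enriched_functor_def by blast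
qed

lemma Kan_apply: "\<lbrakk>N \<in> Ob Set_fp; \<phi> \<in> nonexpanding N X; t \<in> pts (FO F N)\<rbrakk> \<Longrightarrow> Kan X u N \<phi> t = u (FM F N X \<phi> t)"
  by (simp add: id_transformation_def compose_eq)

lemma presheaf_pts:
  "\<theta> \<in> pts (presheaf_hom Set_fp UMet UMet (id_functor Set_fp) GF X B) \<longleftrightarrow>
    \<theta> \<in> extensional (Ob Set_fp) \<and> (\<forall>N\<in>Ob Set_fp. \<theta> N \<in> extensional (nonexpanding N X)) \<and> cocone F X B \<theta>"
  (is "?L \<longleftrightarrow> ?R")
proof -
  have 1: "\<theta> N \<in> nonexpanding (hom_space UMet N X) (hom_space UMet (FO F N) B) \<longleftrightarrow>
    \<theta> N \<in> extensional (nonexpanding N X) \<and> (\<forall>\<phi>\<in>nonexpanding N X. \<theta> N \<phi> \<in> nonexpanding (FO F N) B) \<and>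
    (\<forall>\<phi>\<in>nonexpanding N X. \<forall>\<psi>\<in>nonexpanding N X. \<forall>t\<in>pts (FO F N). dst B (\<theta> N \<phi> t) (\<theta> N \<psi> t) \<le> sup_dist N X \<phi> \<psi>)"
    for N
    unfolding hom_space_UMet nonexpanding_def[of "mk_space _ _"]
    by (auto simp: PiE_def Pi_iff sup_dist_def SUP_le_iff)
  have 2: "(\<forall>\<phi>\<in>nonexpanding N' X. \<theta> N (compose (pts N) \<phi> f) = compose (pts (FO F N)) (\<theta> N' \<phi>) (FM F N N' f)) \<longleftrightarrow>
    (\<forall>\<phi>\<in>nonexpanding N' X. \<forall>t\<in>pts (FO F N). \<theta> N (compose (pts N) \<phi> f) t = \<theta> N' \<phi> (FM F N N' f t))"
    if "N \<in> Ob Set_fp" "N' \<in> Ob Set_fp" "f \<in> nonexpanding N N'"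
      "\<forall>\<phi>\<in>nonexpanding N X. \<theta> N \<phi> \<in> nonexpanding (FO F N) B" for N N' f
  proof (intro ball_cong refl iffI ballI)
    fix \<phi> assume \<phi>: "\<phi> \<in> nonexpanding N' X"
    have e: "\<theta> N (compose (pts N) \<phi> f) \<in> extensional (pts (FO F N))"
      using nonexpanding_ext that(4) nonexpanding_compose[OF that(3) \<phi>] by blast
    { assume "\<forall>t\<in>pts (FO F N). \<theta> N (compose (pts N) \<phi> f) t = \<theta> N' \<phi> (FM F N N' f t)"
      then show "\<theta> N (compose (pts N) \<phi> f) = compose (pts (FO F N)) (\<theta> N' \<phi>) (FM F N N' f)"
        using e by (intro extensionalityI[of _ "pts (FO F N)"]) (auto simp: compose_eq) }
    { fix t
      assume "\<theta> N (compose (pts N) \<phi> f) = compose (pts (FO F N)) (\<theta> N' \<phi>) (FM F N N' f)" "t \<in> pts (FO F N)"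
      then show "\<theta> N (compose (pts N) \<phi> f) t = \<theta> N' \<phi> (FM F N N' f t)" by (simp add: compose_eq) }
  qed
  have "?L \<longleftrightarrow> \<theta> \<in> extensional (Ob Set_fp) \<and>
    (\<forall>N\<in>Ob Set_fp. \<theta> N \<in> nonexpanding (hom_space UMet N X) (hom_space UMet (FO F N) B)) \<and>
    (\<forall>N\<in>Ob Set_fp. \<forall>N'\<in>Ob Set_fp. \<forall>f\<in>nonexpanding N N'. \<forall>\<phi>\<in>nonexpanding N' X.
      \<theta> N (compose (pts N) \<phi> f) = compose (pts (FO F N)) (\<theta> N' \<phi>) (FM F N N' f))"
    unfolding presheaf_hom_def Let_def by (auto simp: PiE_def Pi_iff)
  also have "\<dots> \<longleftrightarrow> ?R" unfolding cocone_def 1 using 2 by (smt (verit))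
  finally show ?thesis .
qed

lemma presheaf_dst:
  assumes "\<theta> \<in> pts (presheaf_hom Set_fp UMet UMet (id_functor Set_fp) GF X B)"
    and "\<theta>' \<in> pts (presheaf_hom Set_fp UMet UMet (id_functor Set_fp) GF X B)"
  shows "dst (presheaf_hom Set_fp UMet UMet (id_functor Set_fp) GF X B) \<theta> \<theta>' =
    (SUP N\<in>Ob Set_fp. SUP \<phi>\<in>nonexpanding N X. sup_dist (FO F N) B (\<theta> N \<phi>) (\<theta>' N \<phi>))"
proof -
  have in_B: "\<theta> N \<phi> \<in> nonexpanding (FO F N) B" "\<theta>' N \<phi> \<in> nonexpanding (FO F N) B"
    if "N \<in> Ob Set_fp" "\<phi> \<in> nonexpanding N X" for N \<phi>
    using assms[unfolded presheaf_pts cocone_def] that by simp_all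
  have "dst (presheaf_hom Set_fp UMet UMet (id_functor Set_fp) GF X B) \<theta> \<theta>' = (SUP N\<in>Ob Set_fp.
      sup_dist (hom_space UMet (FO (id_functor Set_fp) N) X) (hom_space UMet (FO GF N) B) (\<theta> N) (\<theta>' N))"
    using assms unfolding presheaf_hom_def Let_def by simp
  also have "\<dots> = (SUP N\<in>Ob Set_fp. SUP \<phi>\<in>nonexpanding N X. sup_dist (FO F N) B (\<theta> N \<phi>) (\<theta>' N \<phi>))"
    by (intro SUP_cong refl) (simp add: hom_space_UMet sup_dist_mk_space in_B)
  finally show ?thesis .
qed

lemma Kan_in_presheaf:
  assumes X: "X \<in> Ob UMet" and B: "B \<in> Ob UMet" and u: "u \<in> nonexpanding (FO F X) B"
  shows "Kan X u \<in> pts (presheaf_hom Set_fp UMet UMet (id_functor Set_fp) GF X B)"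
proof -
  have K: "Kan X u N \<phi> = compose (pts (FO F N)) u (FM F N X \<phi>)" if "N \<in> Ob Set_fp" "\<phi> \<in> nonexpanding N X" for N \<phi>
    using that by (auto simp: id_transformation_def compose_def intro!: restrict_ext)
  have "cocone F X B (Kan X u)"
    unfolding cocone_def
  proof (intro conjI ballI)
    fix N :: "'u emetric" and \<phi> assume N: "N \<in> Ob Set_fp" and \<phi>: "\<phi> \<in> nonexpanding N X"
    show "Kan X u N \<phi> \<in> nonexpanding (FO F N) B"
      unfolding K[OF N \<phi>] by (intro nonexpanding_compose[OF FM_in u] Set_fp_UMet N X \<phi>)
    fix \<psi> t assume \<psi>: "\<psi> \<in> nonexpanding N X" and t: "t \<in> pts (FO F N)"
    have "dst B (u (FM F N X \<phi> t)) (u (FM F N X \<psi> t)) \<le> dst (FO F X) (FM F N X \<phi> t) (FM F N X \<psi> t)"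
      by (intro nonexpanding_le[OF u] FM_pts Set_fp_UMet N X \<phi> \<psi> t)
    also have "\<dots> \<le> sup_dist N X \<phi> \<psi>" by (intro FM_le Set_fp_UMet N X \<phi> \<psi> t)
    finally show "dst B (Kan X u N \<phi> t) (Kan X u N \<psi> t) \<le> sup_dist N X \<phi> \<psi>"
      unfolding Kan_apply[OF N \<phi> t] Kan_apply[OF N \<psi> t] .
  next
    fix N N' :: "'u emetric" and f \<phi> t assume N: "N \<in> Ob Set_fp" "N' \<in> Ob Set_fp" and f: "f \<in> nonexpanding N N'"
      and \<phi>: "\<phi> \<in> nonexpanding N' X" and t: "t \<in> pts (FO F N)"
    show "Kan X u N (compose (pts N) \<phi> f) t = Kan X u N' \<phi> (FM F N N' f t)"
      unfolding Kan_apply[OF N(1) nonexpanding_compose[OF f \<phi>] t]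
        Kan_apply[OF N(2) \<phi> FM_pts[OF Set_fp_UMet Set_fp_UMet f t, OF N]]
      using FM_comp[OF Set_fp_UMet Set_fp_UMet X f \<phi> t, OF N] by simp
  qed
  then show ?thesis unfolding presheaf_pts by auto
qed

text \<open>Enrichment of the inclusion and of the restricted functor and naturality of the identity
  unit are automatic, which leaves only the comparison maps.\<close>

lemma strongly_finitary_iff:
  "strongly_finitary F \<longleftrightarrow> (\<forall>X\<in>Ob UMet. \<forall>B\<in>Ob UMet.
    isometric_iso (hom_space UMet (FO F X) B) (presheaf_hom Set_fp UMet UMet (id_functor Set_fp) GF X B) (Kan X))"
proof -
  have "natural_transformation Set_fp UMet GF GF (id_transformation Set_fp UMet GF)"
    using enriched_restriction
    by (auto simp: natural_transformation_def id_transformation_def enriched_functor_def is_functor_def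
        nonexpanding_id compose_def FM_pts Set_fp_UMet intro!: restrict_ext)
  then show ?thesis
    unfolding strongly_finitary_def Let_def is_left_Kan_extension_def
    by (simp add: enriched_restriction enriched_inclusion enriched)
qed

text \<open>Generation makes the comparison map injective and isometric, because a supremum over all
  points of \<open>FO F X\<close> is then one over the points reached from finite discrete spaces.
  Extension of cocones is surjectivity.\<close>

lemma strongly_finitaryI:
  assumes generated: "\<And>X t. \<lbrakk>X \<in> Ob UMet; t \<in> pts (FO F X)\<rbrakk> \<Longrightarrow>
      \<exists>N\<in>Ob Set_fp. \<exists>\<phi>\<in>nonexpanding N X. \<exists>s\<in>pts (FO F N). t = FM F N X \<phi> s"
    and extend: "\<And>X B \<theta>. \<lbrakk>X \<in> Ob UMet; B \<in> Ob UMet; cocone F X B \<theta>\<rbrakk> \<Longrightarrow>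
      \<exists>u\<in>nonexpanding (FO F X) B. \<forall>N\<in>Ob Set_fp. \<forall>\<phi>\<in>nonexpanding N X. \<forall>s\<in>pts (FO F N). u (FM F N X \<phi> s) = \<theta> N \<phi> s"
  shows "strongly_finitary F"
  unfolding strongly_finitary_iff
proof (intro ballI)
  fix X B :: "'u emetric" assume X: "X \<in> Ob UMet" and B: "B \<in> Ob UMet"
  let ?P = "presheaf_hom Set_fp UMet UMet (id_functor Set_fp) GF X B"
  have d: "dst ?P (Kan X u) (Kan X v) = sup_dist (FO F X) B u v"
    if u: "u \<in> nonexpanding (FO F X) B" and v: "v \<in> nonexpanding (FO F X) B" for u v
    unfolding presheaf_dst[OF Kan_in_presheaf[OF X B u] Kan_in_presheaf[OF X B v]]
  proof (rule antisym)
    show "(SUP N\<in>Ob Set_fp. SUP \<phi>\<in>nonexpanding N X. sup_dist (FO F N) B (Kan X u N \<phi>) (Kan X v N \<phi>))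
        \<le> sup_dist (FO F X) B u v"
    proof (intro SUP_least sup_dist_le)
      fix N \<phi> t assume "N \<in> Ob Set_fp" "\<phi> \<in> nonexpanding N X" "t \<in> pts (FO F N)"
      then show "dst B (Kan X u N \<phi> t) (Kan X v N \<phi> t) \<le> sup_dist (FO F X) B u v"
        unfolding Kan_apply[OF \<open>N \<in> Ob Set_fp\<close> \<open>\<phi> \<in> nonexpanding N X\<close> \<open>t \<in> pts (FO F N)\<close>]
        by (intro le_sup_dist FM_pts Set_fp_UMet X)
    qed
    show "sup_dist (FO F X) B u v
        \<le> (SUP N\<in>Ob Set_fp. SUP \<phi>\<in>nonexpanding N X. sup_dist (FO F N) B (Kan X u N \<phi>) (Kan X v N \<phi>))"
    proof (rule sup_dist_le)
      fix t assume "t \<in> pts (FO F X)"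
      then obtain N \<phi> s where N: "N \<in> Ob Set_fp" and \<phi>: "\<phi> \<in> nonexpanding N X" and s: "s \<in> pts (FO F N)"
        and t: "t = FM F N X \<phi> s"
        using generated[OF X] by blast
      have "dst B (u t) (v t) = dst B (Kan X u N \<phi> s) (Kan X v N \<phi> s)"
        unfolding Kan_apply[OF N \<phi> s] t ..
      also have "\<dots> \<le> sup_dist (FO F N) B (Kan X u N \<phi>) (Kan X v N \<phi>)" by (rule le_sup_dist[OF s])
      also have "\<dots> \<le> (SUP \<phi>\<in>nonexpanding N X. sup_dist (FO F N) B (Kan X u N \<phi>) (Kan X v N \<phi>))"
        by (rule SUP_upper[OF \<phi>])
      also have "\<dots> \<le> (SUP N\<in>Ob Set_fp. SUP \<phi>\<in>nonexpanding N X. sup_dist (FO F N) B (Kan X u N \<phi>) (Kan X v N \<phi>))"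
        by (rule SUP_upper[OF N])
      finally show "dst B (u t) (v t)
        \<le> (SUP N\<in>Ob Set_fp. SUP \<phi>\<in>nonexpanding N X. sup_dist (FO F N) B (Kan X u N \<phi>) (Kan X v N \<phi>))" .
    qed
  qed
  have "inj_on (Kan X) (nonexpanding (FO F X) B)"
  proof (rule inj_onI)
    fix u v assume u: "u \<in> nonexpanding (FO F X) B" and v: "v \<in> nonexpanding (FO F X) B" and e: "Kan X u = Kan X v"
    show "u = v"
    proof (rule nonexpanding_eqI[OF u v])
      fix t assume "t \<in> pts (FO F X)"
      then obtain N \<phi> s where N: "N \<in> Ob Set_fp" and \<phi>: "\<phi> \<in> nonexpanding N X" and s: "s \<in> pts (FO F N)"
        and t: "t = FM F N X \<phi> s"
        using generated[OF X] by blast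
      show "u t = v t" using fun_cong[OF fun_cong[OF fun_cong[OF e]], of N \<phi> s]
        unfolding Kan_apply[OF N \<phi> s] t .
    qed
  qed
  moreover have "Kan X ` nonexpanding (FO F X) B = pts ?P"
  proof
    show "Kan X ` nonexpanding (FO F X) B \<subseteq> pts ?P" using Kan_in_presheaf[OF X B] by blast
    show "pts ?P \<subseteq> Kan X ` nonexpanding (FO F X) B"
    proof
      fix \<theta> assume \<theta>: "\<theta> \<in> pts ?P"
      then have c: "cocone F X B \<theta>" by (simp add: presheaf_pts)
      then obtain u where u: "u \<in> nonexpanding (FO F X) B"
        and u\<theta>: "\<And>N \<phi> s. \<lbrakk>N \<in> Ob Set_fp; \<phi> \<in> nonexpanding N X; s \<in> pts (FO F N)\<rbrakk> \<Longrightarrow> u (FM F N X \<phi> s) = \<theta> N \<phi> s"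
        using extend[OF X B] by blast
      have pt: "\<theta> N \<phi> s = Kan X u N \<phi> s" if N: "N \<in> Ob Set_fp" "\<phi> \<in> nonexpanding N X" for N \<phi> s
      proof (cases "s \<in> pts (FO F N)")
        case True
        show ?thesis unfolding Kan_apply[OF N True] using u\<theta>[OF N True] by simp
      next
        \<comment> \<open>Outside the points of \<open>FO F N\<close> both functions are
          \<open>undefined\<close>; equality in the presheaf space is HOL equality.\<close>
        case False
        have "\<theta> N \<phi> \<in> nonexpanding (FO F N) B" using c N by (simp add: cocone_def)
        then have "\<theta> N \<phi> s = undefined" using False by (intro extensional_arb[OF nonexpanding_ext])
        then show ?thesis using False N by (simp add: compose_def)
      qed
      have "\<theta> N \<phi> = Kan X u N \<phi>" if N: "N \<in> Ob Set_fp" "\<phi> \<in> nonexpanding N X" for N \<phi>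
        by (rule ext) (rule pt[OF N])
      then have "\<theta> N = Kan X u N" if N: "N \<in> Ob Set_fp" for N
        using that \<theta> by (intro extensionalityI[of _ "nonexpanding N X"]) (auto simp: presheaf_pts)
      then have "\<theta> = Kan X u"
        using \<theta> by (intro extensionalityI[of _ "Ob Set_fp"]) (auto simp: presheaf_pts)
      then show "\<theta> \<in> Kan X ` nonexpanding (FO F X) B" using u by blast
    qed
  qed
  ultimately show "isometric_iso (hom_space UMet (FO F X) B) ?P (Kan X)"
    unfolding isometric_iso_def bij_betw_def hom_space_UMet using d by simp
qed

lemma strongly_finitary_extend:
  fixes X B :: "'u emetric"
  assumes sf: "strongly_finitary F" and X: "X \<in> Ob UMet" and B: "B \<in> Ob UMet" and c: "cocone F X B \<theta>"
  shows "\<exists>u\<in>nonexpanding (FO F X) B. \<forall>N\<in>Ob Set_fp. \<forall>\<phi>\<in>nonexpanding N X. \<forall>s\<in>pts (FO F N). u (FM F N X \<phi> s) = \<theta> N \<phi> s"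
proof -
  let ?P = "presheaf_hom Set_fp UMet UMet (id_functor Set_fp) GF X B"
  \<comment> \<open>The cocone is made extensional to become a point of the presheaf space.\<close>
  let ?\<theta> = "\<lambda>N\<in>Ob Set_fp. \<lambda>\<phi>\<in>nonexpanding N X. \<theta> N \<phi>"
  have "cocone F X B ?\<theta>"
    using c unfolding cocone_def by (simp add: nonexpanding_compose[where Y = "_ :: 'u emetric"])
  then have "?\<theta> \<in> pts ?P" by (simp add: presheaf_pts)
  moreover have "isometric_iso (hom_space UMet (FO F X) B) ?P (Kan X)"
    using sf X B unfolding strongly_finitary_iff by blast
  then have "Kan X ` nonexpanding (FO F X) B = pts ?P"
    by (simp add: isometric_iso_def bij_betw_def hom_space_UMet)
  ultimately obtain u where u: "u \<in> nonexpanding (FO F X) B" and e: "?\<theta> = Kan X u" by blast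
  have "u (FM F N X \<phi> s) = \<theta> N \<phi> s" if "N \<in> Ob Set_fp" "\<phi> \<in> nonexpanding N X" "s \<in> pts (FO F N)" for N \<phi> s
    using fun_cong[OF fun_cong[OF fun_cong[OF e]], of N \<phi> s] unfolding Kan_apply[OF that] using that by simp
  then show ?thesis using u by blast
qed

lemma strongly_finitary_unique:
  fixes X B :: "'u emetric"
  assumes sf: "strongly_finitary F" and X: "X \<in> Ob UMet" and B: "B \<in> Ob UMet"
    and u: "u \<in> nonexpanding (FO F X) B" and v: "v \<in> nonexpanding (FO F X) B"
    and e: "\<And>N \<phi> s. \<lbrakk>N \<in> Ob Set_fp; \<phi> \<in> nonexpanding N X; s \<in> pts (FO F N)\<rbrakk> \<Longrightarrow> u (FM F N X \<phi> s) = v (FM F N X \<phi> s)"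
  shows "u = v"
proof -
  let ?P = "presheaf_hom Set_fp UMet UMet (id_functor Set_fp) GF X B"
  have "isometric_iso (hom_space UMet (FO F X) B) ?P (Kan X)"
    using sf X B unfolding strongly_finitary_iff by blast
  then have "inj_on (Kan X) (nonexpanding (FO F X) B)"
    by (simp add: isometric_iso_def bij_betw_def hom_space_UMet)
  moreover have "Kan X u = Kan X v"
    using e by (auto simp: compose_def id_transformation_def intro!: restrict_ext)
  ultimately show ?thesis using inj_onD[OF _ _ u v] by blast
qed

text \<open>The points reached from finite discrete spaces form a subspace through which the identity
  factors, by the universal property applied to that subspace.\<close>

lemma strongly_finitary_generated:
  fixes X :: "'u emetric"
  assumes sf: "strongly_finitary F" and X: "X \<in> Ob UMet" and t: "t \<in> pts (FO F X)"
  shows "\<exists>N\<in>Ob Set_fp. \<exists>\<phi>\<in>nonexpanding N X. \<exists>s\<in>pts (FO F N). t = FM F N X \<phi> s"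
proof -
  define S where "S = {FM F N X \<phi> s | N \<phi> s. N \<in> Ob Set_fp \<and> \<phi> \<in> nonexpanding N X \<and> s \<in> pts (FO F N)}"
  have SX: "S \<subseteq> pts (FO F X)"
    unfolding S_def using FM_pts[OF Set_fp_UMet X] by blast
  define B where "B = mk_space S (dst (FO F X))"
  have U: "ultrametric_space (FO F X)" using Ob_UMetD[OF FO_Ob[OF X]] .
  have "ultrametric_space B"
    unfolding B_def using U SX by (rule ultrametric_subspace)
  then have B: "B \<in> Ob UMet"
    using FO_Ob[OF X] small_subset[OF _ SX] by (simp add: Ob_UMet B_def)
  have SI: "FM F N X \<phi> s \<in> S" if "N \<in> Ob Set_fp" "\<phi> \<in> nonexpanding N X" "s \<in> pts (FO F N)" for N \<phi> s
    using that by (auto simp: S_def)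
  have c: "cocone F X B (\<lambda>N \<phi>. FM F N X \<phi>)"
    unfolding cocone_def
  proof (intro conjI ballI)
    fix N :: "'u emetric" and \<phi> assume N: "N \<in> Ob Set_fp" and \<phi>: "\<phi> \<in> nonexpanding N X"
    have F: "FM F N X \<phi> \<in> nonexpanding (FO F N) (FO F X)" by (intro FM_in Set_fp_UMet N X \<phi>)
    show "FM F N X \<phi> \<in> nonexpanding (FO F N) B"
      using SI[OF N \<phi>] nonexpanding_ext[OF F] nonexpanding_le[OF F] by (intro nonexpandingI) (auto simp: B_def)
    fix \<psi> t assume \<psi>: "\<psi> \<in> nonexpanding N X" and t: "t \<in> pts (FO F N)"
    show "dst B (FM F N X \<phi> t) (FM F N X \<psi> t) \<le> sup_dist N X \<phi> \<psi>"
      using FM_le[OF Set_fp_UMet[OF N] X \<phi> \<psi> t] SI[OF N \<phi> t] SI[OF N \<psi> t] by (simp add: B_def)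
  next
    fix N N' :: "'u emetric" and f \<phi> t assume "N \<in> Ob Set_fp" "N' \<in> Ob Set_fp" "f \<in> nonexpanding N N'" "\<phi> \<in> nonexpanding N' X" "t \<in> pts (FO F N)"
    then show "FM F N X (compose (pts N) \<phi> f) t = FM F N' X \<phi> (FM F N N' f t)"
      by (intro FM_comp Set_fp_UMet X)
  qed
  obtain u where u: "u \<in> nonexpanding (FO F X) B"
    and e: "\<forall>N\<in>Ob Set_fp. \<forall>\<phi>\<in>nonexpanding N X. \<forall>s\<in>pts (FO F N). u (FM F N X \<phi> s) = FM F N X \<phi> s"
    using strongly_finitary_extend[OF sf X B c] by (elim bexE)
  have "u \<in> nonexpanding (FO F X) (FO F X)"
  proof (rule nonexpandingI)
    show "u \<in> extensional (pts (FO F X))" using nonexpanding_ext[OF u] .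
    show "u x \<in> pts (FO F X)" if "x \<in> pts (FO F X)" for x
      using nonexpanding_pts[OF u that] SX by (auto simp: B_def)
    show "dst (FO F X) (u x) (u y) \<le> dst (FO F X) x y" if "x \<in> pts (FO F X)" "y \<in> pts (FO F X)" for x y
      using nonexpanding_le[OF u that] nonexpanding_pts[OF u that(1)] nonexpanding_pts[OF u that(2)]
      by (simp add: B_def)
  qed
  \<comment> \<open>\<open>u\<close> is now regarded as an endomap of the whole space
    \<open>FO F X\<close>; it fixes every point of \<open>S\<close>, and maps out of
    \<open>FO F X\<close> are determined by their values there.\<close>
  then have "u = (\<lambda>x\<in>pts (FO F X). x)"
  proof (rule strongly_finitary_unique[OF sf X FO_Ob[OF X] _ nonexpanding_id])
    fix N \<phi> s assume N: "N \<in> Ob Set_fp" "\<phi> \<in> nonexpanding N X" "s \<in> pts (FO F N)"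
    show "u (FM F N X \<phi> s) = (\<lambda>x\<in>pts (FO F X). x) (FM F N X \<phi> s)"
      using e[rule_format, OF N] subsetD[OF SX SI[OF N]] by simp
  qed
  then have "t \<in> S" using nonexpanding_pts[OF u t] t by (simp add: B_def)
  then show ?thesis unfolding S_def by blast
qed

end


section \<open>Terms with variables in an arbitrary set\<close>

text \<open>The terms \<open>trm\<close> have variables in \<open>nat\<close> only. A free algebra
  on a space takes its points as variables, and \<open>tmap\<close> renames them along maps of
  spaces; \<open>conv\<close> connects the two kinds of terms.\<close>

datatype (dead 's, vars: 'a) tm = TV 'a | TF 's "('s, 'a) tm list"
  for map: tmap

inductive_set tms :: "'s sig \<Rightarrow> 'a set \<Rightarrow> ('s, 'a) tm set" for \<Sigma> X
  where
    TV: "x \<in> X \<Longrightarrow> TV x \<in> tms \<Sigma> X"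
  | TF: "\<sigma> \<in> symbols \<Sigma> \<Longrightarrow> length ts = arity \<Sigma> \<sigma> \<Longrightarrow> \<forall>t\<in>set ts. t \<in> tms \<Sigma> X \<Longrightarrow> TF \<sigma> ts \<in> tms \<Sigma> X"

primrec eval :: "('s, 'b) alg \<Rightarrow> ('a \<Rightarrow> 'b) \<Rightarrow> ('s, 'a) tm \<Rightarrow> 'b"
  where
    "eval A f (TV x) = f x"
  | "eval A f (TF \<sigma> ts) = opn A \<sigma> (map (eval A f) ts)"

primrec subst :: "('a \<Rightarrow> ('s, 'b) tm) \<Rightarrow> ('s, 'a) tm \<Rightarrow> ('s, 'b) tm"
  where
    "subst g (TV x) = g x"
  | "subst g (TF \<sigma> ts) = TF \<sigma> (map (subst g) ts)"

primrec conv :: "'s trm \<Rightarrow> ('s, nat) tm"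
  where
    "conv (Vr x) = TV x"
  | "conv (Fn \<sigma> ts) = TF \<sigma> (map conv ts)"

lemma TV_tms [simp]: "TV x \<in> tms \<Sigma> X \<longleftrightarrow> x \<in> X"
  by (auto intro: tms.TV elim: tms.cases)

lemma TF_tms [simp]: "TF \<sigma> ts \<in> tms \<Sigma> X \<longleftrightarrow> \<sigma> \<in> symbols \<Sigma> \<and> length ts = arity \<Sigma> \<sigma> \<and> set ts \<subseteq> tms \<Sigma> X"
  by (auto intro: tms.TF elim: tms.cases)

lemma vars_tms: "t \<in> tms \<Sigma> X \<Longrightarrow> vars t \<subseteq> X"
  by (induction rule: tms.induct) auto

lemma tms_vars: "t \<in> tms \<Sigma> X \<Longrightarrow> vars t \<subseteq> Y \<Longrightarrow> t \<in> tms \<Sigma> Y"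
  by (induction rule: tms.induct) auto

lemma finite_vars: "finite (vars t)"
  by (induction t) auto

lemma tmap_tms: "t \<in> tms \<Sigma> X \<Longrightarrow> (\<And>x. x \<in> X \<Longrightarrow> f x \<in> Y) \<Longrightarrow> tmap f t \<in> tms \<Sigma> Y"
  by (induction rule: tms.induct) auto

lemma subst_tms: "t \<in> tms \<Sigma> X \<Longrightarrow> (\<And>x. x \<in> X \<Longrightarrow> g x \<in> tms \<Sigma> Y) \<Longrightarrow> subst g t \<in> tms \<Sigma> Y"
  by (induction rule: tms.induct) auto

lemma subst_cong: "(\<And>x. x \<in> vars t \<Longrightarrow> g x = g' x) \<Longrightarrow> subst g t = subst g' t"
  by (induction t) auto

lemma conv_tms: "t \<in> terms \<Sigma> \<Longrightarrow> conv t \<in> tms \<Sigma> UNIV"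
  by (induction rule: terms.induct) auto

lemma term_ext_eval: "term_ext A f t = eval A f (conv t)"
  by (induction t) (auto cong: map_cong)

lemma eval_tmap: "eval A f (tmap g t) = eval A (\<lambda>x. f (g x)) t"
  by (induction t) (auto simp: o_def cong: map_cong)

lemma eval_subst: "eval A f (subst g t) = eval A (\<lambda>x. eval A f (g x)) t"
  by (induction t) (auto simp: o_def cong: map_cong)

lemma eval_cong: "(\<And>x. x \<in> vars t \<Longrightarrow> f x = g x) \<Longrightarrow> eval A f t = eval A g t"
proof (induction t)
  case (TF \<sigma> ts)
  have "map (eval A f) ts = map (eval A g) ts"
    using TF.prems by (intro map_cong refl TF.IH) auto
  then show ?case by (simp only: eval.simps)
qed simp

lemma eval_pts:
  assumes "ultra_algebra \<Sigma> A" "t \<in> tms \<Sigma> X" "\<And>x. x \<in> X \<Longrightarrow> f x \<in> pts (underlying A)"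
  shows "eval A f t \<in> pts (underlying A)"
  using assms(2) by (induction rule: tms.induct) (auto intro!: opn_pts[OF assms(1)] assms(3))

lemma eval_hom:
  assumes "ultra_algebra \<Sigma> A" "h \<in> homomorphisms \<Sigma> A B" "t \<in> tms \<Sigma> X"
    and "\<And>x. x \<in> X \<Longrightarrow> f x \<in> pts (underlying A)"
  shows "h (eval A f t) = eval B (\<lambda>x. h (f x)) t"
  using assms(3)
proof (induction rule: tms.induct)
  case (TF \<sigma> ts)
  have "set (map (eval A f) ts) \<subseteq> pts (underlying A)"
    using TF eval_pts[where f = f, OF assms(1) _ assms(4)] by auto
  then have "h (opn A \<sigma> (map (eval A f) ts)) = opn B \<sigma> (map h (map (eval A f) ts))"
    using TF by (intro homomorphism_opn[OF assms(2)]) auto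
  moreover have "map h (map (eval A f) ts) = map (eval B (\<lambda>x. h (f x))) ts" using TF by simp
  ultimately show ?case by (simp del: map_map)
qed simp

section \<open>Distances between values of operations and terms\<close>

lemma dst_power_space:
  "\<lbrakk>xs \<in> pts (power_space X n); ys \<in> pts (power_space X n)\<rbrakk> \<Longrightarrow>
    dst (power_space X n) xs ys = (SUP i\<in>{..<n}. dst X (xs ! i) (ys ! i))"
  by (simp add: power_space_def Let_def)

lemma opn_le:
  assumes "ultra_algebra \<Sigma> A" "\<sigma> \<in> symbols \<Sigma>"
    and "length xs = arity \<Sigma> \<sigma>" "set xs \<subseteq> pts (underlying A)"
    and "length ys = arity \<Sigma> \<sigma>" "set ys \<subseteq> pts (underlying A)"
    and "\<And>i. i < arity \<Sigma> \<sigma> \<Longrightarrow> dst (underlying A) (xs ! i) (ys ! i) \<le> c"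
  shows "dst (underlying A) (opn A \<sigma> xs) (opn A \<sigma> ys) \<le> c"
proof -
  let ?P = "power_space (underlying A) (arity \<Sigma> \<sigma>)"
  have xy: "xs \<in> pts ?P" "ys \<in> pts ?P" using assms by (auto simp: pts_power_space)
  have "opn A \<sigma> \<in> nonexpanding ?P (underlying A)" using assms by (auto simp: ultra_algebra_def)
  from nonexpanding_le[OF this xy] have "dst (underlying A) (opn A \<sigma> xs) (opn A \<sigma> ys) \<le> dst ?P xs ys" .
  also have "\<dots> \<le> c" unfolding dst_power_space[OF xy] using assms(7) by (intro SUP_least) auto
  finally show ?thesis .
qed

text \<open>Since powers carry the maximum metric, a bound on the distance of two valuations does
  not grow as operations are nested.\<close>

lemma eval_le:
  assumes A: "ultra_algebra \<Sigma> A" and t: "t \<in> tms \<Sigma> X"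
    and f: "\<And>x. x \<in> X \<Longrightarrow> f x \<in> pts (underlying A)" and g: "\<And>x. x \<in> X \<Longrightarrow> g x \<in> pts (underlying A)"
    and "\<And>x. x \<in> X \<Longrightarrow> dst (underlying A) (f x) (g x) \<le> c"
  shows "dst (underlying A) (eval A f t) (eval A g t) \<le> c"
  using t
proof (induction rule: tms.induct)
  case (TF \<sigma> ts)
  have "eval A f u \<in> pts (underlying A)" "eval A g u \<in> pts (underlying A)" if "u \<in> set ts" for u
    using TF that f g by (auto intro!: eval_pts[OF A, where X = X])
  then show ?case using TF by (auto intro!: opn_le[OF A])
qed (use assms in simp)

definition mk_alg :: "'s sig \<Rightarrow> 'a emetric \<Rightarrow> ('s \<Rightarrow> 'a list \<Rightarrow> 'a) \<Rightarrow> ('s, 'a) alg"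
  where "mk_alg \<Sigma> U g = \<lparr>underlying = U,
    opn = (\<lambda>\<sigma>\<in>symbols \<Sigma>. \<lambda>xs\<in>pts (power_space U (arity \<Sigma> \<sigma>)). g \<sigma> xs)\<rparr>"

lemma underlying_mk_alg [simp]: "underlying (mk_alg \<Sigma> U g) = U"
  by (simp add: mk_alg_def)

lemma opn_mk_alg:
  "\<lbrakk>\<sigma> \<in> symbols \<Sigma>; length xs = arity \<Sigma> \<sigma>; set xs \<subseteq> pts U\<rbrakk> \<Longrightarrow> opn (mk_alg \<Sigma> U g) \<sigma> xs = g \<sigma> xs"
  by (simp add: mk_alg_def pts_power_space)

lemma ultra_algebra_mk_alg:
  assumes "ultrametric_space U"
    and "\<And>\<sigma> xs. \<lbrakk>\<sigma> \<in> symbols \<Sigma>; length xs = arity \<Sigma> \<sigma>; set xs \<subseteq> pts U\<rbrakk> \<Longrightarrow> g \<sigma> xs \<in> pts U"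
    and "\<And>\<sigma> xs ys c. \<lbrakk>\<sigma> \<in> symbols \<Sigma>; length xs = arity \<Sigma> \<sigma>; set xs \<subseteq> pts U; length ys = arity \<Sigma> \<sigma>; set ys \<subseteq> pts U;
      \<And>i. i < arity \<Sigma> \<sigma> \<Longrightarrow> dst U (xs ! i) (ys ! i) \<le> c\<rbrakk> \<Longrightarrow> dst U (g \<sigma> xs) (g \<sigma> ys) \<le> c"
  shows "ultra_algebra \<Sigma> (mk_alg \<Sigma> U g)"
proof -
  have "opn (mk_alg \<Sigma> U g) \<sigma> \<in> nonexpanding (power_space U (arity \<Sigma> \<sigma>)) U" if \<sigma>: "\<sigma> \<in> symbols \<Sigma>" for \<sigma>
  proof (rule nonexpandingI)
    fix xs ys assume xy: "xs \<in> pts (power_space U (arity \<Sigma> \<sigma>))" "ys \<in> pts (power_space U (arity \<Sigma> \<sigma>))"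
    then have l: "length xs = arity \<Sigma> \<sigma>" "set xs \<subseteq> pts U" "length ys = arity \<Sigma> \<sigma>" "set ys \<subseteq> pts U"
      by (auto simp: pts_power_space)
    show "dst U (opn (mk_alg \<Sigma> U g) \<sigma> xs) (opn (mk_alg \<Sigma> U g) \<sigma> ys) \<le> dst (power_space U (arity \<Sigma> \<sigma>)) xs ys"
      unfolding opn_mk_alg[OF \<sigma> l(1,2)] opn_mk_alg[OF \<sigma> l(3,4)] dst_power_space[OF xy]
      by (intro assms(3)[OF \<sigma> l] SUP_upper) auto
  qed (use \<sigma> assms(2) in \<open>auto simp: mk_alg_def pts_power_space\<close>)
  then show ?thesis unfolding ultra_algebra_def using assms(1) by (auto simp: mk_alg_def)
qed

lemma alg_eqI:
  assumes "ultra_algebra \<Sigma> A" "ultra_algebra \<Sigma> B" "underlying A = underlying B"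
    and "\<And>\<sigma> xs. \<lbrakk>\<sigma> \<in> symbols \<Sigma>; length xs = arity \<Sigma> \<sigma>; set xs \<subseteq> pts (underlying A)\<rbrakk> \<Longrightarrow> opn A \<sigma> xs = opn B \<sigma> xs"
  shows "A = B"
proof (rule alg.equality)
  show "opn A = opn B"
  proof (rule extensionalityI)
    show "opn A \<in> extensional (symbols \<Sigma>)" "opn B \<in> extensional (symbols \<Sigma>)"
      using assms(1,2) by (auto simp: ultra_algebra_def PiE_def)
    fix \<sigma> assume \<sigma>: "\<sigma> \<in> symbols \<Sigma>"
    show "opn A \<sigma> = opn B \<sigma>"
    proof (rule nonexpanding_eqI)
      show "opn A \<sigma> \<in> nonexpanding (power_space (underlying A) (arity \<Sigma> \<sigma>)) (underlying A)"
        "opn B \<sigma> \<in> nonexpanding (power_space (underlying A) (arity \<Sigma> \<sigma>)) (underlying B)"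
        using assms(1-3) \<sigma> by (auto simp: ultra_algebra_def PiE_def Pi_iff)
    qed (use assms(4) \<sigma> in \<open>auto simp: pts_power_space\<close>)
  qed
qed (use assms in auto)

section \<open>Quotients of term algebras by pseudometrics\<close>

context universe
begin

text \<open>Arities are finite, so countably many stages exhaust the terms, and each stage is
  small.\<close>

lemma lessU_tms:
  assumes \<Sigma>: "lessU (symbols \<Sigma>)" and X: "lessU X"
  shows "lessU (tms \<Sigma> X)"
proof -
  \<comment> \<open>The stages ignore arities; a superset is enough to bound the size.\<close>
  define lv where "lv n = ((\<lambda>L. TV ` X \<union> (\<lambda>(\<sigma>, ts). TF \<sigma> ts) ` (symbols \<Sigma> \<times> lists L)) ^^ n) {}" for n
  have lv_Suc: "lv (Suc n) = TV ` X \<union> (\<lambda>(\<sigma>, ts). TF \<sigma> ts) ` (symbols \<Sigma> \<times> lists (lv n))" for n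
    by (simp add: lv_def)
  have "lessU (lv n)" for n
  proof (induction n)
    case 0
    show ?case using lessU_finite[of "{}"] by (simp add: lv_def)
  next
    case (Suc n)
    then show ?case unfolding lv_Suc by (intro lessU_Un lessU_image lessU_Sigma lessU_lists X \<Sigma>)
  qed
  then have L: "lessU (\<Union>n. lv n)" using lessU_UN[OF lessU_countable, of UNIV lv] by simp
  have mono: "lv n \<subseteq> lv (n + k)" for n k
  proof -
    have 1: "lv n \<subseteq> lv (Suc n)" for n
    proof (induction n)
      case 0
      show ?case by (simp add: lv_def)
    next
      case (Suc n)
      then have "lists (lv n) \<subseteq> lists (lv (Suc n))" by (rule lists_mono)
      then show ?case using lv_Suc[of n] lv_Suc[of "Suc n"] by blast
    qed
    then show ?thesis using lift_Suc_mono_le[of lv n "n + k"] by simp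
  qed
  have "t \<in> (\<Union>n. lv n)" if "t \<in> tms \<Sigma> X" for t
    using that
  proof (induction rule: tms.induct)
    case (TV x)
    then show ?case using lv_Suc[of 0] by auto
  next
    case (TF \<sigma> ts)
    then have "\<forall>t\<in>set ts. \<exists>n. t \<in> lv n" by blast
    then obtain m where m: "\<And>t. t \<in> set ts \<Longrightarrow> t \<in> lv (m t)" by metis
    \<comment> \<open>The sum bounds the stages of all arguments at once, also when there are
      none.\<close>
    define k where "k = sum m (set ts)"
    have "t \<in> lv k" if "t \<in> set ts" for t
      using m[OF that] mono[of "m t" "k - m t"] member_le_sum[OF that, of m] by (auto simp: k_def)
    then have "ts \<in> lists (lv k)" by (auto simp: in_lists_conv_set)
    then have "TF \<sigma> ts \<in> lv (Suc k)" using TF unfolding lv_Suc by blast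
    then show ?case by blast
  qed
  then show ?thesis using lessU_subset[OF L] by blast
qed

text \<open>A pseudo-ultrametric compatible with the operations has its zero-distance relation as a
  congruence. The classes are coded in \<open>'u\<close>, and the quotient map becomes evaluation of
  terms at the classes of variables.\<close>

lemma quotient_algebra:
  fixes \<Sigma> :: "'u sig" and X :: "'u set" and d :: "('u, 'u) tm \<Rightarrow> ('u, 'u) tm \<Rightarrow> ennreal"
  assumes \<Sigma>: "signature \<Sigma>" and X: "small X"
    and refl: "\<And>s. s \<in> tms \<Sigma> X \<Longrightarrow> d s s = 0"
    and sym: "\<And>s t. s \<in> tms \<Sigma> X \<Longrightarrow> t \<in> tms \<Sigma> X \<Longrightarrow> d s t = d t s"
    and tri: "\<And>s t r. s \<in> tms \<Sigma> X \<Longrightarrow> t \<in> tms \<Sigma> X \<Longrightarrow> r \<in> tms \<Sigma> X \<Longrightarrow> d s r \<le> max (d s t) (d t r)"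
    and ops: "\<And>\<sigma> ss ts c. \<lbrakk>\<sigma> \<in> symbols \<Sigma>; length ss = arity \<Sigma> \<sigma>; set ss \<subseteq> tms \<Sigma> X; length ts = arity \<Sigma> \<sigma>;
      set ts \<subseteq> tms \<Sigma> X; \<And>i. i < arity \<Sigma> \<sigma> \<Longrightarrow> d (ss ! i) (ts ! i) \<le> c\<rbrakk> \<Longrightarrow> d (TF \<sigma> ss) (TF \<sigma> ts) \<le> c"
  shows "\<exists>(A :: ('u, 'u) alg) q. A \<in> Ob (Sigma_UMet \<Sigma>) \<and> pts (underlying A) = q ` tms \<Sigma> X \<and>
    (\<forall>s\<in>tms \<Sigma> X. \<forall>t\<in>tms \<Sigma> X. dst (underlying A) (q s) (q t) = d s t) \<and>
    (\<forall>t\<in>tms \<Sigma> X. eval A (\<lambda>x. q (TV x)) t = q t)"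
proof -
  let ?T = "tms \<Sigma> X"
  define c where "c s = {t \<in> ?T. d s t = 0}" for s
  \<comment> \<open>Terms at distance zero have the same distance to every third term, so distances
    descend to classes.\<close>
  have z: "d s r = d t r" if "s \<in> ?T" "t \<in> ?T" "r \<in> ?T" "d s t = 0" for s t r
    using tri[of s t r] tri[of t s r] sym[of s t] that by (auto simp: max_def)
  have c: "c s = c t \<longleftrightarrow> d s t = 0" if st: "s \<in> ?T" "t \<in> ?T" for s t
  proof
    assume "c s = c t"
    moreover have "t \<in> c t" using st refl by (simp add: c_def)
    ultimately show "d s t = 0" by (auto simp: c_def)
  next
    assume "d s t = 0"
    then show "c s = c t" using z[OF st] by (auto simp: c_def)
  qed
  have "lessU (c ` ?T)"
    using \<Sigma> X by (intro lessU_image lessU_tms) (auto simp: signature_def small_iff_lessU)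
  then obtain j :: "('u, 'u) tm set \<Rightarrow> 'u" where j: "inj_on j (c ` ?T)" "small (j ` c ` ?T)"
    by (rule lessU_inject)
  define q where "q s = j (c s)" for s
  have q: "q s = q t \<longleftrightarrow> d s t = 0" if "s \<in> ?T" "t \<in> ?T" for s t
    unfolding q_def c[OF that, symmetric] using j(1) that by (auto simp: inj_on_def)
  define r where "r x = (SOME s. s \<in> ?T \<and> q s = x)" for x
  have r: "r x \<in> ?T" "q (r x) = x" if "x \<in> q ` ?T" for x
    using someI_ex[of "\<lambda>s. s \<in> ?T \<and> q s = x"] that unfolding r_def by blast+
  have dr: "d (r (q s)) (r (q t)) = d s t" if "s \<in> ?T" "t \<in> ?T" for s t
  proof -
    have r': "r (q s) \<in> ?T" "r (q t) \<in> ?T" "d (r (q s)) s = 0" "d (r (q t)) t = 0"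
      using that r[of "q s"] r[of "q t"] q by auto
    then have "d (r (q s)) (r (q t)) = d s (r (q t))" using that by (intro z)
    also have "\<dots> = d (r (q t)) s" using that r' by (intro sym)
    also have "\<dots> = d t s" using that r' by (intro z)
    finally show ?thesis using sym that by simp
  qed
  define U where "U = mk_space (q ` ?T) (\<lambda>x y. d (r x) (r y))"
  have Up: "pts U = q ` ?T" by (simp add: U_def)
  have Ud: "dst U (q s) (q t) = d s t" if "s \<in> ?T" "t \<in> ?T" for s t
    using that dr by (simp add: U_def)
  have U: "ultrametric_space U"
    unfolding U_def
  proof (rule ultrametric_mk_space)
    show "d (r x) (r y) = 0 \<longleftrightarrow> x = y" if "x \<in> q ` ?T" "y \<in> q ` ?T" for x y
      using q[of "r x" "r y"] r that by metis
    show "d (r x) (r y) = d (r y) (r x)" if "x \<in> q ` ?T" "y \<in> q ` ?T" for x y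
      using r that by (intro sym)
    show "d (r x) (r z) \<le> max (d (r x) (r y)) (d (r y) (r z))" if "x \<in> q ` ?T" "y \<in> q ` ?T" "z \<in> q ` ?T" for x y z
      using r that by (intro tri)
  qed
  define A where "A = mk_alg \<Sigma> U (\<lambda>\<sigma> xs. q (TF \<sigma> (map r xs)))"
  have rs: "set (map r xs) \<subseteq> ?T" if "set xs \<subseteq> q ` ?T" for xs using that r by auto
  have alg: "ultra_algebra \<Sigma> A"
    unfolding A_def
  proof (rule ultra_algebra_mk_alg[OF U])
    show "q (TF \<sigma> (map r xs)) \<in> pts U"
      if "\<sigma> \<in> symbols \<Sigma>" "length xs = arity \<Sigma> \<sigma>" "set xs \<subseteq> pts U" for \<sigma> xs
      using that rs[of xs] by (simp add: Up)
    show "dst U (q (TF \<sigma> (map r xs))) (q (TF \<sigma> (map r ys))) \<le> b"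
      if H: "\<sigma> \<in> symbols \<Sigma>" "length xs = arity \<Sigma> \<sigma>" "set xs \<subseteq> pts U" "length ys = arity \<Sigma> \<sigma>" "set ys \<subseteq> pts U"
        "\<And>i. i < arity \<Sigma> \<sigma> \<Longrightarrow> dst U (xs ! i) (ys ! i) \<le> b" for \<sigma> xs ys b
    proof -
      have "d (map r xs ! i) (map r ys ! i) \<le> b" if i: "i < arity \<Sigma> \<sigma>" for i
      proof -
        have "xs ! i \<in> q ` ?T" "ys ! i \<in> q ` ?T"
          using i H(2-5) by (auto simp: Up subset_iff)
        then show ?thesis
          using H(6)[OF i] i H(2,4) by (simp add: U_def)
      qed
      then have "d (TF \<sigma> (map r xs)) (TF \<sigma> (map r ys)) \<le> b"
        using H(1-5) rs[of xs] rs[of ys] by (intro ops) (simp_all add: Up)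
      then show ?thesis using H(1-5) rs[of xs] rs[of ys] by (subst Ud) (simp_all add: Up)
    qed
  qed
  have "eval A (\<lambda>x. q (TV x)) t = q t" if "t \<in> ?T" for t
    using that
  proof (induction rule: tms.induct)
    case (TF \<sigma> ts)
    have "map (eval A (\<lambda>x. q (TV x))) ts = map q ts" using TF by simp
    moreover have "opn A \<sigma> (map q ts) = q (TF \<sigma> (map r (map q ts)))"
      unfolding A_def using TF by (intro opn_mk_alg) (auto simp: Up)
    moreover have "q (TF \<sigma> (map r (map q ts))) = q (TF \<sigma> ts)"
    proof (subst q)
      \<comment> \<open>Compatibility with the bound 0: replacing arguments by the chosen
        representatives moves each of them by distance zero.\<close>
      have "d (TF \<sigma> (map r (map q ts))) (TF \<sigma> ts) \<le> 0"
      proof (rule ops)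
        show "d (map r (map q ts) ! i) (ts ! i) \<le> 0" if "i < arity \<Sigma> \<sigma>" for i
          using that TF q[of "r (q (ts ! i))" "ts ! i"] r[of "q (ts ! i)"] by simp
      qed (use TF rs[of "map q ts"] in auto)
      then show "d (TF \<sigma> (map r (map q ts))) (TF \<sigma> ts) = 0" by simp
    qed (use TF rs[of "map q ts"] in auto)
    ultimately show ?case by (simp only: eval.simps)
  qed simp
  then show ?thesis
    using alg Up Ud j(2)
    by (intro exI[of _ A] exI[of _ q]) (auto simp: Ob_Sigma_UMet A_def q_def image_image)
qed

end


section \<open>Free algebras as quotients of terms\<close>

section \<open>The free algebra monad of a variety\<close>

lemma list_preimage: "set xs \<subseteq> f ` S \<Longrightarrow> \<exists>ts. set ts \<subseteq> S \<and> xs = map f ts"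
  by (induction xs) (auto, metis insert_subset list.simps(15) list.simps(9))

lemma tmap_id: "(\<And>x. x \<in> vars t \<Longrightarrow> f x = x) \<Longrightarrow> tmap f t = t"
  using tm.map_cong[of t t f id] by (simp add: tm.map_id)

lemma tmap_tmap: "tmap g (tmap f t) = tmap (\<lambda>x. g (f x)) t"
  by (simp add: tm.map_comp o_def)

lemma ultra_zero_eq: "\<lbrakk>ultrametric_space X; x \<in> pts X; y \<in> pts X; dst X x y \<le> 0\<rbrakk> \<Longrightarrow> x = y"
  using ultra_eq_0[of X x y] by simp

lemma enriched_monadI:
  assumes F: "enriched_functor UMet UMet (endo M)"
    and "eta M \<in> extensional (Ob UMet)" "mu M \<in> extensional (Ob UMet)"
    and eta_in: "\<And>X. X \<in> Ob UMet \<Longrightarrow> eta M X \<in> nonexpanding X (FO (endo M) X)"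
    and eta_nat: "\<And>X Y f x. \<lbrakk>X \<in> Ob UMet; Y \<in> Ob UMet; f \<in> nonexpanding X Y; x \<in> pts X\<rbrakk> \<Longrightarrow>
      FM (endo M) X Y f (eta M X x) = eta M Y (f x)"
    and mu_in: "\<And>X. X \<in> Ob UMet \<Longrightarrow> mu M X \<in> nonexpanding (FO (endo M) (FO (endo M) X)) (FO (endo M) X)"
    and mu_nat: "\<And>X Y f t. \<lbrakk>X \<in> Ob UMet; Y \<in> Ob UMet; f \<in> nonexpanding X Y; t \<in> pts (FO (endo M) (FO (endo M) X))\<rbrakk> \<Longrightarrow>
      FM (endo M) X Y f (mu M X t) = mu M Y (FM (endo M) (FO (endo M) X) (FO (endo M) Y) (FM (endo M) X Y f) t)"
    and laws: "\<And>X t. \<lbrakk>X \<in> Ob UMet; t \<in> pts (FO (endo M) X)\<rbrakk> \<Longrightarrow> mu M X (eta M (FO (endo M) X) t) = t"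
      "\<And>X t. \<lbrakk>X \<in> Ob UMet; t \<in> pts (FO (endo M) X)\<rbrakk> \<Longrightarrow> mu M X (FM (endo M) X (FO (endo M) X) (eta M X) t) = t"
      "\<And>X t. \<lbrakk>X \<in> Ob UMet; t \<in> pts (FO (endo M) (FO (endo M) (FO (endo M) X)))\<rbrakk> \<Longrightarrow>
        mu M X (mu M (FO (endo M) X) t) = mu M X (FM (endo M) (FO (endo M) (FO (endo M) X)) (FO (endo M) X) (mu M X) t)"
  shows "enriched_monad UMet M"
proof -
  interpret endofunctor "endo M" using F by unfold_locales
  have "natural_transformation UMet UMet (id_functor UMet) (endo M) (eta M)"
    using assms(2) eta_in eta_nat by (intro natural_transformation_UMetI) auto
  moreover have "natural_transformation UMet UMet (comp_functor UMet (endo M) (endo M)) (endo M) (mu M)"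
    using assms(3) mu_in mu_nat by (intro natural_transformation_UMetI) auto
  moreover have "compose (pts (FO (endo M) X)) (mu M X) (eta M (FO (endo M) X)) = (\<lambda>x\<in>pts (FO (endo M) X). x)"
    "compose (pts (FO (endo M) X)) (mu M X) (FM (endo M) X (FO (endo M) X) (eta M X)) = (\<lambda>x\<in>pts (FO (endo M) X). x)"
    "compose (pts (FO (endo M) (FO (endo M) (FO (endo M) X)))) (mu M X) (mu M (FO (endo M) X)) =
     compose (pts (FO (endo M) (FO (endo M) (FO (endo M) X)))) (mu M X)
      (FM (endo M) (FO (endo M) (FO (endo M) X)) (FO (endo M) X) (mu M X))" if "X \<in> Ob UMet" for X
    using laws[OF that] by (auto simp: compose_def intro!: restrict_ext)
  ultimately show ?thesis unfolding enriched_monad_def Let_def using F by simp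
qed

locale equational_theory = universe u for u :: "'u itself" +
  fixes \<Sigma> :: "'u sig" and E :: "'u quant_eq set"
  assumes signature: "signature \<Sigma>" and quant_eqs: "E \<subseteq> quant_eqs \<Sigma>"
begin

definition Alg :: "('u, 'u) alg set"
  where "Alg = {A \<in> Ob (Sigma_UMet \<Sigma>). \<forall>e\<in>E. satisfies A e}"

lemma Alg_ultra: "A \<in> Alg \<Longrightarrow> ultra_algebra \<Sigma> A"
  by (simp add: Alg_def Ob_Sigma_UMet)

lemma Alg_Ob: "A \<in> Alg \<Longrightarrow> underlying A \<in> Ob UMet"
  by (auto simp: Alg_def Ob_Sigma_UMet Ob_UMet ultra_algebra_def)

lemma Ob_variety: "Ob (variety_cat (\<Sigma>, Alg)) = Alg"
  by (auto simp: Ob_variety_cat Alg_def)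

lemma Alg_satisfies:
  assumes "A \<in> Alg" "(l, \<epsilon>, r) \<in> E" "\<And>n. f n \<in> pts (underlying A)"
  shows "dst (underlying A) (eval A f (conv l)) (eval A f (conv r)) \<le> ennreal (real_of_rat \<epsilon>)"
  using assms unfolding Alg_def satisfies_def term_ext_eval[symmetric] by fast

lemma E_tms:
  assumes "(l, \<epsilon>, r) \<in> E" "\<And>n. g n \<in> tms \<Sigma> X"
  shows "subst g (conv l) \<in> tms \<Sigma> X" "subst g (conv r) \<in> tms \<Sigma> X"
proof -
  have "l \<in> terms \<Sigma>" "r \<in> terms \<Sigma>" using subsetD[OF quant_eqs assms(1)] by (simp_all add: quant_eqs_def)
  then show "subst g (conv l) \<in> tms \<Sigma> X" "subst g (conv r) \<in> tms \<Sigma> X"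
    using subst_tms[OF conv_tms] assms(2) by blast+
qed

text \<open>A valuation of the variables in a quotient of terms lifts to a substitution. Hence the
  quotient satisfies the equations as soon as \<open>d\<close> bounds all their substitution
  instances, and it receives \<open>X\<close> as soon as \<open>d\<close> on variables lies below
  the metric of \<open>X\<close>.\<close>

lemma quotient_model:
  fixes X :: "'u emetric" and d :: "('u, 'u) tm \<Rightarrow> ('u, 'u) tm \<Rightarrow> ennreal"
  assumes X: "X \<in> Ob UMet"
    and refl: "\<And>s. s \<in> tms \<Sigma> (pts X) \<Longrightarrow> d s s = 0"
    and sym: "\<And>s t. s \<in> tms \<Sigma> (pts X) \<Longrightarrow> t \<in> tms \<Sigma> (pts X) \<Longrightarrow> d s t = d t s"
    and tri: "\<And>s t r. s \<in> tms \<Sigma> (pts X) \<Longrightarrow> t \<in> tms \<Sigma> (pts X) \<Longrightarrow> r \<in> tms \<Sigma> (pts X) \<Longrightarrow> d s r \<le> max (d s t) (d t r)"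
    and ops: "\<And>\<sigma> ss ts c. \<lbrakk>\<sigma> \<in> symbols \<Sigma>; length ss = arity \<Sigma> \<sigma>; set ss \<subseteq> tms \<Sigma> (pts X); length ts = arity \<Sigma> \<sigma>;
      set ts \<subseteq> tms \<Sigma> (pts X); \<And>i. i < arity \<Sigma> \<sigma> \<Longrightarrow> d (ss ! i) (ts ! i) \<le> c\<rbrakk> \<Longrightarrow> d (TF \<sigma> ss) (TF \<sigma> ts) \<le> c"
    and eqs: "\<And>l \<epsilon> r g. \<lbrakk>(l, \<epsilon>, r) \<in> E; \<And>n. g n \<in> tms \<Sigma> (pts X)\<rbrakk> \<Longrightarrow>
      d (subst g (conv l)) (subst g (conv r)) \<le> ennreal (real_of_rat \<epsilon>)"
    and vrs: "\<And>x y. x \<in> pts X \<Longrightarrow> y \<in> pts X \<Longrightarrow> d (TV x) (TV y) \<le> dst X x y"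
  shows "\<exists>A e. A \<in> Alg \<and> e \<in> nonexpanding X (underlying A) \<and> pts (underlying A) = eval A e ` tms \<Sigma> (pts X) \<and>
    (\<forall>s\<in>tms \<Sigma> (pts X). \<forall>t\<in>tms \<Sigma> (pts X). dst (underlying A) (eval A e s) (eval A e t) = d s t)"
proof -
  let ?T = "tms \<Sigma> (pts X)"
  have "small (pts X)" using X by (simp add: Ob_UMet)
  then have "\<exists>(A :: ('u, 'u) alg) q. A \<in> Ob (Sigma_UMet \<Sigma>) \<and> pts (underlying A) = q ` ?T \<and>
    (\<forall>s\<in>?T. \<forall>t\<in>?T. dst (underlying A) (q s) (q t) = d s t) \<and> (\<forall>t\<in>?T. eval A (\<lambda>x. q (TV x)) t = q t)"
    by (rule quotient_algebra[OF signature]) (fact refl, fact sym, fact tri, fact ops)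
  then obtain A :: "('u, 'u) alg" and q where A: "A \<in> Ob (Sigma_UMet \<Sigma>)" and qT: "pts (underlying A) = q ` ?T"
    and dq': "\<forall>s\<in>?T. \<forall>t\<in>?T. dst (underlying A) (q s) (q t) = d s t"
    and ev': "\<forall>t\<in>?T. eval A (\<lambda>x. q (TV x)) t = q t" by (elim exE conjE)
  note dq = dq'[rule_format] and ev = ev'[rule_format]
  have "satisfies A (l, \<epsilon>, r)" if e: "(l, \<epsilon>, r) \<in> E" for l \<epsilon> r
    unfolding satisfies_def term_ext_eval
  proof clarify
    fix f :: "nat \<Rightarrow> 'u" assume "range f \<subseteq> pts (underlying A)"
    then have "\<forall>n. \<exists>t\<in>?T. f n = q t" unfolding qT by blast
    then obtain g where g: "\<And>n. g n \<in> ?T" "\<And>n. f n = q (g n)" by metis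
    have "f = (\<lambda>n. q (g n))" using g by auto
    then have "eval A f t = eval A (\<lambda>x. q (TV x)) (subst g t)" for t
      using g ev by (simp add: eval_subst)
    then have "eval A f (conv l) = q (subst g (conv l))" "eval A f (conv r) = q (subst g (conv r))"
      using ev E_tms[OF e g(1)] by simp_all
    then show "dst (underlying A) (eval A f (conv l)) (eval A f (conv r)) \<le> ennreal (real_of_rat \<epsilon>)"
      using eqs[OF e g(1)] dq E_tms[OF e g(1)] by simp
  qed
  then have A': "A \<in> Alg" using A by (auto simp: Alg_def)
  let ?e = "\<lambda>x\<in>pts X. q (TV x)"
  have ev': "eval A ?e t = q t" if "t \<in> ?T" for t
    using ev[OF that] eval_cong[of t ?e "\<lambda>x. q (TV x)" A] vars_tms[OF that] by (auto simp: subset_iff)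
  have "?e \<in> nonexpanding X (underlying A)"
    using qT dq vrs by (intro nonexpandingI) auto
  moreover have "pts (underlying A) = eval A ?e ` ?T" unfolding qT using ev' by (intro image_cong) auto
  ultimately show ?thesis using A' ev' dq by (intro exI[of _ A] exI[of _ ?e]) simp
qed

text \<open>Freeness in metric form: the algebra is generated by \<open>X\<close>, and its distances
  on terms dominate those induced by every nonexpanding map from \<open>X\<close> to a model. The
  usual universal property follows by descending from terms.\<close>

definition is_free :: "'u emetric \<Rightarrow> ('u, 'u) alg \<times> ('u \<Rightarrow> 'u) \<Rightarrow> bool"
  where "is_free X = (\<lambda>(F, e). F \<in> Alg \<and> e \<in> nonexpanding X (underlying F) \<and>
    pts (underlying F) = eval F e ` tms \<Sigma> (pts X) \<and>
    (\<forall>A\<in>Alg. \<forall>f\<in>nonexpanding X (underlying A). \<forall>s\<in>tms \<Sigma> (pts X). \<forall>t\<in>tms \<Sigma> (pts X).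
      dst (underlying A) (eval A f s) (eval A f t) \<le> dst (underlying F) (eval F e s) (eval F e t)))"

text \<open>All requirements of \<open>quotient_model\<close> hold in each interpretation and pass
  to suprema. The supremum ranges over all interpretations and is taken in \<open>ennreal\<close>,
  so smallness matters only for the set of terms.\<close>

lemma free_exists:
  fixes X :: "'u emetric"
  assumes X: "X \<in> Ob UMet"
  shows "\<exists>p. is_free X p"
proof -
  let ?T = "tms \<Sigma> (pts X)"
  define I where "I = {(A, f). A \<in> Alg \<and> f \<in> nonexpanding X (underlying A)}"
  define d where "d s t = (SUP (A, f)\<in>I. dst (underlying A) (eval A f s) (eval A f t))" for s t
  have d_le: "d s t \<le> c"
    if "\<And>A f. A \<in> Alg \<Longrightarrow> f \<in> nonexpanding X (underlying A) \<Longrightarrow> dst (underlying A) (eval A f s) (eval A f t) \<le> c" for s t c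
    unfolding d_def by (intro SUP_least) (auto simp: I_def that)
  have le_d: "dst (underlying A) (eval A f s) (eval A f t) \<le> d s t"
    if "A \<in> Alg" "f \<in> nonexpanding X (underlying A)" for A f s t
    unfolding d_def using that by (intro SUP_upper2[of "(A, f)"]) (auto simp: I_def)
  have U: "ultrametric_space (underlying A)" if "A \<in> Alg" for A using Ob_UMetD[OF Alg_Ob[OF that]] .
  have evp: "eval A f s \<in> pts (underlying A)" if "A \<in> Alg" "f \<in> nonexpanding X (underlying A)" "s \<in> ?T" for A f s
    by (rule eval_pts[OF Alg_ultra[OF that(1)] that(3)]) (rule nonexpanding_pts[OF that(2)])
  have "\<exists>A e. A \<in> Alg \<and> e \<in> nonexpanding X (underlying A) \<and> pts (underlying A) = eval A e ` ?T \<and>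
    (\<forall>s\<in>?T. \<forall>t\<in>?T. dst (underlying A) (eval A e s) (eval A e t) = d s t)"
  proof (rule quotient_model[OF X])
    show "d s s = 0" if "s \<in> ?T" for s
      using d_le[of s s 0] ultra_refl[OF U evp] that by simp
    have "d s t \<le> d t s" if "s \<in> ?T" "t \<in> ?T" for s t
      using ultra_sym[OF U evp evp] that le_d by (intro d_le) metis
    then show "d s t = d t s" if "s \<in> ?T" "t \<in> ?T" for s t using that by (simp add: antisym)
    show "d s r \<le> max (d s t) (d t r)" if "s \<in> ?T" "t \<in> ?T" "r \<in> ?T" for s t r
    proof (rule d_le)
      fix A f assume A: "A \<in> Alg" and f: "f \<in> nonexpanding X (underlying A)"
      show "dst (underlying A) (eval A f s) (eval A f r) \<le> max (d s t) (d t r)"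
        using ultra_tri[OF U[OF A] evp[OF A f that(1)] evp[OF A f that(2)] evp[OF A f that(3)]]
          le_d[OF A f, of s t] le_d[OF A f, of t r] by (meson max.mono order_trans)
    qed
    show "d (TF \<sigma> ss) (TF \<sigma> ts) \<le> c"
      if "\<sigma> \<in> symbols \<Sigma>" "length ss = arity \<Sigma> \<sigma>" "set ss \<subseteq> ?T" "length ts = arity \<Sigma> \<sigma>" "set ts \<subseteq> ?T"
        "\<And>i. i < arity \<Sigma> \<sigma> \<Longrightarrow> d (ss ! i) (ts ! i) \<le> c" for \<sigma> ss ts c
    proof (rule d_le)
      fix A f assume A: "A \<in> Alg" and f: "f \<in> nonexpanding X (underlying A)"
      show "dst (underlying A) (eval A f (TF \<sigma> ss)) (eval A f (TF \<sigma> ts)) \<le> c"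
        unfolding eval.simps using that order_trans[OF le_d[OF A f] that(6)]
        by (intro opn_le[OF Alg_ultra[OF A]]) (auto intro!: evp[OF A f])
    qed
    show "d (subst g (conv l)) (subst g (conv r)) \<le> ennreal (real_of_rat \<epsilon>)"
      if e: "(l, \<epsilon>, r) \<in> E" and g: "\<And>n. g n \<in> ?T" for l \<epsilon> r g
      unfolding d_def using evp[OF _ _ g]
      by (intro SUP_least) (auto simp: I_def eval_subst intro!: Alg_satisfies[OF _ e])
    show "d (TV x) (TV y) \<le> dst X x y" if "x \<in> pts X" "y \<in> pts X" for x y
      using nonexpanding_le[OF _ that] by (intro d_le) simp
  qed
  then obtain A e where "A \<in> Alg" "e \<in> nonexpanding X (underlying A)" "pts (underlying A) = eval A e ` ?T"
    "\<forall>s\<in>?T. \<forall>t\<in>?T. dst (underlying A) (eval A e s) (eval A e t) = d s t" by blast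
  then have "is_free X (A, e)" unfolding is_free_def using le_d by simp
  then show ?thesis by blast
qed

definition free :: "'u emetric \<Rightarrow> ('u, 'u) alg \<times> ('u \<Rightarrow> 'u)"
  where "free X = (SOME p. is_free X p)"

definition "FA X = fst (free X)"
definition "fe X = snd (free X)"
abbreviation "TO X \<equiv> underlying (FA X)"
definition "ev X = eval (FA X) (fe X)"

lemma free:
  assumes X: "X \<in> Ob UMet"
  shows FA_Alg: "FA X \<in> Alg" and fe_in: "fe X \<in> nonexpanding X (TO X)"
    and pts_TO: "pts (TO X) = ev X ` tms \<Sigma> (pts X)"
    and ev_le: "\<lbrakk>A \<in> Alg; f \<in> nonexpanding X (underlying A); s \<in> tms \<Sigma> (pts X); t \<in> tms \<Sigma> (pts X)\<rbrakk> \<Longrightarrow>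
      dst (underlying A) (eval A f s) (eval A f t) \<le> dst (TO X) (ev X s) (ev X t)"
proof -
  have "is_free X (free X)" unfolding free_def using free_exists[OF X] by (rule someI_ex)
  then have "is_free X (FA X, fe X)" by (simp add: FA_def fe_def)
  note f = this[unfolded is_free_def case_prod_conv, folded ev_def]
  show "FA X \<in> Alg" "fe X \<in> nonexpanding X (TO X)" "pts (TO X) = ev X ` tms \<Sigma> (pts X)" using f by blast+
  show "\<lbrakk>A \<in> Alg; f \<in> nonexpanding X (underlying A); s \<in> tms \<Sigma> (pts X); t \<in> tms \<Sigma> (pts X)\<rbrakk> \<Longrightarrow>
      dst (underlying A) (eval A f s) (eval A f t) \<le> dst (TO X) (ev X s) (ev X t)" using f by simp
qed

lemma FA_ultra: "X \<in> Ob UMet \<Longrightarrow> ultra_algebra \<Sigma> (FA X)"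
  using FA_Alg Alg_ultra by blast

lemma TO_Ob: "X \<in> Ob UMet \<Longrightarrow> TO X \<in> Ob UMet"
  using FA_Alg Alg_Ob by blast

lemma ev_pts: "X \<in> Ob UMet \<Longrightarrow> t \<in> tms \<Sigma> (pts X) \<Longrightarrow> ev X t \<in> pts (TO X)"
  by (simp add: pts_TO)

lemma ev_TV: "ev X (TV x) = fe X x"
  by (simp add: ev_def)

lemma ev_TF: "ev X (TF \<sigma> ts) = opn (FA X) \<sigma> (map (ev X) ts)"
  by (simp add: ev_def)

lemma TO_cases:
  assumes "X \<in> Ob UMet" "z \<in> pts (TO X)" obtains t where "t \<in> tms \<Sigma> (pts X)" "z = ev X t"
  using assms pts_TO by blast

definition rep :: "'u emetric \<Rightarrow> 'u \<Rightarrow> ('u, 'u) tm"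
  where "rep X z = (SOME t. t \<in> tms \<Sigma> (pts X) \<and> ev X t = z)"

lemma rep: "X \<in> Ob UMet \<Longrightarrow> z \<in> pts (TO X) \<Longrightarrow> rep X z \<in> tms \<Sigma> (pts X) \<and> ev X (rep X z) = z"
  unfolding rep_def by (rule someI_ex) (auto simp: pts_TO)

text \<open>Terms identified in the free algebra have distance 0 there, so the bound forces
  \<open>g\<close> to identify them as well, and the choice of representatives is
  immaterial.\<close>

lemma descend:
  assumes X: "X \<in> Ob UMet" and B: "ultrametric_space B" and g: "\<And>t. t \<in> tms \<Sigma> (pts X) \<Longrightarrow> g t \<in> pts B"
    and le: "\<And>s t. s \<in> tms \<Sigma> (pts X) \<Longrightarrow> t \<in> tms \<Sigma> (pts X) \<Longrightarrow> dst B (g s) (g t) \<le> dst (TO X) (ev X s) (ev X t)"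
  shows "(\<lambda>z\<in>pts (TO X). g (rep X z)) \<in> nonexpanding (TO X) B"
    and "t \<in> tms \<Sigma> (pts X) \<Longrightarrow> (\<lambda>z\<in>pts (TO X). g (rep X z)) (ev X t) = g t"
proof -
  show "(\<lambda>z\<in>pts (TO X). g (rep X z)) \<in> nonexpanding (TO X) B"
    using rep[OF X] g le by (intro nonexpandingI) (auto, metis)
  assume t: "t \<in> tms \<Sigma> (pts X)"
  have r: "rep X (ev X t) \<in> tms \<Sigma> (pts X)" "ev X (rep X (ev X t)) = ev X t"
    using rep[OF X ev_pts[OF X t]] by auto
  have "dst B (g (rep X (ev X t))) (g t) \<le> 0"
    using le[OF r(1) t] r ultra_refl[OF Ob_UMetD[OF TO_Ob[OF X]] ev_pts[OF X t]] by simp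
  then have "g (rep X (ev X t)) = g t" using B g r t by (intro ultra_zero_eq)
  then show "(\<lambda>z\<in>pts (TO X). g (rep X z)) (ev X t) = g t" using ev_pts[OF X t] by simp
qed

section \<open>Universal property and functoriality of the free algebra\<close>

definition ext :: "'u emetric \<Rightarrow> ('u, 'u) alg \<Rightarrow> ('u \<Rightarrow> 'u) \<Rightarrow> 'u \<Rightarrow> 'u"
  where "ext X A f = (\<lambda>z\<in>pts (TO X). eval A f (rep X z))"

lemma eval_Alg_pts:
  "\<lbrakk>A \<in> Alg; f \<in> nonexpanding X (underlying A); t \<in> tms \<Sigma> (pts X)\<rbrakk> \<Longrightarrow> eval A f t \<in> pts (underlying A)"
  by (rule eval_pts[OF Alg_ultra], assumption+) (rule nonexpanding_pts)

lemma ext: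
  assumes X: "X \<in> Ob UMet" and A: "A \<in> Alg" and f: "f \<in> nonexpanding X (underlying A)"
  shows ext_in: "ext X A f \<in> nonexpanding (TO X) (underlying A)"
    and ext_ev: "t \<in> tms \<Sigma> (pts X) \<Longrightarrow> ext X A f (ev X t) = eval A f t"
    and ext_hom: "ext X A f \<in> homomorphisms \<Sigma> (FA X) A"
proof -
  note d = descend[where g = "eval A f", OF X Ob_UMetD[OF Alg_Ob[OF A]] eval_Alg_pts[OF A f] ev_le[OF X A f]]
  show i: "ext X A f \<in> nonexpanding (TO X) (underlying A)" unfolding ext_def using d(1) by blast
  show e: "ext X A f (ev X t) = eval A f t" if "t \<in> tms \<Sigma> (pts X)" for t unfolding ext_def using d(2) that by blast
  show "ext X A f \<in> homomorphisms \<Sigma> (FA X) A"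
  proof (rule homomorphismI[OF i])
    fix \<sigma> xs assume \<sigma>: "\<sigma> \<in> symbols \<Sigma>" "length xs = arity \<Sigma> \<sigma>" and "set xs \<subseteq> pts (TO X)"
    then obtain ts where ts: "set ts \<subseteq> tms \<Sigma> (pts X)" "xs = map (ev X) ts"
      using list_preimage[of xs "ev X"] pts_TO[OF X] by auto
    have "map (ext X A f) xs = map (eval A f) ts" using ts e by auto
    moreover have "ext X A f (ev X (TF \<sigma> ts)) = eval A f (TF \<sigma> ts)" using ts \<sigma> by (intro e) simp
    ultimately show "ext X A f (opn (FA X) \<sigma> xs) = opn A \<sigma> (map (ext X A f) xs)"
      using ts by (simp only: ev_TF eval.simps)
  qed
qed

definition TMap :: "'u emetric \<Rightarrow> 'u emetric \<Rightarrow> ('u \<Rightarrow> 'u) \<Rightarrow> 'u \<Rightarrow> 'u"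
  where "TMap X Y f = ext X (FA Y) (compose (pts X) (fe Y) f)"

lemma TMap:
  assumes X: "X \<in> Ob UMet" and Y: "Y \<in> Ob UMet" and f: "f \<in> nonexpanding X Y"
  shows TMap_in: "TMap X Y f \<in> nonexpanding (TO X) (TO Y)"
    and TMap_ev: "t \<in> tms \<Sigma> (pts X) \<Longrightarrow> TMap X Y f (ev X t) = ev Y (tmap f t)"
    and TMap_hom: "TMap X Y f \<in> homomorphisms \<Sigma> (FA X) (FA Y)"
proof -
  note c = nonexpanding_compose[OF f fe_in[OF Y]]
  show "TMap X Y f \<in> nonexpanding (TO X) (TO Y)" "TMap X Y f \<in> homomorphisms \<Sigma> (FA X) (FA Y)"
    unfolding TMap_def using ext_in[OF X FA_Alg[OF Y] c] ext_hom[OF X FA_Alg[OF Y] c] .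
  assume t: "t \<in> tms \<Sigma> (pts X)"
  have "eval (FA Y) (compose (pts X) (fe Y) f) t = eval (FA Y) (\<lambda>x. fe Y (f x)) t"
    using vars_tms[OF t] by (intro eval_cong) (auto simp: compose_eq)
  then show "TMap X Y f (ev X t) = ev Y (tmap f t)"
    unfolding TMap_def ext_ev[OF X FA_Alg[OF Y] c t] by (simp add: ev_def eval_tmap)
qed

text \<open>The counit of the adjunction between free algebras and underlying spaces: on classes of
  terms it is evaluation in \<open>A\<close>.\<close>

definition str :: "('u, 'u) alg \<Rightarrow> 'u \<Rightarrow> 'u"
  where "str A = ext (underlying A) A (\<lambda>x\<in>pts (underlying A). x)"

lemma str:
  assumes A: "A \<in> Alg"
  shows str_in: "str A \<in> nonexpanding (TO (underlying A)) (underlying A)"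
    and str_ev: "t \<in> tms \<Sigma> (pts (underlying A)) \<Longrightarrow> str A (ev (underlying A) t) = eval A (\<lambda>x. x) t"
    and str_hom: "str A \<in> homomorphisms \<Sigma> (FA (underlying A)) A"
proof -
  show "str A \<in> nonexpanding (TO (underlying A)) (underlying A)" "str A \<in> homomorphisms \<Sigma> (FA (underlying A)) A"
    unfolding str_def using ext_in[OF Alg_Ob[OF A] A nonexpanding_id] ext_hom[OF Alg_Ob[OF A] A nonexpanding_id] .
  assume t: "t \<in> tms \<Sigma> (pts (underlying A))"
  show "str A (ev (underlying A) t) = eval A (\<lambda>x. x) t"
    unfolding str_def ext_ev[OF Alg_Ob[OF A] A nonexpanding_id t] using vars_tms[OF t]
    by (intro eval_cong) auto
qed

section \<open>The monad of free algebras\<close>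

definition monad :: "('u emetric, 'u \<Rightarrow> 'u) mnd"
  where "monad = \<lparr>endo = \<lparr>FO = (\<lambda>X\<in>Ob UMet. TO X),
      FM = (\<lambda>X\<in>Ob UMet. \<lambda>Y\<in>Ob UMet. \<lambda>f\<in>nonexpanding X Y. TMap X Y f)\<rparr>,
    eta = (\<lambda>X\<in>Ob UMet. fe X), mu = (\<lambda>X\<in>Ob UMet. str (FA X))\<rparr>"

lemma monad_simps [simp]:
  "X \<in> Ob UMet \<Longrightarrow> FO (endo monad) X = TO X"
  "\<lbrakk>X \<in> Ob UMet; Y \<in> Ob UMet; f \<in> nonexpanding X Y\<rbrakk> \<Longrightarrow> FM (endo monad) X Y f = TMap X Y f"
  "X \<in> Ob UMet \<Longrightarrow> eta monad X = fe X"
  "X \<in> Ob UMet \<Longrightarrow> mu monad X = str (FA X)"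
  by (simp_all add: monad_def)

lemma TMap_id: "X \<in> Ob UMet \<Longrightarrow> TMap X X (\<lambda>x\<in>pts X. x) = (\<lambda>z\<in>pts (TO X). z)"
proof (rule nonexpanding_eqI[OF TMap_in nonexpanding_id])
  fix z assume X: "X \<in> Ob UMet" and z: "z \<in> pts (TO X)"
  obtain t where t: "t \<in> tms \<Sigma> (pts X)" "z = ev X t" by (rule TO_cases[OF X z])
  have "tmap (\<lambda>x\<in>pts X. x) t = t" using vars_tms[OF t(1)] by (intro tmap_id) auto
  then show "TMap X X (\<lambda>x\<in>pts X. x) z = (\<lambda>z\<in>pts (TO X). z) z"
    using z TMap_ev[OF X X nonexpanding_id t(1)] t(2) by simp
qed (auto intro: nonexpanding_id)

lemma TMap_comp:
  assumes X: "X \<in> Ob UMet" and Y: "Y \<in> Ob UMet" and Z: "Z \<in> Ob UMet"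
    and f: "f \<in> nonexpanding X Y" and g: "g \<in> nonexpanding Y Z"
  shows "TMap X Z (compose (pts X) g f) = compose (pts (TO X)) (TMap Y Z g) (TMap X Y f)"
proof (rule nonexpanding_eqI[OF TMap_in[OF X Z nonexpanding_compose[OF f g]]
      nonexpanding_compose[OF TMap_in[OF X Y f] TMap_in[OF Y Z g]]])
  fix z assume z: "z \<in> pts (TO X)"
  obtain t where t: "t \<in> tms \<Sigma> (pts X)" "z = ev X t" by (rule TO_cases[OF X z])
  have "tmap (compose (pts X) g f) t = tmap (\<lambda>x. g (f x)) t"
    using vars_tms[OF t(1)] by (intro tm.map_cong refl) (auto simp: compose_eq)
  moreover have "tmap f t \<in> tms \<Sigma> (pts Y)" by (rule tmap_tms[OF t(1)]) (rule nonexpanding_pts[OF f])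
  ultimately show "TMap X Z (compose (pts X) g f) z = compose (pts (TO X)) (TMap Y Z g) (TMap X Y f) z"
    using z t TMap_ev[OF X Z nonexpanding_compose[OF f g]] TMap_ev[OF X Y f] TMap_ev[OF Y Z g]
    by (simp add: compose_eq tmap_tmap)
qed

text \<open>On the class of a term both sides evaluate this term at two valuations that are
  uniformly as close as \<open>f\<close> and \<open>g\<close>; evaluation does not increase this
  distance.\<close>

lemma TMap_le:
  assumes X: "X \<in> Ob UMet" and Y: "Y \<in> Ob UMet" and f: "f \<in> nonexpanding X Y" and g: "g \<in> nonexpanding X Y"
  shows "sup_dist (TO X) (TO Y) (TMap X Y f) (TMap X Y g) \<le> sup_dist X Y f g"
proof (rule sup_dist_le)
  fix z assume z: "z \<in> pts (TO X)"
  obtain t where t: "t \<in> tms \<Sigma> (pts X)" "z = ev X t" by (rule TO_cases[OF X z])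
  have "dst (TO Y) (eval (FA Y) (\<lambda>x. fe Y (f x)) t) (eval (FA Y) (\<lambda>x. fe Y (g x)) t) \<le> sup_dist X Y f g"
  proof (rule eval_le[OF FA_ultra[OF Y] t(1)])
    fix x assume x: "x \<in> pts X"
    have fg: "f x \<in> pts Y" "g x \<in> pts Y" using nonexpanding_pts[OF f x] nonexpanding_pts[OF g x] by auto
    show "fe Y (f x) \<in> pts (TO Y)" "fe Y (g x) \<in> pts (TO Y)"
      using nonexpanding_pts[OF fe_in[OF Y]] fg by auto
    show "dst (TO Y) (fe Y (f x)) (fe Y (g x)) \<le> sup_dist X Y f g"
      using nonexpanding_le[OF fe_in[OF Y] fg] le_sup_dist[OF x, of Y f g] by (rule order_trans)
  qed
  then show "dst (TO Y) (TMap X Y f z) (TMap X Y g z) \<le> sup_dist X Y f g"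
    using TMap_ev[OF X Y f t(1)] TMap_ev[OF X Y g t(1)] t(2) by (simp add: ev_def eval_tmap)
qed

lemma enriched_endo: "enriched_functor UMet UMet (endo monad)"
  unfolding enriched_functor_UMet
proof (intro conjI ballI)
  show "is_functor UMet UMet (endo monad)"
    unfolding is_functor_def
    by (auto simp: TO_Ob TMap_in nonexpanding_id nonexpanding_compose TMap_id TMap_comp)
      (auto simp: monad_def TMap_in)
qed (simp add: TMap_le)

lemma str_fe: "A \<in> Alg \<Longrightarrow> x \<in> pts (underlying A) \<Longrightarrow> str A (fe (underlying A) x) = x"
  using str_ev[of A "TV x"] by (simp add: ev_TV)

text \<open>Naturality of the counit. With \<open>h\<close> a structure map it is the associativity
  law, and with \<open>h\<close> a map between free algebras it is naturality of the
  multiplication.\<close>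

lemma str_TMap:
  assumes A: "A \<in> Alg" and B: "B \<in> Alg" and h: "h \<in> homomorphisms \<Sigma> A B" and z: "z \<in> pts (TO (underlying A))"
  shows "h (str A z) = str B (TMap (underlying A) (underlying B) h z)"
proof -
  note h' = homomorphism_nonexpanding[OF h]
  obtain t where t: "t \<in> tms \<Sigma> (pts (underlying A))" "z = ev (underlying A) t"
    by (rule TO_cases[OF Alg_Ob[OF A] z])
  have m: "tmap h t \<in> tms \<Sigma> (pts (underlying B))" by (rule tmap_tms[OF t(1)]) (rule nonexpanding_pts[OF h'])
  have "h (eval A (\<lambda>x. x) t) = eval B h t"
    using eval_hom[OF Alg_ultra[OF A] h t(1), of "\<lambda>x. x"] by simp
  then show ?thesis
    using str_ev[OF A t(1)] str_ev[OF B m] TMap_ev[OF Alg_Ob[OF A] Alg_Ob[OF B] h' t(1)] t(2)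
    by (simp add: eval_tmap)
qed

lemma monad_enriched: "enriched_monad UMet monad"
proof (rule enriched_monadI[OF enriched_endo])
  show "eta monad \<in> extensional (Ob UMet)" "mu monad \<in> extensional (Ob UMet)" by (simp_all add: monad_def)
  fix X :: "'u emetric" assume X: "X \<in> Ob UMet"
  note [simp] = X TO_Ob[OF X] TO_Ob[OF TO_Ob[OF X]]
  note A = FA_Alg[OF X] and s = str_in[OF FA_Alg[OF X]]
  show "eta monad X \<in> nonexpanding X (FO (endo monad) X)" by (simp add: fe_in)
  show "mu monad X \<in> nonexpanding (FO (endo monad) (FO (endo monad) X)) (FO (endo monad) X)"
    by (simp add: s)
  show "mu monad X (eta monad (FO (endo monad) X) t) = t" if "t \<in> pts (FO (endo monad) X)" for t
    using that str_fe[OF A] by simp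
  show "mu monad X (FM (endo monad) X (FO (endo monad) X) (eta monad X) t) = t" if t': "t \<in> pts (FO (endo monad) X)" for t
  proof -
    from t' have "t \<in> pts (TO X)" by simp
    then obtain r where r: "r \<in> tms \<Sigma> (pts X)" "t = ev X r" by (rule TO_cases[OF X])
    have "tmap (fe X) r \<in> tms \<Sigma> (pts (TO X))" by (rule tmap_tms[OF r(1)]) (rule nonexpanding_pts[OF fe_in[OF X]])
    then show ?thesis using r str_ev[OF A] TMap_ev[OF X TO_Ob[OF X] fe_in[OF X] r(1)]
      by (simp add: fe_in eval_tmap) (simp add: ev_def)
  qed
  show "mu monad X (mu monad (FO (endo monad) X) t) =
      mu monad X (FM (endo monad) (FO (endo monad) (FO (endo monad) X)) (FO (endo monad) X) (mu monad X) t)"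
    if "t \<in> pts (FO (endo monad) (FO (endo monad) (FO (endo monad) X)))" for t
    using that str_TMap[OF FA_Alg[OF TO_Ob[OF X]] A str_hom[OF A]] s by simp
  fix Y :: "'u emetric" and f assume Y: "Y \<in> Ob UMet" and f: "f \<in> nonexpanding X Y"
  note [simp] = Y TO_Ob[OF Y]
  show "FM (endo monad) X Y f (eta monad X x) = eta monad Y (f x)" if "x \<in> pts X" for x
    using TMap_ev[OF X Y f, of "TV x"] that f by (simp add: ev_TV)
  show "FM (endo monad) X Y f (mu monad X t) =
      mu monad Y (FM (endo monad) (FO (endo monad) X) (FO (endo monad) Y) (FM (endo monad) X Y f) t)"
    if "t \<in> pts (FO (endo monad) (FO (endo monad) X))" for t
    using that str_TMap[OF A FA_Alg[OF Y] TMap_hom[OF X Y f]] f TMap_in[OF X Y f] by simp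
qed

section \<open>Eilenberg-Moore algebras of the free algebra monad\<close>

lemma EM_monad: "(X, a) \<in> EM monad \<longleftrightarrow> X \<in> Ob UMet \<and> a \<in> nonexpanding (TO X) X \<and>
    (\<forall>x\<in>pts X. a (fe X x) = x) \<and> (\<forall>t\<in>pts (TO (TO X)). a (str (FA X) t) = a (TMap (TO X) X a t))"
  by (auto simp: EM_def TO_Ob)

lemma str_EM:
  assumes A: "A \<in> Alg" shows "(underlying A, str A) \<in> EM monad"
  unfolding EM_monad
  using Alg_Ob[OF A] str_in[OF A] str_fe[OF A] str_TMap[OF FA_Alg[OF Alg_Ob[OF A]] A str_hom[OF A]] by simp

text \<open>An operation is the structure map at a flat term. Therefore \<open>str A\<close>
  determines \<open>A\<close>, and compatibility with structure maps gives back compatibility with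
  operations.\<close>

lemma opn_str:
  assumes A: "A \<in> Alg" and "\<sigma> \<in> symbols \<Sigma>" "length xs = arity \<Sigma> \<sigma>" "set xs \<subseteq> pts (underlying A)"
  shows "opn A \<sigma> xs = str A (ev (underlying A) (TF \<sigma> (map TV xs)))"
  using assms by (subst str_ev[OF A]) (auto simp: o_def)

text \<open>The algebra is read off from \<open>a\<close> at flat terms; the associativity law
  propagates the agreement to all terms. The type of variables is left open: \<open>nat\<close> is
  used for the equations and the points of \<open>X\<close> for recovering \<open>a\<close>.\<close>

lemma EM_eval:
  assumes EM: "(X, a) \<in> EM monad"
    and A: "A = mk_alg \<Sigma> X (\<lambda>\<sigma> xs. a (ev X (TF \<sigma> (map TV xs))))"
    and t: "t \<in> tms \<Sigma> Y" and f: "\<And>y. y \<in> Y \<Longrightarrow> f y \<in> pts X"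
  shows "eval A f t = a (ev X (tmap f t))"
proof -
  have X: "X \<in> Ob UMet" and a: "a \<in> nonexpanding (TO X) X" and a_fe: "\<And>x. x \<in> pts X \<Longrightarrow> a (fe X x) = x"
    and a_str: "\<And>t. t \<in> pts (TO (TO X)) \<Longrightarrow> a (str (FA X) t) = a (TMap (TO X) X a t)"
    using EM unfolding EM_monad by auto
  note [simp] = X TO_Ob[OF X]
  show ?thesis
    using t
  proof (induction rule: tms.induct)
    case (TV y)
    then show ?case using f a_fe by (simp add: ev_TV)
  next
    case (TF \<sigma> ts)
    define zs where "zs = map (\<lambda>t. ev X (tmap f t)) ts"
    have ts: "tmap f t \<in> tms \<Sigma> (pts X)" if "t \<in> set ts" for t
      using TF that by (intro tmap_tms[OF _ f]) auto
    then have zs: "set zs \<subseteq> pts (TO X)" by (auto simp: zs_def ev_pts)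
    \<comment> \<open>A flat term over the free algebra, whose variables are the values of the
      arguments: applying \<open>a\<close> inside it or flattening it by \<open>str (FA X)\<close>
      yields the two sides of the associativity law.\<close>
    let ?u = "TF \<sigma> (map TV zs)"
    have u: "?u \<in> tms \<Sigma> (pts (TO X))" using zs TF by (auto simp: zs_def)
    have "eval A f (TF \<sigma> ts) = opn A \<sigma> (map a zs)"
      using TF by (auto simp: zs_def o_def intro!: arg_cong[where f = "opn A \<sigma>"])
    also have "\<dots> = a (ev X (TF \<sigma> (map TV (map a zs))))"
      unfolding A using TF zs nonexpanding_pts[OF a] by (intro opn_mk_alg) (auto simp: zs_def)
    also have "\<dots> = a (TMap (TO X) X a (ev (TO X) ?u))"
      using TMap_ev[OF TO_Ob[OF X] X a u] by (simp add: o_def)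
    also have "\<dots> = a (str (FA X) (ev (TO X) ?u))"
      using a_str ev_pts[OF TO_Ob[OF X] u] by simp
    also have "str (FA X) (ev (TO X) ?u) = opn (FA X) \<sigma> zs"
      using str_ev[OF FA_Alg[OF X] u] by (simp add: o_def)
    also have "opn (FA X) \<sigma> zs = ev X (tmap f (TF \<sigma> ts))"
      by (simp add: zs_def ev_TF o_def)
    finally show ?case .
  qed
qed

text \<open>Equations hold because the two sides are images under the nonexpanding \<open>a\<close>
  of points of the free algebra, where the equation holds already.\<close>

lemma EM_surj:
  assumes EM: "(X, a) \<in> EM monad"
  shows "\<exists>A\<in>Alg. underlying A = X \<and> str A = a"
proof -
  have X: "X \<in> Ob UMet" and a: "a \<in> nonexpanding (TO X) X"
    using EM unfolding EM_monad by auto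
  define A where "A = mk_alg \<Sigma> X (\<lambda>\<sigma> xs. a (ev X (TF \<sigma> (map TV xs))))"
  have U: "underlying A = X" by (simp add: A_def)
  note ev = EM_eval[OF EM A_def]
  have vt: "TF \<sigma> (map TV xs) \<in> tms \<Sigma> (pts X)"
    if "\<sigma> \<in> symbols \<Sigma>" "length xs = arity \<Sigma> \<sigma>" "set xs \<subseteq> pts X" for \<sigma> and xs :: "'u list"
    using that by auto
  have "ultra_algebra \<Sigma> A"
    unfolding A_def
  proof (rule ultra_algebra_mk_alg[OF Ob_UMetD[OF X]])
    show "a (ev X (TF \<sigma> (map TV xs))) \<in> pts X"
      if "\<sigma> \<in> symbols \<Sigma>" "length xs = arity \<Sigma> \<sigma>" "set xs \<subseteq> pts X" for \<sigma> xs
      by (rule nonexpanding_pts[OF a ev_pts[OF X vt[OF that]]])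
    fix \<sigma> xs ys c assume \<sigma>: "\<sigma> \<in> symbols \<Sigma>" and xs: "length xs = arity \<Sigma> \<sigma>" "set xs \<subseteq> pts X"
      and ys: "length ys = arity \<Sigma> \<sigma>" "set ys \<subseteq> pts X" and c: "\<And>i. i < arity \<Sigma> \<sigma> \<Longrightarrow> dst X (xs ! i) (ys ! i) \<le> c"
    have "dst X (a (ev X (TF \<sigma> (map TV xs)))) (a (ev X (TF \<sigma> (map TV ys))))
        \<le> dst (TO X) (ev X (TF \<sigma> (map TV xs))) (ev X (TF \<sigma> (map TV ys)))"
      by (rule nonexpanding_le[OF a ev_pts[OF X vt[OF \<sigma> xs]] ev_pts[OF X vt[OF \<sigma> ys]]])
    also have "\<dots> \<le> c"
      unfolding ev_TF
    proof (rule opn_le[OF FA_ultra[OF X] \<sigma>])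
      show "set (map (ev X) (map TV xs)) \<subseteq> pts (TO X)" "set (map (ev X) (map TV ys)) \<subseteq> pts (TO X)"
        using xs ys nonexpanding_pts[OF fe_in[OF X]] by (auto simp: ev_TV)
      show "dst (TO X) (map (ev X) (map TV xs) ! i) (map (ev X) (map TV ys) ! i) \<le> c" if "i < arity \<Sigma> \<sigma>" for i
        using that xs ys order_trans[OF nonexpanding_le[OF fe_in[OF X]] c[OF that]] nth_mem[of i xs] nth_mem[of i ys]
        by (simp add: ev_TV subset_iff)
    qed (use xs ys in auto)
    finally show "dst X (a (ev X (TF \<sigma> (map TV xs)))) (a (ev X (TF \<sigma> (map TV ys)))) \<le> c" .
  qed
  moreover have "satisfies A (l, \<epsilon>, r)" if e: "(l, \<epsilon>, r) \<in> E" for l \<epsilon> r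
    unfolding satisfies_def term_ext_eval
  proof clarify
    fix f :: "nat \<Rightarrow> 'u" assume "range f \<subseteq> pts (underlying A)"
    then have f: "f n \<in> pts X" for n by (auto simp: U)
    have lr: "conv l \<in> tms \<Sigma> UNIV" "conv r \<in> tms \<Sigma> UNIV"
      using e quant_eqs conv_tms by (auto simp: quant_eqs_def)
    have "dst X (a (ev X (tmap f (conv l)))) (a (ev X (tmap f (conv r))))
        \<le> dst (TO X) (ev X (tmap f (conv l))) (ev X (tmap f (conv r)))"
      by (intro nonexpanding_le[OF a] ev_pts X tmap_tms[OF lr(1)] tmap_tms[OF lr(2)] f)
    also have "\<dots> \<le> ennreal (real_of_rat \<epsilon>)"
      unfolding ev_def eval_tmap
      by (rule Alg_satisfies[OF FA_Alg[OF X] e]) (rule nonexpanding_pts[OF fe_in[OF X] f])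
    finally show "dst (underlying A) (eval A f (conv l)) (eval A f (conv r)) \<le> ennreal (real_of_rat \<epsilon>)"
      using ev[OF lr(1) f] ev[OF lr(2) f] by (simp add: U)
  qed
  ultimately have A: "A \<in> Alg" using X by (auto simp: Alg_def Ob_Sigma_UMet U Ob_UMet)
  have "str A = a"
  proof (rule nonexpanding_eqI)
    show "str A \<in> nonexpanding (TO X) X" "a \<in> nonexpanding (TO X) X" using str_in[OF A] a by (auto simp: U)
    fix z assume "z \<in> pts (TO X)"
    then obtain t where t: "t \<in> tms \<Sigma> (pts X)" "z = ev X t" by (rule TO_cases[OF X])
    show "str A z = a z"
      using str_ev[OF A, of t] t ev[OF t(1), of "\<lambda>x. x"] by (simp add: U tmap_id)
  qed
  then show ?thesis using A U by blast
qed

lemma represents_monad: "represents (\<Sigma>, Alg) monad str"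
  unfolding represents_def Ob_variety
proof (intro conjI ballI)
  show "enriched_monad UMet monad" by (rule monad_enriched)
  show "bij_betw (\<lambda>A. (underlying A, str A)) Alg (EM monad)"
    unfolding bij_betw_def
  proof
    show "inj_on (\<lambda>A. (underlying A, str A)) Alg"
    proof (rule inj_onI)
      fix A B assume A: "A \<in> Alg" and B: "B \<in> Alg" and e: "(underlying A, str A) = (underlying B, str B)"
      show "A = B"
        using e opn_str[OF A] opn_str[OF B]
        by (intro alg_eqI[OF Alg_ultra[OF A] Alg_ultra[OF B]]) auto
    qed
    show "(\<lambda>A. (underlying A, str A)) ` Alg = EM monad"
      using str_EM EM_surj by (force simp: image_iff)
  qed
  fix A B assume A: "A \<in> Alg" and B: "B \<in> Alg"
  have "h \<in> homomorphisms \<Sigma> A B \<longleftrightarrow> h \<in> EM_hom monad (underlying A, str A) (underlying B, str B)" for h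
  proof
    assume h: "h \<in> homomorphisms \<Sigma> A B"
    then show "h \<in> EM_hom monad (underlying A, str A) (underlying B, str B)"
      using str_TMap[OF A B h] homomorphism_nonexpanding[OF h] Alg_Ob[OF A] Alg_Ob[OF B]
      by (simp add: EM_hom_def)
  next
    assume "h \<in> EM_hom monad (underlying A, str A) (underlying B, str B)"
    then have h: "h \<in> nonexpanding (underlying A) (underlying B)"
      and hs: "\<And>t. t \<in> pts (TO (underlying A)) \<Longrightarrow> h (str A t) = str B (TMap (underlying A) (underlying B) h t)"
      using Alg_Ob[OF A] Alg_Ob[OF B] by (auto simp: EM_hom_def)
    show "h \<in> homomorphisms \<Sigma> A B"
    proof (rule homomorphismI[OF h])
      fix \<sigma> xs assume x: "\<sigma> \<in> symbols \<Sigma>" "length xs = arity \<Sigma> \<sigma>" "set xs \<subseteq> pts (underlying A)"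
      let ?t = "TF \<sigma> (map TV xs)"
      have t: "?t \<in> tms \<Sigma> (pts (underlying A))" using x by auto
      have "h (opn A \<sigma> xs) = str B (ev (underlying B) (tmap h ?t))"
        unfolding opn_str[OF A x] using hs[OF ev_pts[OF Alg_Ob[OF A] t]]
        by (simp only: TMap_ev[OF Alg_Ob[OF A] Alg_Ob[OF B] h t])
      also have "tmap h ?t = TF \<sigma> (map TV (map h xs))" by simp
      also have "str B (ev (underlying B) (TF \<sigma> (map TV (map h xs)))) = opn B \<sigma> (map h xs)"
        using x nonexpanding_pts[OF h] by (intro opn_str[OF B, symmetric]) auto
      finally show "h (opn A \<sigma> xs) = opn B \<sigma> (map h xs)" .
    qed
  qed
  then show "homomorphisms (fst (\<Sigma>, Alg)) A B = EM_hom monad (underlying A, str A) (underlying B, str B)" by auto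
qed

text \<open>Families of maps on finite discrete spaces that are compatible with reindexing, expressed
  as one map on terms.\<close>

definition tcocone :: "'u emetric \<Rightarrow> 'u emetric \<Rightarrow> (('u, 'u) tm \<Rightarrow> 'u) \<Rightarrow> bool"
  where "tcocone X B \<Theta> \<longleftrightarrow> (\<forall>s\<in>tms \<Sigma> (pts X). \<Theta> s \<in> pts B) \<and>
    (\<forall>N\<in>Ob Set_fp. \<forall>\<phi>\<in>nonexpanding N X. \<forall>s\<in>tms \<Sigma> (pts N). \<forall>t\<in>tms \<Sigma> (pts N).
      dst B (\<Theta> (tmap \<phi> s)) (\<Theta> (tmap \<phi> t)) \<le> dst (TO N) (ev N s) (ev N t)) \<and>
    (\<forall>N\<in>Ob Set_fp. \<forall>\<phi>\<in>nonexpanding N X. \<forall>\<psi>\<in>nonexpanding N X. \<forall>t\<in>tms \<Sigma> (pts (N :: 'u emetric)).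
      dst B (\<Theta> (tmap \<phi> t)) (\<Theta> (tmap \<psi> t)) \<le> sup_dist N X \<phi> \<psi>)"

lemma tcoconeD:
  assumes "tcocone X B \<Theta>"
  shows "s \<in> tms \<Sigma> (pts X) \<Longrightarrow> \<Theta> s \<in> pts B"
    and "\<lbrakk>N \<in> Ob Set_fp; \<phi> \<in> nonexpanding N X; s \<in> tms \<Sigma> (pts N); t \<in> tms \<Sigma> (pts N)\<rbrakk> \<Longrightarrow>
      dst B (\<Theta> (tmap \<phi> s)) (\<Theta> (tmap \<phi> t)) \<le> dst (TO N) (ev N s) (ev N t)"
    and "\<lbrakk>N \<in> Ob Set_fp; \<phi> \<in> nonexpanding N X; \<psi> \<in> nonexpanding N X; t \<in> tms \<Sigma> (pts N)\<rbrakk> \<Longrightarrow>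
      dst B (\<Theta> (tmap \<phi> t)) (\<Theta> (tmap \<psi> t)) \<le> sup_dist N X \<phi> \<psi>"
  using assms unfolding tcocone_def by blast+

section \<open>Cocones as maps on terms, and strong finitariness\<close>

lemma fresh_copy:
  fixes D :: "'u set"
  assumes "finite S" "finite D"
  obtains i Q where "finite Q" "Q \<inter> D = {}" "bij_betw i S Q"
proof -
  have "infinite (UNIV - D)" using infinite_UNIV_u assms(2) by (rule Diff_infinite_finite[rotated])
  then obtain Q where Q: "finite Q" "card Q = card S" "Q \<subseteq> UNIV - D"
    using infinite_arbitrarily_large by blast
  then obtain i where "bij_betw i S Q" using finite_same_card_bij[OF assms(1)] by metis
  then show ?thesis using that Q by blast
qed

text \<open>The fixed arguments contain finitely many variables \<open>D\<close> in
  \<open>X\<close>. A cocone at \<open>N\<close> for the remaining argument is obtained from the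
  given one at the disjoint union of \<open>D\<close> with a copy of \<open>N\<close>, where
  \<open>D\<close> is mapped to \<open>X\<close> by inclusion and the copy as before.\<close>

lemma tcocone_op:
  assumes X: "X \<in> Ob UMet" and \<Theta>: "tcocone X B \<Theta>" and \<sigma>: "\<sigma> \<in> symbols \<Sigma>" "length ss = arity \<Sigma> \<sigma>"
    and ss: "set ss \<subseteq> tms \<Sigma> (pts X)"
  shows "tcocone X B (\<lambda>s. \<Theta> (TF \<sigma> (ss[k := s])))"
proof -
  have upd: "set (xs[k := s]) \<subseteq> tms \<Sigma> Y" if "s \<in> tms \<Sigma> Y" "set xs \<subseteq> tms \<Sigma> Y" for s :: "('u, 'u) tm" and xs Y
    using that set_update_subset_insert[of xs k s] by blast
  define D where "D = (\<Union>s\<in>set ss. vars s)"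
  have D: "finite D" by (simp add: D_def finite_vars)
  have DX: "D \<subseteq> pts X" using ss vars_tms by (fastforce simp: D_def)
  have fresh: "\<exists>P\<in>Ob Set_fp. \<exists>i\<in>nonexpanding N P. \<exists>h. D \<subseteq> pts P \<and>
    (\<forall>\<phi>\<in>nonexpanding N X. h \<phi> \<in> nonexpanding P X \<and>
      (\<forall>s\<in>tms \<Sigma> (pts N). tmap (h \<phi>) (TF \<sigma> (ss[k := tmap i s])) = TF \<sigma> (ss[k := tmap \<phi> s])) \<and>
      (\<forall>\<psi>\<in>nonexpanding N X. sup_dist P X (h \<phi>) (h \<psi>) \<le> sup_dist N X \<phi> \<psi>))"
    if N: "N \<in> Ob Set_fp" for N :: "'u emetric"
  proof -
    have "finite (pts N)" using N by (simp add: Ob_Set_fp)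
    then obtain i Q where Q: "finite Q" "Q \<inter> D = {}" and i: "bij_betw i (pts N) Q"
      by (rule fresh_copy[OF _ D])
    let ?P = "disc (D \<union> Q)"
    let ?i = "\<lambda>x\<in>pts N. i x"
    define j where "j = inv_into (pts N) i"
    \<comment> \<open>Points of \<open>N\<close> are arbitrary elements of \<open>'u\<close> and
      could collide with \<open>D\<close>, hence the copy \<open>Q\<close> and the translation
      \<open>j\<close> back to \<open>N\<close>.\<close>
    define h where "h \<phi> = (\<lambda>p\<in>D \<union> Q. if p \<in> D then p else \<phi> (j p))" for \<phi> :: "'u \<Rightarrow> 'u"
    have P: "?P \<in> Ob Set_fp" using D Q by (intro disc_Ob_Set_fp) simp
    have iQ: "i x \<in> Q" if "x \<in> pts N" for x using i that by (auto simp: bij_betw_def)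
    have ji: "j (i x) = x" if "x \<in> pts N" for x
      using i that by (simp add: j_def bij_betw_def inv_into_f_f)
    have jN: "j p \<in> pts N" if "p \<in> Q" for p
      using i that by (simp add: j_def bij_betw_def inv_into_into)
    have i': "?i \<in> nonexpanding N ?P"
      using iQ by (simp add: nonexpanding_Set_fp[OF N Set_fp_UMet[OF P]] PiE_iff)
    have h: "h \<phi> \<in> nonexpanding ?P X" if "\<phi> \<in> nonexpanding N X" for \<phi>
      using DX jN nonexpanding_pts[OF that] by (auto simp: nonexpanding_disc[OF X] h_def PiE_iff)
    have t: "tmap (h \<phi>) (TF \<sigma> (ss[k := tmap ?i s])) = TF \<sigma> (ss[k := tmap \<phi> s])"
      if "\<phi> \<in> nonexpanding N X" "s \<in> tms \<Sigma> (pts N)" for \<phi> s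
    proof -
      have "tmap (h \<phi>) (tmap ?i s) = tmap \<phi> s"
        unfolding tmap_tmap using vars_tms[OF that(2)] iQ ji Q(2)
        by (intro tm.map_cong refl) (auto simp: h_def subset_iff disjoint_iff)
      moreover have "map (tmap (h \<phi>)) ss = ss"
        by (intro map_idI tmap_id) (auto simp: h_def D_def)
      ultimately show ?thesis by (simp add: map_update)
    qed
    \<comment> \<open>The two extended maps agree on \<open>D\<close>, so no distance is added
      there.\<close>
    have "sup_dist ?P X (h \<phi>) (h \<psi>) \<le> sup_dist N X \<phi> \<psi>" for \<phi> \<psi>
    proof (rule sup_dist_le)
      fix p assume "p \<in> pts ?P"
      then show "dst X (h \<phi> p) (h \<psi> p) \<le> sup_dist N X \<phi> \<psi>"
        using DX ultra_refl[OF Ob_UMetD[OF X], of p] le_sup_dist[OF jN, of p X \<phi> \<psi>]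
        by (auto simp: h_def)
    qed
    then show ?thesis using P i' h t by (intro bexI[of _ ?P] bexI[of _ ?i] exI[of _ h]) auto
  qed
  show ?thesis
    unfolding tcocone_def
  proof (intro conjI ballI)
    show "\<Theta> (TF \<sigma> (ss[k := s])) \<in> pts B" if "s \<in> tms \<Sigma> (pts X)" for s
      using tcoconeD(1)[OF \<Theta>, of "TF \<sigma> (ss[k := s])"] \<sigma> upd[OF that ss] by simp
    fix N :: "'u emetric" and \<phi> assume N: "N \<in> Ob Set_fp" and \<phi>: "\<phi> \<in> nonexpanding N X"
    from fresh[OF N] obtain P i h where P: "P \<in> Ob Set_fp" and i: "i \<in> nonexpanding N P" and DP: "D \<subseteq> pts P"
      and h': "\<forall>\<phi>\<in>nonexpanding N X. h \<phi> \<in> nonexpanding P X \<and>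
      (\<forall>s\<in>tms \<Sigma> (pts N). tmap (h \<phi>) (TF \<sigma> (ss[k := tmap i s])) = TF \<sigma> (ss[k := tmap \<phi> s])) \<and>
      (\<forall>\<psi>\<in>nonexpanding N X. sup_dist P X (h \<phi>) (h \<psi>) \<le> sup_dist N X \<phi> \<psi>)"
      by (elim bexE exE conjE)
    have h: "h \<phi> \<in> nonexpanding P X" if "\<phi> \<in> nonexpanding N X" for \<phi> using h' that by blast
    have ht: "tmap (h \<phi>) (TF \<sigma> (ss[k := tmap i s])) = TF \<sigma> (ss[k := tmap \<phi> s])"
      if "\<phi> \<in> nonexpanding N X" "s \<in> tms \<Sigma> (pts N)" for \<phi> s using h' that by blast
    have P': "P \<in> Ob UMet" and N': "N \<in> Ob UMet" using P N by (auto intro: Set_fp_UMet)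
    have ssP: "set ss \<subseteq> tms \<Sigma> (pts P)"
    proof
      fix s assume s: "s \<in> set ss"
      then have "vars s \<subseteq> pts P" using DP by (auto simp: D_def)
      then show "s \<in> tms \<Sigma> (pts P)" by (rule tms_vars[OF subsetD[OF ss s]])
    qed
    have mi: "tmap i s \<in> tms \<Sigma> (pts P)" if "s \<in> tms \<Sigma> (pts N)" for s
      by (rule tmap_tms[OF that]) (rule nonexpanding_pts[OF i])
    have tP: "TF \<sigma> (ss[k := tmap i s]) \<in> tms \<Sigma> (pts P)" if "s \<in> tms \<Sigma> (pts N)" for s
      using \<sigma> upd[OF mi[OF that] ssP] by simp
    { fix s t assume s: "s \<in> tms \<Sigma> (pts N)" and t: "t \<in> tms \<Sigma> (pts N)"
      have "dst B (\<Theta> (TF \<sigma> (ss[k := tmap \<phi> s]))) (\<Theta> (TF \<sigma> (ss[k := tmap \<phi> t])))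
          \<le> dst (TO P) (ev P (TF \<sigma> (ss[k := tmap i s]))) (ev P (TF \<sigma> (ss[k := tmap i t])))"
        using tcoconeD(2)[OF \<Theta> P h[OF \<phi>] tP[OF s] tP[OF t]] unfolding ht[OF \<phi> s] ht[OF \<phi> t] .
      also have "\<dots> \<le> dst (TO N) (ev N s) (ev N t)"
        unfolding ev_TF
      proof (rule opn_le[OF FA_ultra[OF P'] \<sigma>(1)])
        have e: "set (map (ev P) (ss[k := tmap i r])) \<subseteq> pts (TO P)" if "r \<in> tms \<Sigma> (pts N)" for r
          using upd[OF mi[OF that] ssP] ev_pts[OF P'] by (auto simp del: set_update_subset_insert)
        show "set (map (ev P) (ss[k := tmap i s])) \<subseteq> pts (TO P)" "set (map (ev P) (ss[k := tmap i t])) \<subseteq> pts (TO P)"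
          using e s t by blast+
        fix m assume m: "m < arity \<Sigma> \<sigma>"
        show "dst (TO P) (map (ev P) (ss[k := tmap i s]) ! m) (map (ev P) (ss[k := tmap i t]) ! m)
            \<le> dst (TO N) (ev N s) (ev N t)"
        \<comment> \<open>Only position \<open>k\<close> varies; there the renaming \<open>i\<close>
          induces a nonexpanding map of free algebras. All other arguments coincide.\<close>
        proof (cases "m = k")
          case True
          then show ?thesis
            using m \<sigma> nonexpanding_le[OF TMap_in[OF N' P' i] ev_pts[OF N' s] ev_pts[OF N' t]]
              TMap_ev[OF N' P' i s] TMap_ev[OF N' P' i t] by simp
        next
          case False
          have "ss ! m \<in> tms \<Sigma> (pts P)" using ssP m \<sigma> nth_mem[of m ss] by auto
          then show ?thesis
            using False m \<sigma> ultra_refl[OF Ob_UMetD[OF TO_Ob[OF P']] ev_pts[OF P']] by simp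
        qed
      qed (use \<sigma> in auto)
      finally show "dst B (\<Theta> (TF \<sigma> (ss[k := tmap \<phi> s]))) (\<Theta> (TF \<sigma> (ss[k := tmap \<phi> t])))
          \<le> dst (TO N) (ev N s) (ev N t)" . }
    fix \<psi> t assume \<psi>: "\<psi> \<in> nonexpanding N X" and t: "t \<in> tms \<Sigma> (pts N)"
    have "dst B (\<Theta> (TF \<sigma> (ss[k := tmap \<phi> t]))) (\<Theta> (TF \<sigma> (ss[k := tmap \<psi> t]))) \<le> sup_dist P X (h \<phi>) (h \<psi>)"
      using tcoconeD(3)[OF \<Theta> P h[OF \<phi>] h[OF \<psi>] tP[OF t]] unfolding ht[OF \<phi> t] ht[OF \<psi> t] .
    also have "\<dots> \<le> sup_dist N X \<phi> \<psi>" using h' \<phi> \<psi> by blast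
    finally show "dst B (\<Theta> (TF \<sigma> (ss[k := tmap \<phi> t]))) (\<Theta> (TF \<sigma> (ss[k := tmap \<psi> t]))) \<le> sup_dist N X \<phi> \<psi>" .
  qed
qed

text \<open>The supremum of the pseudometrics induced by all such families is a model of the theory, so
  it lies below the metric of the free algebra. It is compatible with the operations because the
  arguments can be changed one at a time, which is where the ultrametric inequality is used.\<close>

lemma tcocone_le:
  assumes X: "X \<in> Ob UMet" and B: "ultrametric_space B" and \<Theta>: "tcocone X B \<Theta>"
    and s: "s \<in> tms \<Sigma> (pts X)" and t: "t \<in> tms \<Sigma> (pts X)"
  shows "dst B (\<Theta> s) (\<Theta> t) \<le> dst (TO X) (ev X s) (ev X t)"
proof -
  let ?T = "tms \<Sigma> (pts X)"
  define I where "I = {(B, \<Theta>). ultrametric_space B \<and> tcocone X B \<Theta>}"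
  define d where "d s t = (SUP (B, \<Theta>)\<in>I. dst B (\<Theta> s) (\<Theta> t))" for s t
  have d_le: "d s t \<le> c"
    if "\<And>B \<Theta>. ultrametric_space B \<Longrightarrow> tcocone X B \<Theta> \<Longrightarrow> dst B (\<Theta> s) (\<Theta> t) \<le> c" for s t c
    unfolding d_def by (intro SUP_least) (auto simp: I_def that)
  have le_d: "dst B (\<Theta> s) (\<Theta> t) \<le> d s t" if "ultrametric_space B" "tcocone X B \<Theta>" for B \<Theta> s t
    unfolding d_def using that by (intro SUP_upper2[of "(B, \<Theta>)"]) (auto simp: I_def)
  have "\<exists>A e. A \<in> Alg \<and> e \<in> nonexpanding X (underlying A) \<and> pts (underlying A) = eval A e ` ?T \<and>
    (\<forall>s\<in>?T. \<forall>t\<in>?T. dst (underlying A) (eval A e s) (eval A e t) = d s t)"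
  proof (rule quotient_model[OF X])
    show "d s s = 0" if "s \<in> ?T" for s
      using d_le[of s s 0] ultra_refl[OF _ tcoconeD(1)] that by simp
    have "d s t \<le> d t s" if "s \<in> ?T" "t \<in> ?T" for s t
      using ultra_sym[OF _ tcoconeD(1) tcoconeD(1)] that le_d by (intro d_le) metis
    then show "d s t = d t s" if "s \<in> ?T" "t \<in> ?T" for s t using that by (simp add: antisym)
    show "d s r \<le> max (d s t) (d t r)" if "s \<in> ?T" "t \<in> ?T" "r \<in> ?T" for s t r
    proof (rule d_le)
      fix B \<Theta> assume B: "ultrametric_space B" and \<Theta>: "tcocone X B \<Theta>"
      note p = tcoconeD(1)[OF \<Theta>]
      show "dst B (\<Theta> s) (\<Theta> r) \<le> max (d s t) (d t r)"
        using ultra_tri[OF B p[OF that(1)] p[OF that(2)] p[OF that(3)]]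
          le_d[OF B \<Theta>, of s t] le_d[OF B \<Theta>, of t r] by (meson max.mono order_trans)
    qed
    show "d (TF \<sigma> ss) (TF \<sigma> ts) \<le> c"
      if \<sigma>: "\<sigma> \<in> symbols \<Sigma>" and ss: "length ss = arity \<Sigma> \<sigma>" "set ss \<subseteq> ?T" and ts: "length ts = arity \<Sigma> \<sigma>" "set ts \<subseteq> ?T"
        and c: "\<And>i. i < arity \<Sigma> \<sigma> \<Longrightarrow> d (ss ! i) (ts ! i) \<le> c" for \<sigma> ss ts c
    proof (rule d_le)
      fix B \<Theta> assume B: "ultrametric_space B" and \<Theta>: "tcocone X B \<Theta>"
      \<comment> \<open>The hybrid list with the leading \<open>k\<close> arguments already
        replaced; it runs from \<open>ss\<close> to \<open>ts\<close>.\<close>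
      define w where "w k = take k ts @ drop k ss" for k
      have w: "length (w k) = arity \<Sigma> \<sigma>" "set (w k) \<subseteq> ?T" if "k \<le> arity \<Sigma> \<sigma>" for k
        using ss ts that set_take_subset[of k ts] set_drop_subset[of k ss] by (auto simp: w_def)
      have wp: "\<Theta> (TF \<sigma> (w k)) \<in> pts B" if "k \<le> arity \<Sigma> \<sigma>" for k
        using tcoconeD(1)[OF \<Theta>, of "TF \<sigma> (w k)"] \<sigma> w[OF that] by simp
      have "k \<le> arity \<Sigma> \<sigma> \<Longrightarrow> dst B (\<Theta> (TF \<sigma> (w 0))) (\<Theta> (TF \<sigma> (w k))) \<le> c" for k
      proof (induction k)
        case 0
        then show ?case using ultra_refl[OF B wp[of 0]] by simp
      next
        case (Suc k)
        then have k: "k < arity \<Sigma> \<sigma>" by simp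
        \<comment> \<open>Neighbouring hybrids are values of one cocone, with all arguments except
          the one at position \<open>k\<close> fixed as in \<open>w k\<close>, at the two terms
          \<open>ss ! k\<close> and \<open>ts ! k\<close>.\<close>
        have "w k = (w k)[k := ss ! k]"
          using k ss ts by (simp add: w_def list_update_append nth_append flip: Cons_nth_drop_Suc)
        moreover have "w (Suc k) = (w k)[k := ts ! k]"
          using k ss ts
          by (simp add: w_def list_update_append take_Suc_conv_app_nth flip: Cons_nth_drop_Suc)
        moreover have "dst B (\<Theta> (TF \<sigma> ((w k)[k := ss ! k]))) (\<Theta> (TF \<sigma> ((w k)[k := ts ! k]))) \<le> d (ss ! k) (ts ! k)"
          using le_d[OF B tcocone_op[OF X \<Theta> \<sigma> w]] k by simp
        ultimately have "dst B (\<Theta> (TF \<sigma> (w k))) (\<Theta> (TF \<sigma> (w (Suc k)))) \<le> c"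
          using c[OF k] by (metis order_trans)
        then show ?case
          \<comment> \<open>The bound \<open>c\<close> survives each step because distances combine
            by maximum.\<close>
          using Suc k by (intro ultra_tri3[OF B wp wp wp, of 0 k "Suc k"]) auto
      qed
      from this[of "arity \<Sigma> \<sigma>"] show "dst B (\<Theta> (TF \<sigma> ss)) (\<Theta> (TF \<sigma> ts)) \<le> c"
        using ss ts by (simp add: w_def)
    qed
    show "d (subst g (conv l)) (subst g (conv r)) \<le> ennreal (real_of_rat \<epsilon>)"
      if e: "(l, \<epsilon>, r) \<in> E" and g: "\<And>n. g n \<in> ?T" for l \<epsilon> r g
    proof (rule d_le)
      fix B \<Theta> assume B: "ultrametric_space B" and \<Theta>: "tcocone X B \<Theta>"
      define L where "L = vars (conv l) \<union> vars (conv r)"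
      \<comment> \<open>Only variables of the equation matter; all others get the value
        \<open>g 0\<close>, so that every value of \<open>g'\<close> is a term over the finite set
        \<open>D\<close>. The instance then lives in the free algebra on \<open>disc D\<close>,
        which satisfies the equation.\<close>
      define g' where "g' n = (if n \<in> L then g n else g 0)" for n
      define D where "D = (\<Union>n\<in>insert 0 L. vars (g n))"
      have "finite D" by (simp add: D_def L_def finite_vars)
      then have N: "disc D \<in> Ob Set_fp" by (rule disc_Ob_Set_fp)
      note N' = Set_fp_UMet[OF N]
      have DX: "D \<subseteq> pts X" using g vars_tms by (fastforce simp: D_def)
      have g': "g' n \<in> tms \<Sigma> (pts (disc D))" for n
      proof -
        have "g' n \<in> ?T" "vars (g' n) \<subseteq> D" using g by (auto simp: g'_def D_def)
        then show ?thesis by (simp add: tms_vars)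
      qed
      have sub: "subst g (conv l) = subst g' (conv l)" "subst g (conv r) = subst g' (conv r)"
        by (auto intro!: subst_cong simp: g'_def L_def)
      let ?i = "\<lambda>x\<in>D. x"
      have i: "?i \<in> nonexpanding (disc D) X" using DX by (auto simp: nonexpanding_disc[OF X] PiE_iff)
      have ti: "tmap ?i u = u" if "u \<in> tms \<Sigma> (pts (disc D))" for u
        using vars_tms[OF that] by (intro tmap_id) auto
      note lr = E_tms[OF e, of g' "pts (disc D)", OF g']
      have "dst B (\<Theta> (subst g (conv l))) (\<Theta> (subst g (conv r)))
          \<le> dst (TO (disc D)) (ev (disc D) (subst g' (conv l))) (ev (disc D) (subst g' (conv r)))"
        using tcoconeD(2)[OF \<Theta> N i lr] unfolding ti[OF lr(1)] ti[OF lr(2)] sub .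
      also have "\<dots> \<le> ennreal (real_of_rat \<epsilon>)"
        unfolding ev_def eval_subst by (rule Alg_satisfies[OF FA_Alg[OF N'] e]) (fold ev_def, rule ev_pts[OF N' g'])
      finally show "dst B (\<Theta> (subst g (conv l))) (\<Theta> (subst g (conv r))) \<le> ennreal (real_of_rat \<epsilon>)" .
    qed
    show "d (TV x) (TV y) \<le> dst X x y" if x: "x \<in> pts X" and y: "y \<in> pts X" for x y
    proof (rule d_le)
      fix B \<Theta> assume B: "ultrametric_space B" and \<Theta>: "tcocone X B \<Theta>"
      \<comment> \<open>Two points of \<open>X\<close> are two maps from a one-point space, whose
        supremum distance is the distance of the points.\<close>
      let ?N = "disc {x}" and ?f = "\<lambda>p\<in>{x}. x" and ?g = "\<lambda>p\<in>{x}. y"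
      have "?N \<in> Ob Set_fp" by (rule disc_Ob_Set_fp) simp
      moreover have "?f \<in> nonexpanding ?N X" "?g \<in> nonexpanding ?N X"
        using x y by (auto simp: nonexpanding_disc[OF X] PiE_iff)
      ultimately have "dst B (\<Theta> (tmap ?f (TV x))) (\<Theta> (tmap ?g (TV x))) \<le> sup_dist ?N X ?f ?g"
        by (intro tcoconeD(3)[OF \<Theta>]) auto
      then show "dst B (\<Theta> (TV x)) (\<Theta> (TV y)) \<le> dst X x y" by (simp add: sup_dist_def)
    qed
  qed
  then obtain A e where A: "A \<in> Alg" and e: "e \<in> nonexpanding X (underlying A)"
    and d: "\<forall>s\<in>?T. \<forall>t\<in>?T. dst (underlying A) (eval A e s) (eval A e t) = d s t" by blast
  have "dst B (\<Theta> s) (\<Theta> t) \<le> d s t" by (rule le_d[OF B \<Theta>])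
  also have "\<dots> \<le> dst (TO X) (ev X s) (ev X t)" using ev_le[OF X A e s t] d s t by simp
  finally show ?thesis .
qed

text \<open>A term is evaluated by the cocone at the space of its own variables. The value agrees
  with that at any \<open>N\<close> by naturality along two maps: the inclusion of the variables
  into \<open>N\<close>, and the surjection from them onto the variables of the renamed
  term.\<close>

lemma cocone_tcocone:
  assumes X: "X \<in> Ob UMet" and B: "B \<in> Ob UMet" and \<theta>: "cocone (endo monad) X B \<theta>"
  defines "\<Theta> \<equiv> \<lambda>s. \<theta> (disc (vars s)) (\<lambda>x\<in>vars s. x) (ev (disc (vars s)) s)"
  shows cocone_term: "\<And>N \<phi> s. \<lbrakk>N \<in> Ob Set_fp; \<phi> \<in> nonexpanding N X; s \<in> tms \<Sigma> (pts N)\<rbrakk> \<Longrightarrow>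
      \<Theta> (tmap \<phi> s) = \<theta> N \<phi> (ev N s)"
    and "tcocone X B \<Theta>"
proof -
  have \<theta>in: "\<theta> N \<phi> \<in> nonexpanding (TO N) B" if "N \<in> Ob Set_fp" "\<phi> \<in> nonexpanding N X" for N \<phi>
    using \<theta> that by (simp add: cocone_def Set_fp_UMet)
  have \<theta>le: "dst B (\<theta> N \<phi> t) (\<theta> N \<psi> t) \<le> sup_dist N X \<phi> \<psi>"
    if "N \<in> Ob Set_fp" "\<phi> \<in> nonexpanding N X" "\<psi> \<in> nonexpanding N X" "t \<in> pts (TO N)" for N \<phi> \<psi> t
    using \<theta> that by (simp add: cocone_def Set_fp_UMet)
  have \<theta>nat: "\<theta> N (compose (pts N) \<phi> f) (ev N s) = \<theta> N' \<phi> (ev N' (tmap f s))"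
    if "N \<in> Ob Set_fp" "N' \<in> Ob Set_fp" "f \<in> nonexpanding N N'" "\<phi> \<in> nonexpanding N' X" "s \<in> tms \<Sigma> (pts N)" for N N' f \<phi> s
    using \<theta> that TMap_ev[OF _ _ that(3,5)] by (simp add: cocone_def Set_fp_UMet ev_pts)
  have dO: "disc (vars s) \<in> Ob Set_fp" for s :: "('u, 'u) tm" by (rule disc_Ob_Set_fp[OF finite_vars])
  have ds: "s \<in> tms \<Sigma> (pts (disc (vars s)))" if "s \<in> tms \<Sigma> Y" for s and Y :: "'u set"
    using tms_vars[OF that] by simp
  show key: "\<Theta> (tmap \<phi> s) = \<theta> N \<phi> (ev N s)" if N: "N \<in> Ob Set_fp" and \<phi>: "\<phi> \<in> nonexpanding N X" and s: "s \<in> tms \<Sigma> (pts N)" for N \<phi> s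
  proof -
    let ?D = "vars s" and ?W = "vars (tmap \<phi> s)"
    have DN: "?D \<subseteq> pts N" by (rule vars_tms[OF s])
    have W: "?W = \<phi> ` ?D" by (rule tm.set_map)
    have i: "(\<lambda>x\<in>?D. x) \<in> nonexpanding (disc ?D) N"
      using DN by (auto simp: nonexpanding_disc[OF Set_fp_UMet[OF N]] PiE_iff)
    have f: "(\<lambda>x\<in>?D. \<phi> x) \<in> nonexpanding (disc ?D) (disc ?W)"
      unfolding nonexpanding_disc[OF Set_fp_UMet[OF dO]] by (auto simp: PiE_iff W)
    have w: "(\<lambda>x\<in>?W. x) \<in> nonexpanding (disc ?W) X"
      using DN nonexpanding_pts[OF \<phi>] by (auto simp: nonexpanding_disc[OF X] PiE_iff W)
    have "tmap (\<lambda>x\<in>?D. x) s = s" by (intro tmap_id) simp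
    then have "\<theta> N \<phi> (ev N s) = \<theta> (disc ?D) (compose ?D \<phi> (\<lambda>x\<in>?D. x)) (ev (disc ?D) s)"
      using \<theta>nat[OF dO N i \<phi> ds[OF s]] by simp
    also have "compose ?D \<phi> (\<lambda>x\<in>?D. x) = compose ?D (\<lambda>x\<in>?W. x) (\<lambda>x\<in>?D. \<phi> x)"
      by (intro compose_eqI) (simp add: W)
    also have "\<theta> (disc ?D) (compose ?D (\<lambda>x\<in>?W. x) (\<lambda>x\<in>?D. \<phi> x)) (ev (disc ?D) s)
        = \<theta> (disc ?W) (\<lambda>x\<in>?W. x) (ev (disc ?W) (tmap (\<lambda>x\<in>?D. \<phi> x) s))"
      using \<theta>nat[OF dO dO f w ds[OF s]] by simp
    also have "tmap (\<lambda>x\<in>?D. \<phi> x) s = tmap \<phi> s" by (intro tm.map_cong) auto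
    finally show ?thesis unfolding \<Theta>_def by (rule sym)
  qed
  show "tcocone X B \<Theta>"
    unfolding tcocone_def
  proof (intro conjI ballI)
    show "\<Theta> s \<in> pts B" if s: "s \<in> tms \<Sigma> (pts X)" for s
    proof -
      have "(\<lambda>x\<in>vars s. x) \<in> nonexpanding (disc (vars s)) X"
        using vars_tms[OF s] by (auto simp: nonexpanding_disc[OF X] PiE_iff)
      then show ?thesis
        unfolding \<Theta>_def by (rule nonexpanding_pts[OF \<theta>in[OF dO] ev_pts[OF Set_fp_UMet[OF dO] ds[OF s]]])
    qed
    fix N :: "'u emetric" and \<phi> assume N: "N \<in> Ob Set_fp" and \<phi>: "\<phi> \<in> nonexpanding N X"
    show "dst B (\<Theta> (tmap \<phi> s)) (\<Theta> (tmap \<phi> t)) \<le> dst (TO N) (ev N s) (ev N t)"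
      if "s \<in> tms \<Sigma> (pts N)" "t \<in> tms \<Sigma> (pts N)" for s t
      unfolding key[OF N \<phi> that(1)] key[OF N \<phi> that(2)]
      by (rule nonexpanding_le[OF \<theta>in[OF N \<phi>]]) (rule ev_pts[OF Set_fp_UMet[OF N]], fact that)+
    show "dst B (\<Theta> (tmap \<phi> t)) (\<Theta> (tmap \<psi> t)) \<le> sup_dist N X \<phi> \<psi>"
      if "\<psi> \<in> nonexpanding N X" "t \<in> tms \<Sigma> (pts N)" for \<psi> t
      unfolding key[OF N \<phi> that(2)] key[OF N that]
      by (rule \<theta>le[OF N \<phi> that(1) ev_pts[OF Set_fp_UMet[OF N] that(2)]])
  qed
qed

text \<open>Every class of a term comes from the space of its variables, which is generation. A
  cocone becomes a map on terms that lies below the free metric, so it descends to the required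
  nonexpanding map.\<close>

lemma monad_strongly_finitary: "strongly_finitary (endo monad)"
proof -
  interpret endofunctor "endo monad" using enriched_endo by unfold_locales
  show ?thesis
  proof (rule strongly_finitaryI)
    fix X :: "'u emetric" and z assume X: "X \<in> Ob UMet" and "z \<in> pts (FO (endo monad) X)"
    then have "z \<in> pts (TO X)" by simp
    then obtain t where t: "t \<in> tms \<Sigma> (pts X)" "z = ev X t" by (rule TO_cases[OF X])
    let ?N = "disc (vars t)" and ?i = "\<lambda>x\<in>vars t. x"
    have N: "?N \<in> Ob Set_fp" by (rule disc_Ob_Set_fp[OF finite_vars])
    have i: "?i \<in> nonexpanding ?N X" using vars_tms[OF t(1)] by (auto simp: nonexpanding_disc[OF X] PiE_iff)
    have t': "t \<in> tms \<Sigma> (pts ?N)" using tms_vars[OF t(1)] by simp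
    have "tmap ?i t = t" by (intro tmap_id) simp
    then have "FM (endo monad) ?N X ?i (ev ?N t) = z"
      using TMap_ev[OF Set_fp_UMet[OF N] X i t'] t(2) X i Set_fp_UMet[OF N] by simp
    moreover have "ev ?N t \<in> pts (FO (endo monad) ?N)"
      using ev_pts[OF Set_fp_UMet[OF N] t'] Set_fp_UMet[OF N] by simp
    ultimately show "\<exists>N\<in>Ob Set_fp. \<exists>\<phi>\<in>nonexpanding N X. \<exists>s\<in>pts (FO (endo monad) N). z = FM (endo monad) N X \<phi> s"
      using N i by metis
  next
    fix X B :: "'u emetric" and \<theta> assume X: "X \<in> Ob UMet" and B: "B \<in> Ob UMet" and \<theta>: "cocone (endo monad) X B \<theta>"
    define \<Theta> where "\<Theta> s = \<theta> (disc (vars s)) (\<lambda>x\<in>vars s. x) (ev (disc (vars s)) s)" for s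
    have key: "\<Theta> (tmap \<phi> s) = \<theta> N \<phi> (ev N s)"
      if "N \<in> Ob Set_fp" "\<phi> \<in> nonexpanding N X" "s \<in> tms \<Sigma> (pts N)" for N \<phi> s
      unfolding \<Theta>_def by (rule cocone_term[OF X B \<theta> that])
    have \<Theta>: "tcocone X B \<Theta>" unfolding \<Theta>_def by (rule cocone_tcocone(2)[OF X B \<theta>])
    note d = descend[where g = \<Theta>, OF X Ob_UMetD[OF B] tcoconeD(1)[OF \<Theta>] tcocone_le[OF X Ob_UMetD[OF B] \<Theta>]]
    let ?u = "\<lambda>z\<in>pts (TO X). \<Theta> (rep X z)"
    have u: "?u \<in> nonexpanding (FO (endo monad) X) B" using d(1) X by simp
    have "?u (FM (endo monad) N X \<phi> z) = \<theta> N \<phi> z"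
      if N: "N \<in> Ob Set_fp" and \<phi>: "\<phi> \<in> nonexpanding N X" and z: "z \<in> pts (FO (endo monad) N)" for N \<phi> z
    proof -
      note N' = Set_fp_UMet[OF N]
      have "z \<in> pts (TO N)" using z N' by simp
      then obtain s where s: "s \<in> tms \<Sigma> (pts N)" "z = ev N s" by (rule TO_cases[OF N'])
      have m: "tmap \<phi> s \<in> tms \<Sigma> (pts X)" by (rule tmap_tms[OF s(1)]) (rule nonexpanding_pts[OF \<phi>])
      have "?u (ev X (tmap \<phi> s)) = \<Theta> (tmap \<phi> s)" using d(2) m by blast
      then show ?thesis using key[OF N \<phi> s(1)] TMap_ev[OF N' X \<phi> s(1)] s(2) N' X \<phi> by simp
    qed
    then show "\<exists>u\<in>nonexpanding (FO (endo monad) X) B. \<forall>N\<in>Ob Set_fp. \<forall>\<phi>\<in>nonexpanding N X.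
        \<forall>s\<in>pts (FO (endo monad) N). u (FM (endo monad) N X \<phi> s) = \<theta> N \<phi> s"
      using u by blast
  qed
qed

end

lemma (in universe) variety_represented:
  assumes "finitary_variety (V :: 'u variety)"
  shows "\<exists>M\<in>Ob Mon_sf. \<exists>s. represents V M s"
proof -
  obtain \<Sigma> C where V: "V = (\<Sigma>, C)" by (cases V)
  with assms obtain E where "signature \<Sigma>" "E \<subseteq> quant_eqs \<Sigma>"
    and C: "C = {A \<in> Ob (Sigma_UMet \<Sigma>). \<forall>e\<in>E. satisfies A e}"
    by (auto simp: finitary_variety_def)
  then interpret equational_theory u \<Sigma> E by unfold_locales
  have "V = (\<Sigma>, Alg)" by (simp add: V C Alg_def)
  moreover have "monad \<in> Ob Mon_sf" using monad_enriched monad_strongly_finitary by (simp add: Mon_sf_simps)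
  ultimately show ?thesis using represents_monad by blast
qed


section \<open>The variety of a strongly finitary monad\<close>

locale finitary_monad = universe u + umonad M for u :: "'u itself" and M :: "('u emetric, 'u \<Rightarrow> 'u) mnd" +
  assumes sf: "strongly_finitary (endo M)"
begin

section \<open>Standard finite spaces and points as applied operations\<close>

definition pt :: "nat \<Rightarrow> 'u"
  where "pt = (SOME e. inj e)"

lemma inj_pt: "inj pt"
proof -
  have "\<exists>e :: nat \<Rightarrow> 'u. inj e"
    using infinite_countable_subset[OF infinite_UNIV_u] by blast
  then show ?thesis unfolding pt_def by (rule someI_ex)
qed

definition ix :: "'u \<Rightarrow> nat"
  where "ix = inv pt"

lemma ix_pt [simp]: "ix (pt i) = i"
  by (simp add: ix_def inj_pt)

text \<open>The standard discrete space with n points. A list of length n is the same as a map out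
  of it, which turns points of \<open>T (node n)\<close> into n-ary operations.\<close>

definition node :: "nat \<Rightarrow> 'u emetric"
  where "node n = disc (pt ` {..<n})"

lemma pts_node [simp]: "pts (node n) = pt ` {..<n}"
  by (simp add: node_def)

lemma node_Set_fp [simp]: "node n \<in> Ob Set_fp"
  unfolding node_def by (rule disc_Ob_Set_fp) simp

lemma node_UMet [simp]: "node n \<in> Ob UMet"
  by (rule Set_fp_UMet) simp

definition tuple :: "'u list \<Rightarrow> 'u \<Rightarrow> 'u"
  where "tuple xs = (\<lambda>p\<in>pt ` {..<length xs}. xs ! ix p)"

lemma tuple_pt [simp]: "i < length xs \<Longrightarrow> tuple xs (pt i) = xs ! i"
  by (simp add: tuple_def)

lemma tuple_in:
  assumes "X \<in> Ob UMet" "set xs \<subseteq> pts X" "length xs = n"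
  shows "tuple xs \<in> nonexpanding (node n) X"
  using assms nth_mem unfolding node_def nonexpanding_disc[OF assms(1)] by (fastforce simp: tuple_def PiE_iff)

lemma compose_tuple:
  assumes n: "length xs = n" shows "compose (pts (node n)) f (tuple xs) = tuple (map f xs)"
  unfolding tuple_def compose_def pts_node length_map n by (rule restrict_ext) (auto simp: n)

lemma TM_tuple:
  assumes X: "X \<in> Ob UMet" and Y: "Y \<in> Ob UMet" and f: "f \<in> nonexpanding X Y"
    and xs: "length xs = n" "set xs \<subseteq> pts X" and \<sigma>: "\<sigma> \<in> pts (T (node n))"
  shows "TM X Y f (TM (node n) X (tuple xs) \<sigma>) = TM (node n) Y (tuple (map f xs)) \<sigma>"
  using FM_comp[OF node_UMet X Y tuple_in[OF X xs(2,1)] f \<sigma>] compose_tuple[OF xs(1)] by simp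

definition enum :: "'u emetric \<Rightarrow> 'u list"
  where "enum N = (SOME l. set l = pts N)"

lemma set_enum: "N \<in> Ob Set_fp \<Longrightarrow> set (enum N) = pts N"
  unfolding enum_def by (rule someI_ex) (use finite_list in \<open>auto simp: Ob_Set_fp\<close>)

definition index :: "'u list \<Rightarrow> 'u \<Rightarrow> nat"
  where "index l x = (SOME i. i < length l \<and> l ! i = x)"

lemma index: "x \<in> set l \<Longrightarrow> index l x < length l \<and> l ! index l x = x"
  unfolding index_def by (rule someI_ex) (auto simp: in_set_conv_nth)

text \<open>A section of \<open>tuple l\<close> when \<open>l\<close> enumerates the points of
  \<open>N\<close>. The enumeration may repeat points, so \<open>N\<close> is exhibited only as a
  retract of a standard space, which is all that is used.\<close>

definition locate :: "'u emetric \<Rightarrow> 'u list \<Rightarrow> 'u \<Rightarrow> 'u"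
  where "locate N l = (\<lambda>x\<in>pts N. pt (index l x))"

lemma locate_in:
  assumes "N \<in> Ob Set_fp" "pts N \<subseteq> set l"
  shows "locate N l \<in> nonexpanding N (node (length l))"
  using assms index by (auto simp: nonexpanding_Set_fp locate_def PiE_iff subset_iff)

text \<open>Strong finitariness supplies a preimage over some finite discrete \<open>N\<close>; it
  is moved to a standard space along \<open>locate\<close>, through which every map out of
  \<open>N\<close> factors.\<close>

lemma generated:
  assumes X: "X \<in> Ob UMet" and z: "z \<in> pts (T X)"
  shows "\<exists>xs \<sigma>. set xs \<subseteq> pts X \<and> \<sigma> \<in> pts (T (node (length xs))) \<and> z = TM (node (length xs)) X (tuple xs) \<sigma>"
proof -
  obtain N \<phi> s where N: "N \<in> Ob Set_fp" and \<phi>: "\<phi> \<in> nonexpanding N X" and s: "s \<in> pts (T N)"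
    and z: "z = TM N X \<phi> s"
    using strongly_finitary_generated[OF sf X z] by blast
  note N' = Set_fp_UMet[OF N]
  let ?l = "enum N" and ?xs = "map \<phi> (enum N)"
  have l: "pts N \<subseteq> set ?l" and xs: "set ?xs \<subseteq> pts X"
    using set_enum[OF N] nonexpanding_pts[OF \<phi>] by auto
  note g = locate_in[OF N l]
  have t: "tuple ?xs \<in> nonexpanding (node (length ?l)) X" using xs by (intro tuple_in X) auto
  have "\<phi> = compose (pts N) (tuple ?xs) (locate N ?l)"
  proof (rule nonexpanding_eqI[OF \<phi> nonexpanding_compose[OF g t]])
    fix x assume x: "x \<in> pts N"
    then have "index ?l x < length ?l \<and> ?l ! index ?l x = x" using l by (intro index) auto
    then show "\<phi> x = compose (pts N) (tuple ?xs) (locate N ?l) x" using x by (simp add: compose_eq locate_def)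
  qed
  then have "z = TM (node (length ?l)) X (tuple ?xs) (TM N (node (length ?l)) (locate N ?l) s)"
    using FM_comp[OF N' node_UMet X g t s] z by simp
  moreover have "TM N (node (length ?l)) (locate N ?l) s \<in> pts (T (node (length ?l)))"
    by (rule FM_pts[OF N' node_UMet g s])
  ultimately show ?thesis using xs by (metis length_map)
qed

text \<open>Each entry of \<open>xs\<close> occurs in \<open>ys\<close>, so \<open>tuple xs\<close>
  factors through \<open>tuple ys\<close>, and the operation is transported along the map of
  positions.\<close>

lemma generated_mono:
  assumes X: "X \<in> Ob UMet" and ys: "set ys \<subseteq> pts X" "set xs \<subseteq> set ys"
    and \<sigma>: "\<sigma> \<in> pts (T (node (length xs)))"
  shows "\<exists>\<tau>\<in>pts (T (node (length ys))). TM (node (length xs)) X (tuple xs) \<sigma> = TM (node (length ys)) X (tuple ys) \<tau>"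
proof -
  let ?n = "length xs" and ?m = "length ys"
  define g where "g = tuple (map (\<lambda>x. pt (index ys x)) xs)"
  have i: "index ys (xs ! i) < ?m" "ys ! index ys (xs ! i) = xs ! i" if "i < ?n" for i
    using index[of "xs ! i" ys] nth_mem[OF that] ys by auto
  have g: "g \<in> nonexpanding (node ?n) (node ?m)"
    unfolding g_def using i by (intro tuple_in) (auto simp: in_set_conv_nth)
  have t: "tuple xs \<in> nonexpanding (node ?n) X" "tuple ys \<in> nonexpanding (node ?m) X"
    using ys by (auto intro!: tuple_in X)
  have "tuple xs = compose (pts (node ?n)) (tuple ys) g"
    by (rule nonexpanding_eqI[OF t(1) nonexpanding_compose[OF g t(2)]]) (auto simp: compose_eq g_def i)
  then have "TM (node ?n) X (tuple xs) \<sigma> = TM (node ?m) X (tuple ys) (TM (node ?n) (node ?m) g \<sigma>)"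
    using FM_comp[OF node_UMet node_UMet X g t(2) \<sigma>] by simp
  then show ?thesis using FM_pts[OF node_UMet node_UMet g \<sigma>] by blast
qed

text \<open>Concatenating the argument lists of all entries gives common arguments. This puts a
  point of \<open>T (T X)\<close> into the form to which the substitution law \<open>opn_mu\<close>
  applies.\<close>

lemma generated_list:
  assumes X: "X \<in> Ob UMet" and zs: "set zs \<subseteq> pts (T X)"
  shows "\<exists>ys \<sigma>s. set ys \<subseteq> pts X \<and> set \<sigma>s \<subseteq> pts (T (node (length ys))) \<and>
    zs = map (TM (node (length ys)) X (tuple ys)) \<sigma>s"
proof -
  have "\<forall>z\<in>set zs. \<exists>xs. set xs \<subseteq> pts X \<and> (\<exists>\<sigma>\<in>pts (T (node (length xs))). z = TM (node (length xs)) X (tuple xs) \<sigma>)"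
    using generated[OF X] zs by blast
  then obtain f where f: "\<And>z. z \<in> set zs \<Longrightarrow> set (f z) \<subseteq> pts X"
    "\<And>z. z \<in> set zs \<Longrightarrow> \<exists>\<sigma>\<in>pts (T (node (length (f z)))). z = TM (node (length (f z))) X (tuple (f z)) \<sigma>"
    by metis
  define ys where "ys = concat (map f zs)"
  have ys: "set ys \<subseteq> pts X" using f(1) by (auto simp: ys_def)
  have "z \<in> TM (node (length ys)) X (tuple ys) ` pts (T (node (length ys)))" if z: "z \<in> set zs" for z
  proof -
    obtain \<sigma> where \<sigma>: "\<sigma> \<in> pts (T (node (length (f z))))" and e: "z = TM (node (length (f z))) X (tuple (f z)) \<sigma>"
      using f(2)[OF z] by blast
    have "set (f z) \<subseteq> set ys" using z by (auto simp: ys_def)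
    from generated_mono[OF X ys this \<sigma>] show ?thesis unfolding e[symmetric] by blast
  qed
  then have "set zs \<subseteq> TM (node (length ys)) X (tuple ys) ` pts (T (node (length ys)))" by blast
  from list_preimage[OF this] show ?thesis using ys by blast
qed

lemma generated_eqI:
  assumes X: "X \<in> Ob UMet" and a: "a \<in> nonexpanding (T X) Y" and b: "b \<in> nonexpanding (T X) Z"
    and e: "\<And>xs \<sigma>. set xs \<subseteq> pts X \<Longrightarrow> \<sigma> \<in> pts (T (node (length xs))) \<Longrightarrow>
      a (TM (node (length xs)) X (tuple xs) \<sigma>) = b (TM (node (length xs)) X (tuple xs) \<sigma>)"
  shows "a = b"
proof (rule nonexpanding_eqI[OF a b])
  fix z assume "z \<in> pts (T X)"
  from generated[OF X this] obtain xs \<sigma> where "set xs \<subseteq> pts X" "\<sigma> \<in> pts (T (node (length xs)))"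
    "z = TM (node (length xs)) X (tuple xs) \<sigma>" by (elim exE conjE)
  then show "a z = b z" using e by simp
qed

section \<open>The signature and the equations of a monad\<close>

definition S :: "(nat \<times> 'u) set"
  where "S = (SIGMA n:UNIV. pts (T (node n)))"

text \<open>Operations are pairs of an arity and a point, but symbols must have type
  \<open>'u\<close>; \<open>S\<close> is a countable union of small sets, hence can be coded
  there.\<close>

definition encode :: "nat \<times> 'u \<Rightarrow> 'u"
  where "encode = (SOME c. inj_on c S \<and> small (c ` S))"

lemma encode: "inj_on encode S" "small (encode ` S)"
proof -
  have "lessU (pts (T (node n)))" for n
    using FO_Ob[OF node_UMet, of n] by (simp add: Ob_UMet small_iff_lessU)
  then have "lessU S" unfolding S_def by (rule lessU_Sigma[OF lessU_countable[OF countableI_type]])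
  then obtain c :: "nat \<times> 'u \<Rightarrow> 'u" where "inj_on c S" "small (c ` S)" by (rule lessU_inject)
  then have "\<exists>c :: nat \<times> 'u \<Rightarrow> 'u. inj_on c S \<and> small (c ` S)" by (intro exI[of _ c] conjI)
  then have "inj_on encode S \<and> small (encode ` S)" unfolding encode_def by (rule someI_ex)
  then show "inj_on encode S" "small (encode ` S)" by auto
qed

definition \<Sigma> :: "'u sig"
  where "\<Sigma> = \<lparr>symbols = encode ` S, arity = (\<lambda>s\<in>encode ` S. fst (inv_into S encode s))\<rparr>"

lemma symbol [simp]: "\<sigma> \<in> pts (T (node n)) \<Longrightarrow> encode (n, \<sigma>) \<in> symbols \<Sigma>"
  by (auto simp: \<Sigma>_def S_def)

lemma inv_encode [simp]: "\<sigma> \<in> pts (T (node n)) \<Longrightarrow> inv_into S encode (encode (n, \<sigma>)) = (n, \<sigma>)"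
  by (rule inv_into_f_f[OF encode(1)]) (simp add: S_def)

lemma arity [simp]: "\<sigma> \<in> pts (T (node n)) \<Longrightarrow> arity \<Sigma> (encode (n, \<sigma>)) = n"
proof -
  assume \<sigma>: "\<sigma> \<in> pts (T (node n))"
  then have "(n, \<sigma>) \<in> S" by (simp add: S_def)
  then show ?thesis using inv_encode[OF \<sigma>] by (simp add: \<Sigma>_def)
qed

lemma symbol_cases:
  assumes "s \<in> symbols \<Sigma>" obtains n \<sigma> where "\<sigma> \<in> pts (T (node n))" "s = encode (n, \<sigma>)"
  using assms by (auto simp: \<Sigma>_def S_def)

lemma signature_\<Sigma>: "signature \<Sigma>"
  using encode(2) by (simp add: signature_def \<Sigma>_def)

definition alg :: "'u emetric \<Rightarrow> ('u \<Rightarrow> 'u) \<Rightarrow> ('u, 'u) alg"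
  where "alg X a = mk_alg \<Sigma> X
    (\<lambda>s xs. a (TM (node (length xs)) X (tuple xs) (snd (inv_into S encode s))))"

lemma underlying_alg [simp]: "underlying (alg X a) = X"
  by (simp add: alg_def)

lemma opn_alg:
  assumes "\<sigma> \<in> pts (T (node n))" "length xs = n" "set xs \<subseteq> pts X"
  shows "opn (alg X a) (encode (n, \<sigma>)) xs = a (TM (node n) X (tuple xs) \<sigma>)"
  using assms unfolding alg_def by (subst opn_mk_alg) auto

lemma EM_D:
  assumes "(X, a) \<in> EM M"
  shows "X \<in> Ob UMet" "a \<in> nonexpanding (T X) X" "x \<in> pts X \<Longrightarrow> a (eta M X x) = x"
    "t \<in> pts (T (T X)) \<Longrightarrow> a (mu M X t) = a (TM (T X) X a t)"
  using assms by (auto simp: EM_def)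

text \<open>Two argument lists are two maps out of a discrete space. Enrichment of the functor
  bounds the distance of their effects on a fixed operation by their supremum distance, which is the
  maximum metric on lists.\<close>

lemma alg_Ob:
  assumes EM: "(X, a) \<in> EM M" shows "alg X a \<in> Ob (Sigma_UMet \<Sigma>)"
proof -
  note X = EM_D(1)[OF EM] and a = EM_D(2)[OF EM]
  have "ultra_algebra \<Sigma> (alg X a)"
    unfolding alg_def
  proof (rule ultra_algebra_mk_alg[OF Ob_UMetD[OF X]])
    fix s xs assume s: "s \<in> symbols \<Sigma>" and xs: "length xs = arity \<Sigma> s" "set xs \<subseteq> pts X"
    from s obtain n \<sigma> where \<sigma>: "\<sigma> \<in> pts (T (node n))" "s = encode (n, \<sigma>)" by (rule symbol_cases)
    have n: "length xs = n" using xs \<sigma> by simp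
    note t = tuple_in[OF X xs(2) n]
    note p = FM_pts[OF node_UMet X t \<sigma>(1)]
    show "a (TM (node (length xs)) X (tuple xs) (snd (inv_into S encode s))) \<in> pts X"
      using nonexpanding_pts[OF a p] \<sigma> n by simp
    fix ys c assume ys: "length ys = arity \<Sigma> s" "set ys \<subseteq> pts X"
      and c: "\<And>i. i < arity \<Sigma> s \<Longrightarrow> dst X (xs ! i) (ys ! i) \<le> c"
    have m: "length ys = n" using ys \<sigma> by simp
    note t' = tuple_in[OF X ys(2) m]
    note p' = FM_pts[OF node_UMet X t' \<sigma>(1)]
    have "dst X (a (TM (node n) X (tuple xs) \<sigma>)) (a (TM (node n) X (tuple ys) \<sigma>))
        \<le> dst (T X) (TM (node n) X (tuple xs) \<sigma>) (TM (node n) X (tuple ys) \<sigma>)"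
      by (rule nonexpanding_le[OF a p p'])
    also have "\<dots> \<le> sup_dist (node n) X (tuple xs) (tuple ys)" by (rule FM_le[OF node_UMet X t t' \<sigma>(1)])
    also have "\<dots> \<le> c" using c \<sigma> n m by (intro sup_dist_le) auto
    finally show "dst X (a (TM (node (length xs)) X (tuple xs) (snd (inv_into S encode s))))
       (a (TM (node (length ys)) X (tuple ys) (snd (inv_into S encode s)))) \<le> c"
      using \<sigma> n m by simp
  qed
  then show ?thesis using X by (simp add: Ob_Sigma_UMet Ob_UMet)
qed

text \<open>The full quantitative theory of the Eilenberg-Moore algebras, in place of an axiom list:
  any property expressible by equations passes from these algebras to all models. The instances
  needed below express the metric of \<open>T (node n)\<close>, reindexing, projections and
  substitution.\<close>

definition E :: "'u quant_eq set"
  where "E = {e \<in> quant_eqs \<Sigma>. \<forall>(X, a)\<in>EM M. satisfies (alg X a) e}"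

definition Mod :: "('u, 'u) alg set"
  where "Mod = {A \<in> Ob (Sigma_UMet \<Sigma>). \<forall>e\<in>E. satisfies A e}"

lemma alg_Mod: "(X, a) \<in> EM M \<Longrightarrow> alg X a \<in> Mod"
  using alg_Ob unfolding Mod_def E_def by auto

lemma Mod_ultra: "A \<in> Mod \<Longrightarrow> ultra_algebra \<Sigma> A"
  by (simp add: Mod_def Ob_Sigma_UMet)

lemma Mod_UMet: "A \<in> Mod \<Longrightarrow> underlying A \<in> Ob UMet"
  by (auto simp: Mod_def Ob_Sigma_UMet Ob_UMet ultra_algebra_def)

abbreviation "app n \<sigma> ts \<equiv> Fn (encode (n, \<sigma>)) ts"
abbreviation "basic n \<sigma> \<equiv> app n \<sigma> (map Vr [0..<n])"

lemma app_terms: "\<sigma> \<in> pts (T (node n)) \<Longrightarrow> length ts = n \<Longrightarrow> set ts \<subseteq> terms \<Sigma> \<Longrightarrow> app n \<sigma> ts \<in> terms \<Sigma>"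
  by (rule terms.Fn) auto

lemma basic_terms: "\<sigma> \<in> pts (T (node n)) \<Longrightarrow> basic n \<sigma> \<in> terms \<Sigma>"
  by (rule app_terms) (auto intro: terms.Vr)

text \<open>The point \<open>p\<close> extends the finite list of values to all variables.\<close>

lemma Mod_le:
  assumes A: "A \<in> Mod" and lr: "l \<in> terms \<Sigma>" "r \<in> terms \<Sigma>" and "0 \<le> \<epsilon>"
    and EM: "\<And>X a v. (X, a) \<in> EM M \<Longrightarrow> (\<And>i :: nat. v i \<in> pts X) \<Longrightarrow>
      dst X (term_ext (alg X a) v l) (term_ext (alg X a) v r) \<le> ennreal (real_of_rat \<epsilon>)"
    and xs: "set xs \<subseteq> pts (underlying A)" and p: "p \<in> pts (underlying A)"
  defines "v \<equiv> \<lambda>i. if i < length xs then xs ! i else p"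
  shows "dst (underlying A) (term_ext A v l) (term_ext A v r) \<le> ennreal (real_of_rat \<epsilon>)"
proof -
  have "satisfies (alg X a) (l, \<epsilon>, r)" if "(X, a) \<in> EM M" for X a
    unfolding satisfies_def using EM[OF that] by (simp add: image_subset_iff)
  then have "(l, \<epsilon>, r) \<in> E" unfolding E_def quant_eqs_def using lr assms(4) by auto
  then have "satisfies A (l, \<epsilon>, r)" using A unfolding Mod_def by blast
  moreover have "range v \<subseteq> pts (underlying A)" using xs p nth_mem by (fastforce simp: v_def)
  ultimately show ?thesis unfolding satisfies_def by blast
qed

section \<open>Consequences of the equations in all models\<close>

lemma map_default: "map (\<lambda>i. if i < length xs then xs ! i else p) [0..<length xs] = xs"
  by (intro nth_equalityI) auto

lemma opn_Mod: "\<lbrakk>A \<in> Mod; \<sigma> \<in> pts (T (node n)); length xs = n; set xs \<subseteq> pts (underlying A)\<rbrakk> \<Longrightarrow>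
    opn A (encode (n, \<sigma>)) xs \<in> pts (underlying A)"
  by (rule opn_pts[OF Mod_ultra]) auto

text \<open>For each rational \<epsilon> above the distance of \<sigma> and \<tau>, the equation
  between the two basic terms with bound \<epsilon> is valid in all Eilenberg-Moore algebras, since
  structure maps are nonexpanding. The distance itself may be irrational, so the bound is reached by
  density.\<close>

lemma opn_dist:
  assumes A: "A \<in> Mod" and \<sigma>: "\<sigma> \<in> pts (T (node n))" and \<tau>: "\<tau> \<in> pts (T (node n))"
    and xs: "length xs = n" "set xs \<subseteq> pts (underlying A)"
  shows "dst (underlying A) (opn A (encode (n, \<sigma>)) xs) (opn A (encode (n, \<tau>)) xs) \<le> dst (T (node n)) \<sigma> \<tau>"
proof (rule ccontr)
  assume "\<not> ?thesis"
  then obtain \<epsilon> :: rat where 1: "dst (T (node n)) \<sigma> \<tau> < ennreal (real_of_rat \<epsilon>)"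
    and 2: "ennreal (real_of_rat \<epsilon>) < dst (underlying A) (opn A (encode (n, \<sigma>)) xs) (opn A (encode (n, \<tau>)) xs)"
    using ennreal_rat_dense not_le by metis
  have "0 \<le> \<epsilon>"
  \<comment> \<open>\<open>ennreal\<close> sends negative numbers to 0, so a negative rational would
    not lie strictly above a distance.\<close>
  proof (rule ccontr)
    assume "\<not> 0 \<le> \<epsilon>"
    then have "ennreal (real_of_rat \<epsilon>) = 0" by (simp add: ennreal_neg)
    then show False using 1 by simp
  qed
  note p = opn_Mod[OF A \<sigma> xs]
  have "dst X (term_ext (alg X a) v (basic n \<sigma>)) (term_ext (alg X a) v (basic n \<tau>)) \<le> ennreal (real_of_rat \<epsilon>)"
    if EM: "(X, a) \<in> EM M" and v: "\<And>i. v i \<in> pts X" for X a v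
  proof -
    let ?ys = "map v [0..<n]"
    have ys: "length ?ys = n" "set ?ys \<subseteq> pts X" using v by auto
    note X = EM_D(1)[OF EM]
    note t = tuple_in[OF X ys(2,1)]
    have "dst X (a (TM (node n) X (tuple ?ys) \<sigma>)) (a (TM (node n) X (tuple ?ys) \<tau>)) \<le> dst (T (node n)) \<sigma> \<tau>"
      by (intro order_trans[OF nonexpanding_le[OF EM_D(2)[OF EM]] nonexpanding_le[OF FM_in[OF node_UMet X t]]]
          FM_pts[OF node_UMet X t] \<sigma> \<tau>)
    then show ?thesis using 1 ys by (simp add: opn_alg[OF \<sigma> ys] opn_alg[OF \<tau> ys] o_def)
  qed
  from Mod_le[OF A basic_terms[OF \<sigma>] basic_terms[OF \<tau>] \<open>0 \<le> \<epsilon>\<close> this xs(2) p]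
  have "dst (underlying A) (opn A (encode (n, \<sigma>)) xs) (opn A (encode (n, \<tau>)) xs) \<le> ennreal (real_of_rat \<epsilon>)"
    using map_default[of xs] xs(1) by (simp add: o_def)
  then show False using 2 by simp
qed

text \<open>An ordinary equation is a quantitative one with bound 0, because distance 0 means
  equality.\<close>

lemma Mod_eq:
  assumes A: "A \<in> Mod" and lr: "l \<in> terms \<Sigma>" "r \<in> terms \<Sigma>"
    and EM: "\<And>X a v. (X, a) \<in> EM M \<Longrightarrow> (\<And>i :: nat. v i \<in> pts X) \<Longrightarrow>
      term_ext (alg X a) v l \<in> pts X \<and> term_ext (alg X a) v l = term_ext (alg X a) v r"
    and xs: "set xs \<subseteq> pts (underlying A)" and p: "p \<in> pts (underlying A)"
  defines "v \<equiv> \<lambda>i. if i < length xs then xs ! i else p"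
  shows "term_ext A v l = term_ext A v r"
proof -
  have "dst (underlying A) (term_ext A v l) (term_ext A v r) \<le> ennreal (real_of_rat 0)"
    unfolding v_def
    using EM ultra_refl[OF Ob_UMetD[OF EM_D(1)]]
    by (intro Mod_le[OF A lr _ _ xs p]) (simp, metis of_rat_0 ennreal_0 order_refl)
  moreover have "range v \<subseteq> pts (underlying A)" using xs p nth_mem by (fastforce simp: v_def)
  then have "term_ext A v t \<in> pts (underlying A)" if "t \<in> terms \<Sigma>" for t
    unfolding term_ext_eval by (intro eval_pts[OF Mod_ultra[OF A] conv_tms[OF that]]) auto
  ultimately show ?thesis using lr by (intro ultra_zero_eq[OF Ob_UMetD[OF Mod_UMet[OF A]]]) auto
qed

text \<open>In an Eilenberg-Moore algebra this is functoriality of \<open>T\<close>: the reindexed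
  argument list, as a map out of \<open>node n\<close>, is the original one composed with
  \<open>g\<close>.\<close>

lemma opn_reindex:
  assumes A: "A \<in> Mod" and \<sigma>: "\<sigma> \<in> pts (T (node n))" and g: "g \<in> nonexpanding (node n) (node m)"
    and xs: "length xs = m" "set xs \<subseteq> pts (underlying A)"
  shows "opn A (encode (n, \<sigma>)) (map (\<lambda>i. xs ! ix (g (pt i))) [0..<n]) = opn A (encode (m, TM (node n) (node m) g \<sigma>)) xs"
proof -
  let ?\<tau> = "TM (node n) (node m) g \<sigma>"
  have \<tau>: "?\<tau> \<in> pts (T (node m))" by (rule FM_pts[OF node_UMet node_UMet g \<sigma>])
  have gm: "ix (g (pt i)) < m" "pt (ix (g (pt i))) = g (pt i)" if "i < n" for i
    using nonexpanding_pts[OF g, of "pt i"] that by auto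
  let ?l = "app n \<sigma> (map (\<lambda>i. Vr (ix (g (pt i)))) [0..<n])" and ?r = "basic m ?\<tau>"
  have l: "?l \<in> terms \<Sigma>" by (rule app_terms[OF \<sigma>]) (auto intro: terms.Vr)
  have "term_ext (alg X a) v ?l \<in> pts X \<and> term_ext (alg X a) v ?l = term_ext (alg X a) v ?r"
    if EM: "(X, a) \<in> EM M" and v: "\<And>i. v i \<in> pts X" for X a v
  proof -
    let ?zs = "map (\<lambda>i. v (ix (g (pt i)))) [0..<n]" and ?ys = "map v [0..<m]"
    have zs: "length ?zs = n" "set ?zs \<subseteq> pts X" and ys: "length ?ys = m" "set ?ys \<subseteq> pts X" using v by auto
    note X = EM_D(1)[OF EM]
    note t = tuple_in[OF X zs(2,1)] and t' = tuple_in[OF X ys(2,1)]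
    have "tuple ?zs = compose (pts (node n)) (tuple ?ys) g"
    proof (rule nonexpanding_eqI[OF t nonexpanding_compose[OF g t']])
      fix p assume "p \<in> pts (node n)"
      then obtain i where i: "i < n" "p = pt i" by auto
      have "tuple ?ys (pt (ix (g (pt i)))) = v (ix (g (pt i)))" using gm(1)[OF i(1)] by simp
      then show "tuple ?zs p = compose (pts (node n)) (tuple ?ys) g p" using i gm(2)[OF i(1)] by (simp add: compose_eq)
    qed
    then have "a (TM (node n) X (tuple ?zs) \<sigma>) = a (TM (node m) X (tuple ?ys) ?\<tau>)"
      using FM_comp[OF node_UMet node_UMet X g t' \<sigma>] by simp
    moreover have "a (TM (node n) X (tuple ?zs) \<sigma>) \<in> pts X"
      by (rule nonexpanding_pts[OF EM_D(2)[OF EM] FM_pts[OF node_UMet X t \<sigma>]])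
    ultimately show ?thesis using opn_alg[OF \<sigma> zs] opn_alg[OF \<tau> ys] by (simp add: o_def)
  qed
  note e = Mod_eq[OF A l basic_terms[OF \<tau>] this xs(2) opn_Mod[OF A \<tau> xs]]
  define q where "q = opn A (encode (m, ?\<tau>)) xs"
  have e': "opn A (encode (n, \<sigma>)) (map (\<lambda>i. if ix (g (pt i)) < length xs then xs ! ix (g (pt i)) else q) [0..<n]) =
      opn A (encode (m, ?\<tau>)) (map (\<lambda>i. if i < length xs then xs ! i else q) [0..<m])"
    using e unfolding q_def[symmetric] by (simp add: o_def)
  have "map (\<lambda>i. if ix (g (pt i)) < length xs then xs ! ix (g (pt i)) else q) [0..<n] = map (\<lambda>i. xs ! ix (g (pt i))) [0..<n]"
    using gm xs by simp
  moreover have "map (\<lambda>i. if i < length xs then xs ! i else q) [0..<m] = xs"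
    using map_default[of xs q] xs(1) by simp
  ultimately show ?thesis using e' by (simp only:)
qed

text \<open>The unit at the point \<open>pt i\<close> acts as the i-th projection, by naturality of
  the unit and the unit law of the algebra.\<close>

lemma opn_eta:
  assumes A: "A \<in> Mod" and i: "i < length xs" and xs: "set xs \<subseteq> pts (underlying A)"
  shows "opn A (encode (length xs, eta M (node (length xs)) (pt i))) xs = xs ! i"
proof -
  let ?n = "length xs"
  let ?\<tau> = "eta M (node ?n) (pt i)"
  have pi: "pt i \<in> pts (node ?n)" using i by simp
  have \<tau>: "?\<tau> \<in> pts (T (node ?n))" by (rule eta_pts[OF node_UMet pi])
  have "term_ext (alg X a) v (basic ?n ?\<tau>) \<in> pts X \<and> term_ext (alg X a) v (basic ?n ?\<tau>) = term_ext (alg X a) v (Vr i)"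
    if EM: "(X, a) \<in> EM M" and v: "\<And>i. v i \<in> pts X" for X a v
  proof -
    let ?ys = "map v [0..<?n]"
    have ys: "length ?ys = ?n" "set ?ys \<subseteq> pts X" using v by auto
    note X = EM_D(1)[OF EM]
    have "a (TM (node ?n) X (tuple ?ys) ?\<tau>) = v i"
      using eta_nat[OF node_UMet X tuple_in[OF X ys(2,1)] pi] EM_D(3)[OF EM] v i by simp
    then show ?thesis using opn_alg[OF \<tau> ys] v by (simp add: o_def)
  qed
  from Mod_eq[OF A basic_terms[OF \<tau>] terms.Vr this xs opn_Mod[OF A \<tau> refl xs]]
  show ?thesis using map_default[of xs] i by (simp add: o_def)
qed

text \<open>The multiplication acts as substitution of the operations \<open>\<sigma>s\<close> into
  \<tau>. In an Eilenberg-Moore algebra this follows from naturality of the multiplication and the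
  associativity law; \<open>TM_tuple\<close> carries the list of operations through the two maps
  involved.\<close>

lemma opn_mu:
  assumes A: "A \<in> Mod" and \<tau>: "\<tau> \<in> pts (T (node k))"
    and \<sigma>s: "length \<sigma>s = k" "set \<sigma>s \<subseteq> pts (T (node (length xs)))"
    and xs: "set xs \<subseteq> pts (underlying A)"
  shows "opn A (encode (length xs, mu M (node (length xs)) (TM (node k) (T (node (length xs))) (tuple \<sigma>s) \<tau>))) xs
    = opn A (encode (k, \<tau>)) (map (\<lambda>\<sigma>. opn A (encode (length xs, \<sigma>)) xs) \<sigma>s)"
proof -
  define n where "n = length xs"
  have \<sigma>s': "set \<sigma>s \<subseteq> pts (T (node n))" using \<sigma>s by (simp add: n_def)
  note s = tuple_in[OF FO_Ob[OF node_UMet] \<sigma>s' \<sigma>s(1)]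
  let ?\<kappa> = "TM (node k) (T (node n)) (tuple \<sigma>s) \<tau>"
  let ?\<rho> = "mu M (node n) ?\<kappa>"
  have \<kappa>: "?\<kappa> \<in> pts (T (T (node n)))" by (rule FM_pts[OF node_UMet FO_Ob[OF node_UMet] s \<tau>])
  have \<rho>: "?\<rho> \<in> pts (T (node n))" by (rule mu_pts[OF node_UMet \<kappa>])
  let ?r = "app k \<tau> (map (basic n) \<sigma>s)"
  have r: "?r \<in> terms \<Sigma>" using \<sigma>s(1) \<sigma>s' basic_terms by (intro app_terms[OF \<tau>]) auto
  have "term_ext (alg X a) v (basic n ?\<rho>) \<in> pts X \<and> term_ext (alg X a) v (basic n ?\<rho>) = term_ext (alg X a) v ?r"
    if EM: "(X, a) \<in> EM M" and v: "\<And>i. v i \<in> pts X" for X a v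
  proof -
    let ?ys = "map v [0..<n]"
    have ys: "length ?ys = n" "set ?ys \<subseteq> pts X" using v by auto
    note X = EM_D(1)[OF EM] and a = EM_D(2)[OF EM]
    note t = tuple_in[OF X ys(2,1)]
    let ?\<phi> = "TM (node n) X (tuple ?ys)"
    note \<phi> = FM_in[OF node_UMet X t]
    let ?ws = "map (\<lambda>\<sigma>. a (?\<phi> \<sigma>)) \<sigma>s"
    have ws: "length ?ws = k" "set ?ws \<subseteq> pts X"
      using \<sigma>s(1) \<sigma>s' nonexpanding_pts[OF a nonexpanding_pts[OF \<phi>]] by auto
    have ps: "set (map ?\<phi> \<sigma>s) \<subseteq> pts (T X)" using \<sigma>s' nonexpanding_pts[OF \<phi>] by auto
    have "a (?\<phi> ?\<rho>) = a (mu M X (TM (T (node n)) (T X) ?\<phi> ?\<kappa>))"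
      using mu_nat[OF node_UMet X t \<kappa>] by simp
    also have "\<dots> = a (TM (T X) X a (TM (T (node n)) (T X) ?\<phi> ?\<kappa>))"
      by (rule EM_D(4)[OF EM FM_pts[OF FO_Ob[OF node_UMet] FO_Ob[OF X] \<phi> \<kappa>]])
    also have "TM (T (node n)) (T X) ?\<phi> ?\<kappa> = TM (node k) (T X) (tuple (map ?\<phi> \<sigma>s)) \<tau>"
      by (rule TM_tuple[OF FO_Ob[OF node_UMet] FO_Ob[OF X] \<phi> \<sigma>s(1) \<sigma>s' \<tau>])
    also have "TM (T X) X a \<dots> = TM (node k) X (tuple (map a (map ?\<phi> \<sigma>s))) \<tau>"
      by (rule TM_tuple[OF FO_Ob[OF X] X a _ ps \<tau>]) (simp add: \<sigma>s)
    also have "map a (map ?\<phi> \<sigma>s) = ?ws" by simp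
    finally have 1: "a (?\<phi> ?\<rho>) = a (TM (node k) X (tuple ?ws) \<tau>)" .
    have "term_ext (alg X a) v ?r = opn (alg X a) (encode (k, \<tau>)) (map (\<lambda>\<sigma>. opn (alg X a) (encode (n, \<sigma>)) ?ys) \<sigma>s)"
      by (simp add: o_def)
    also have "map (\<lambda>\<sigma>. opn (alg X a) (encode (n, \<sigma>)) ?ys) \<sigma>s = ?ws"
      using \<sigma>s' ys by (intro map_cong refl opn_alg) auto
    also have "opn (alg X a) (encode (k, \<tau>)) ?ws = a (TM (node k) X (tuple ?ws) \<tau>)" by (rule opn_alg[OF \<tau> ws])
    finally have 2: "term_ext (alg X a) v ?r = a (TM (node k) X (tuple ?ws) \<tau>)" .
    have "term_ext (alg X a) v (basic n ?\<rho>) = opn (alg X a) (encode (n, ?\<rho>)) ?ys" by (simp add: o_def)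
    also have "\<dots> = a (?\<phi> ?\<rho>)" by (rule opn_alg[OF \<rho> ys])
    finally have 3: "term_ext (alg X a) v (basic n ?\<rho>) = a (?\<phi> ?\<rho>)" .
    show ?thesis unfolding 2 3 using 1 nonexpanding_pts[OF a nonexpanding_pts[OF \<phi> \<rho>]] by simp
  qed
  from Mod_eq[OF A basic_terms[OF \<rho>] r this xs opn_Mod[OF A \<rho> n_def[symmetric] xs]]
  show ?thesis using map_default[of xs] unfolding n_def by (simp add: o_def)
qed

section \<open>From models of the theory to Eilenberg-Moore algebras\<close>

definition \<theta> :: "('u, 'u) alg \<Rightarrow> 'u emetric \<Rightarrow> ('u \<Rightarrow> 'u) \<Rightarrow> 'u \<Rightarrow> 'u"
  where "\<theta> A N \<phi> = (\<lambda>t\<in>pts (T N). opn A (encode (length (enum N), TM N (node (length (enum N))) (locate N (enum N)) t))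
    (map \<phi> (enum N)))"

text \<open>A point over \<open>N\<close> acts through its image in a standard space along
  \<open>locate\<close>. Nonexpansion in the point is \<open>opn_dist\<close>, nonexpansion in
  \<phi> is that of the operation, and naturality is \<open>opn_reindex\<close>.\<close>

lemma cocone_\<theta>:
  assumes A: "A \<in> Mod"
  shows "cocone (endo M) (underlying A) (underlying A) (\<theta> A)"
  unfolding cocone_def
proof (intro conjI ballI)
  fix N :: "'u emetric" and \<phi> assume N: "N \<in> Ob Set_fp" and \<phi>: "\<phi> \<in> nonexpanding N (underlying A)"
  define l where "l = enum N"
  define m where "m = length l"
  have l: "set l = pts N" unfolding l_def by (rule set_enum[OF N])
  note N' = Set_fp_UMet[OF N]
  have g: "locate N l \<in> nonexpanding N (node m)" unfolding m_def using N l by (intro locate_in) auto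
  note gt = FM_in[OF N' node_UMet g]
  have xs: "set (map \<phi> l) \<subseteq> pts (underlying A)" using l nonexpanding_pts[OF \<phi>] by auto
  have \<theta>: "\<theta> A N \<phi> t = opn A (encode (m, TM N (node m) (locate N l) t)) (map \<phi> l)" if "t \<in> pts (T N)" for \<phi> t
    using that by (simp add: \<theta>_def l_def m_def)
  show "\<theta> A N \<phi> \<in> nonexpanding (T N) (underlying A)"
  proof (rule nonexpandingI)
    show "\<theta> A N \<phi> \<in> extensional (pts (T N))" by (simp add: \<theta>_def)
    fix s t assume s: "s \<in> pts (T N)" and t: "t \<in> pts (T N)"
    show "\<theta> A N \<phi> s \<in> pts (underlying A)"
      unfolding \<theta>[OF s] by (rule opn_Mod[OF A nonexpanding_pts[OF gt s] _ xs]) (simp add: m_def)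
    show "dst (underlying A) (\<theta> A N \<phi> s) (\<theta> A N \<phi> t) \<le> dst (T N) s t"
      unfolding \<theta>[OF s] \<theta>[OF t]
      using opn_dist[OF A nonexpanding_pts[OF gt s] nonexpanding_pts[OF gt t] _ xs] nonexpanding_le[OF gt s t]
      by (simp add: m_def)
  qed
  fix \<psi> t assume \<psi>: "\<psi> \<in> nonexpanding N (underlying A)" and t: "t \<in> pts (T N)"
  show "dst (underlying A) (\<theta> A N \<phi> t) (\<theta> A N \<psi> t) \<le> sup_dist N (underlying A) \<phi> \<psi>"
    unfolding \<theta>[OF t]
  proof (rule opn_le[OF Mod_ultra[OF A] symbol[OF nonexpanding_pts[OF gt t]]])
    show "set (map \<psi> l) \<subseteq> pts (underlying A)" using l nonexpanding_pts[OF \<psi>] by auto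
    show "length (map \<phi> l) = arity \<Sigma> (encode (m, TM N (node m) (locate N l) t))"
      "length (map \<psi> l) = arity \<Sigma> (encode (m, TM N (node m) (locate N l) t))"
      using arity[OF nonexpanding_pts[OF gt t]] by (simp_all add: m_def)
    fix i assume "i < arity \<Sigma> (encode (m, TM N (node m) (locate N l) t))"
    then have "i < length l" using arity[OF nonexpanding_pts[OF gt t]] by (simp add: m_def)
    then show "dst (underlying A) (map \<phi> l ! i) (map \<psi> l ! i) \<le> sup_dist N (underlying A) \<phi> \<psi>"
      using le_sup_dist[of "l ! i" N "underlying A" \<phi> \<psi>] nth_mem[of i l] l by simp
  qed (use xs in auto)
next
  fix N N' :: "'u emetric" and f \<phi> t
  assume N: "N \<in> Ob Set_fp" "N' \<in> Ob Set_fp" and f: "f \<in> nonexpanding N N'"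
    and \<phi>: "\<phi> \<in> nonexpanding N' (underlying A)" and t: "t \<in> pts (T N)"
  note NU = N[THEN Set_fp_UMet]
  let ?l = "enum N" and ?l' = "enum N'"
  let ?m = "length ?l" and ?m' = "length ?l'"
  have l: "set ?l = pts N" and l': "set ?l' = pts N'" using set_enum N by auto
  have g: "locate N ?l \<in> nonexpanding N (node ?m)" "locate N' ?l' \<in> nonexpanding N' (node ?m')"
    using N l l' by (auto intro!: locate_in)
  have b: "tuple ?l \<in> nonexpanding (node ?m) N" using l by (intro tuple_in NU) auto
  \<comment> \<open>The map \<open>f\<close> transported to positions: it sends a position of
    \<open>?l\<close> to the point listed there, applies \<open>f\<close>, and locates the result in
    \<open>?l'\<close>. Since \<open>locate\<close> is a section of the enumeration,
    \<open>h\<close> after \<open>locate N ?l\<close> is \<open>locate N' ?l'\<close> after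
    \<open>f\<close>.\<close>
  define h where "h = compose (pts (node ?m)) (compose (pts N) (locate N' ?l') f) (tuple ?l)"
  have h: "h \<in> nonexpanding (node ?m) (node ?m')"
    unfolding h_def by (intro nonexpanding_compose[OF b] nonexpanding_compose[OF f] g)
  have lx: "index ?l x < ?m" "?l ! index ?l x = x" if "x \<in> pts N" for x using index[of x ?l] l that by auto
  have "compose (pts N) h (locate N ?l) = compose (pts N) (locate N' ?l') f"
    by (rule compose_eqI) (use lx in \<open>simp add: h_def compose_eq locate_def\<close>)
  then have e: "TM N' (node ?m') (locate N' ?l') (TM N N' f t) = TM (node ?m) (node ?m') h (TM N (node ?m) (locate N ?l) t)"
    using FM_comp[OF NU(1) node_UMet node_UMet g(1) h t] FM_comp[OF NU node_UMet f g(2) t] by simp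
  have xs: "set (map \<phi> ?l') \<subseteq> pts (underlying A)" using l' nonexpanding_pts[OF \<phi>] by auto
  have "map (\<lambda>i. map \<phi> ?l' ! ix (h (pt i))) [0..<?m] = map (compose (pts N) \<phi> f) ?l"
  proof (rule nth_equalityI)
    fix i assume "i < length (map (\<lambda>i. map \<phi> ?l' ! ix (h (pt i))) [0..<?m])"
    then have i: "i < ?m" by simp
    then have li: "?l ! i \<in> pts N" using l nth_mem by blast
    then have fi: "f (?l ! i) \<in> pts N'" by (rule nonexpanding_pts[OF f])
    have "index ?l' (f (?l ! i)) < ?m'" "?l' ! index ?l' (f (?l ! i)) = f (?l ! i)"
      using index[of "f (?l ! i)" ?l'] fi l' by auto
    then show "map (\<lambda>i. map \<phi> ?l' ! ix (h (pt i))) [0..<?m] ! i = map (compose (pts N) \<phi> f) ?l ! i"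
      using i li fi by (simp add: h_def compose_eq locate_def)
  qed simp
  then show "\<theta> A N (compose (pts N) \<phi> f) t = \<theta> A N' \<phi> (TM N N' f t)"
    using opn_reindex[OF A FM_pts[OF NU(1) node_UMet g(1) t] h _ xs] e t FM_pts[OF NU f t]
    by (simp add: \<theta>_def)
qed

text \<open>The chosen enumeration of a standard space may reorder or repeat its points; reindexing
  along \<open>locate\<close> undoes this.\<close>

lemma \<theta>_node:
  assumes A: "A \<in> Mod" and xs: "set xs \<subseteq> pts (underlying A)" and \<sigma>: "\<sigma> \<in> pts (T (node (length xs)))"
  shows "\<theta> A (node (length xs)) (tuple xs) \<sigma> = opn A (encode (length xs, \<sigma>)) xs"
proof -
  let ?n = "length xs"
  let ?l = "enum (node ?n)"
  have l: "set ?l = pts (node ?n)" by (rule set_enum) simp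
  have g: "locate (node ?n) ?l \<in> nonexpanding (node ?n) (node (length ?l))" using l by (intro locate_in) auto
  have ys: "set (map (tuple xs) ?l) \<subseteq> pts (underlying A)"
    using l nonexpanding_pts[OF tuple_in[OF Mod_UMet[OF A] xs refl]] by auto
  have "map (\<lambda>i. map (tuple xs) ?l ! ix (locate (node ?n) ?l (pt i))) [0..<?n] = xs"
  proof (rule nth_equalityI)
    fix i assume "i < length (map (\<lambda>i. map (tuple xs) ?l ! ix (locate (node ?n) ?l (pt i))) [0..<?n])"
    then have i: "i < ?n" by simp
    then have p: "pt i \<in> pts (node ?n)" by simp
    then have "index ?l (pt i) < length ?l" "?l ! index ?l (pt i) = pt i" using index[of "pt i" ?l] l by auto
    then show "map (\<lambda>i. map (tuple xs) ?l ! ix (locate (node ?n) ?l (pt i))) [0..<?n] ! i = xs ! i"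
      using i p by (simp add: locate_def)
  qed simp
  then show ?thesis
    using opn_reindex[OF A \<sigma> g _ ys] \<sigma> by (simp add: \<theta>_def)
qed

definition str :: "('u, 'u) alg \<Rightarrow> 'u \<Rightarrow> 'u"
  where "str A = (SOME a. a \<in> nonexpanding (T (underlying A)) (underlying A) \<and>
    (\<forall>xs \<sigma>. set xs \<subseteq> pts (underlying A) \<longrightarrow> \<sigma> \<in> pts (T (node (length xs))) \<longrightarrow>
      a (TM (node (length xs)) (underlying A) (tuple xs) \<sigma>) = opn A (encode (length xs, \<sigma>)) xs))"

text \<open>The operations form a cocone, so strong finitariness extends them to a single
  nonexpanding map on \<open>T (underlying A)\<close>, which realizes the choice in the
  definition.\<close>

lemma str:
  assumes A: "A \<in> Mod"
  shows str_in: "str A \<in> nonexpanding (T (underlying A)) (underlying A)"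
    and str_opn: "\<And>xs \<sigma>. set xs \<subseteq> pts (underlying A) \<Longrightarrow> \<sigma> \<in> pts (T (node (length xs))) \<Longrightarrow>
      str A (TM (node (length xs)) (underlying A) (tuple xs) \<sigma>) = opn A (encode (length xs, \<sigma>)) xs"
proof -
  let ?X = "underlying A"
  let ?P = "\<lambda>a. a \<in> nonexpanding (T ?X) ?X \<and>
    (\<forall>xs \<sigma>. set xs \<subseteq> pts ?X \<longrightarrow> \<sigma> \<in> pts (T (node (length xs))) \<longrightarrow>
      a (TM (node (length xs)) ?X (tuple xs) \<sigma>) = opn A (encode (length xs, \<sigma>)) xs)"
  note X = Mod_UMet[OF A]
  obtain a where a: "a \<in> nonexpanding (T ?X) ?X"
    and e: "\<forall>N\<in>Ob Set_fp. \<forall>\<phi>\<in>nonexpanding N ?X. \<forall>s\<in>pts (T N). a (TM N ?X \<phi> s) = \<theta> A N \<phi> s"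
    using strongly_finitary_extend[OF sf X X cocone_\<theta>[OF A]] by (elim bexE)
  have "a (TM (node (length xs)) ?X (tuple xs) \<sigma>) = opn A (encode (length xs, \<sigma>)) xs"
    if "set xs \<subseteq> pts ?X" "\<sigma> \<in> pts (T (node (length xs)))" for xs \<sigma>
    using e[rule_format, OF node_Set_fp tuple_in[OF X that(1) refl] that(2)] \<theta>_node[OF A that] by simp
  then have "?P a" using a by simp
  then have "?P (SOME a. ?P a)" by (rule someI[of ?P])
  then have "?P (str A)" unfolding str_def .
  then show "str A \<in> nonexpanding (T ?X) ?X" "\<And>xs \<sigma>. set xs \<subseteq> pts ?X \<Longrightarrow> \<sigma> \<in> pts (T (node (length xs))) \<Longrightarrow>
      str A (TM (node (length xs)) ?X (tuple xs) \<sigma>) = opn A (encode (length xs, \<sigma>)) xs" by simp_all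
qed

lemma str_EM:
  assumes A: "A \<in> Mod" shows "(underlying A, str A) \<in> EM M"
proof -
  let ?X = "underlying A"
  note X = Mod_UMet[OF A] and a = str_in[OF A]
  have "str A (eta M ?X x) = x" if x: "x \<in> pts ?X" for x
  proof -
    \<comment> \<open>A point is a list of length one, and its unit is the image of the unit of the
      one-point standard space.\<close>
    have x': "set [x] \<subseteq> pts ?X" and p: "pt 0 \<in> pts (node (length [x]))" using x by auto
    have "eta M ?X x = TM (node (length [x])) ?X (tuple [x]) (eta M (node (length [x])) (pt 0))"
      using eta_nat[OF node_UMet X tuple_in[OF X x' refl] p] tuple_pt[of 0 "[x]"] by simp
    then show ?thesis
      using str_opn[OF A x' eta_pts[OF node_UMet p]] opn_eta[OF A _ x', of 0] by simp
  qed
  moreover have "str A (mu M ?X z) = str A (TM (T ?X) ?X (str A) z)" if z: "z \<in> pts (T (T ?X))" for z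
  proof -
    obtain zs \<tau> where zs: "set zs \<subseteq> pts (T ?X)" and \<tau>: "\<tau> \<in> pts (T (node (length zs)))"
      and z_eq: "z = TM (node (length zs)) (T ?X) (tuple zs) \<tau>"
      using generated[OF FO_Ob[OF X] z] by (elim exE conjE)
    \<comment> \<open>All entries of \<open>zs\<close> are rewritten as operations on the same list
      \<open>ys\<close>; now \<open>z\<close> comes from \<open>T (T (node n))\<close>, where the
      multiplication is governed by \<open>opn_mu\<close>.\<close>
    obtain ys \<sigma>s where ys: "set ys \<subseteq> pts ?X" and \<sigma>s: "set \<sigma>s \<subseteq> pts (T (node (length ys)))"
      and zs_eq: "zs = map (TM (node (length ys)) ?X (tuple ys)) \<sigma>s"
      using generated_list[OF X zs] by (elim exE conjE)
    define n k where "n = length ys" and "k = length zs"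
    note t = tuple_in[OF X ys n_def[symmetric]]
    note \<phi> = FM_in[OF node_UMet X t]
    let ?\<kappa> = "TM (node k) (T (node n)) (tuple \<sigma>s) \<tau>"
    have k: "length \<sigma>s = k" by (simp add: k_def zs_eq)
    have \<sigma>s': "set \<sigma>s \<subseteq> pts (T (node n))" using \<sigma>s by (simp add: n_def)
    have \<tau>': "\<tau> \<in> pts (T (node k))" using \<tau> by (simp add: k_def)
    have \<kappa>: "?\<kappa> \<in> pts (T (T (node n)))"
      by (rule FM_pts[OF node_UMet FO_Ob[OF node_UMet] tuple_in[OF FO_Ob[OF node_UMet] \<sigma>s' k] \<tau>'])
    have "z = TM (T (node n)) (T ?X) (TM (node n) ?X (tuple ys)) ?\<kappa>"
      using TM_tuple[OF FO_Ob[OF node_UMet] FO_Ob[OF X] \<phi> k \<sigma>s' \<tau>'] by (simp add: z_eq k_def zs_eq n_def)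
    then have "mu M ?X z = TM (node n) ?X (tuple ys) (mu M (node n) ?\<kappa>)"
      using mu_nat[OF node_UMet X t \<kappa>] by simp
    then have "str A (mu M ?X z) = opn A (encode (n, mu M (node n) ?\<kappa>)) ys"
      using str_opn[OF A ys, of "mu M (node n) ?\<kappa>"] mu_pts[OF node_UMet \<kappa>] by (simp add: n_def)
    also have "\<dots> = opn A (encode (k, \<tau>)) (map (\<lambda>\<sigma>. opn A (encode (n, \<sigma>)) ys) \<sigma>s)"
      using opn_mu[OF A \<tau>' k \<sigma>s ys] by (simp add: n_def)
    also have "map (\<lambda>\<sigma>. opn A (encode (n, \<sigma>)) ys) \<sigma>s = map (str A) zs"
      using str_opn[OF A ys] \<sigma>s by (auto simp: zs_eq n_def)
    also have "opn A (encode (k, \<tau>)) (map (str A) zs) = str A (TM (node k) ?X (tuple (map (str A) zs)) \<tau>)"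
    proof -
      have "set (map (str A) zs) \<subseteq> pts ?X" using zs nonexpanding_pts[OF a] by auto
      from str_opn[OF A this, of \<tau>] show ?thesis using \<tau> by (simp add: k_def)
    qed
    also have "TM (node k) ?X (tuple (map (str A) zs)) \<tau> = TM (T ?X) ?X (str A) z"
      using TM_tuple[OF FO_Ob[OF X] X a _ zs \<tau>] by (simp add: z_eq k_def)
    finally show ?thesis .
  qed
  ultimately show ?thesis using X a by (simp add: EM_def)
qed

lemma alg_str:
  assumes A: "A \<in> Mod" shows "alg (underlying A) (str A) = A"
proof (rule alg_eqI[OF Mod_ultra[OF alg_Mod[OF str_EM[OF A]]] Mod_ultra[OF A]])
  fix s xs assume s: "s \<in> symbols \<Sigma>" and xs: "length xs = arity \<Sigma> s" "set xs \<subseteq> pts (underlying (alg (underlying A) (str A)))"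
  from s obtain n \<sigma> where \<sigma>: "\<sigma> \<in> pts (T (node n))" "s = encode (n, \<sigma>)" by (rule symbol_cases)
  have n: "length xs = n" using xs \<sigma> by simp
  show "opn (alg (underlying A) (str A)) s xs = opn A s xs"
    using opn_alg[OF \<sigma>(1) n] str_opn[OF A, of xs \<sigma>] xs \<sigma> n by simp
qed simp

text \<open>Both maps agree on operations applied to lists, and by generation these are all points
  of \<open>T X\<close>.\<close>

lemma str_alg:
  assumes EM: "(X, a) \<in> EM M" shows "str (alg X a) = a"
proof (rule generated_eqI[OF EM_D(1)[OF EM] _ EM_D(2)[OF EM]])
  note A = alg_Mod[OF EM]
  show "str (alg X a) \<in> nonexpanding (T X) X" using str_in[OF A] by simp
  show "str (alg X a) (TM (node (length xs)) X (tuple xs) \<sigma>) = a (TM (node (length xs)) X (tuple xs) \<sigma>)"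
    if "set xs \<subseteq> pts X" "\<sigma> \<in> pts (T (node (length xs)))" for xs \<sigma>
    using str_opn[OF A, of xs \<sigma>] opn_alg[OF that(2) refl that(1)] that by simp
qed

text \<open>Every point of \<open>T\<close> at the underlying space of \<open>A\<close> is an
  operation applied to a list, where \<open>str\<close> is the operation itself. Commuting with
  structure maps is therefore commuting with operations.\<close>

lemma homomorphism_iff:
  assumes A: "A \<in> Mod" and B: "B \<in> Mod"
  shows "homomorphisms \<Sigma> A B = EM_hom M (underlying A, str A) (underlying B, str B)"
proof (rule set_eqI)
  fix h
  let ?X = "underlying A" and ?Y = "underlying B"
  note X = Mod_UMet[OF A] and Y = Mod_UMet[OF B]
  have tup: "str B (TM ?X ?Y h (TM (node (length xs)) ?X (tuple xs) \<sigma>)) = opn B (encode (length xs, \<sigma>)) (map h xs)"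
    if "h \<in> nonexpanding ?X ?Y" "set xs \<subseteq> pts ?X" "\<sigma> \<in> pts (T (node (length xs)))" for xs \<sigma>
  proof -
    have "set (map h xs) \<subseteq> pts ?Y" using that nonexpanding_pts[OF that(1)] by auto
    then show ?thesis
      using TM_tuple[OF X Y that(1) refl that(2,3)] str_opn[OF B, of "map h xs" \<sigma>] that(3) by simp
  qed
  show "h \<in> homomorphisms \<Sigma> A B \<longleftrightarrow> h \<in> EM_hom M (underlying A, str A) (underlying B, str B)"
  proof
    assume hom: "h \<in> homomorphisms \<Sigma> A B"
    note h = homomorphism_nonexpanding[OF hom]
    have "h (str A z) = str B (TM ?X ?Y h z)" if z: "z \<in> pts (T ?X)" for z
    proof -
      obtain xs \<sigma> where xs: "set xs \<subseteq> pts ?X" and \<sigma>: "\<sigma> \<in> pts (T (node (length xs)))"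
        and z: "z = TM (node (length xs)) ?X (tuple xs) \<sigma>"
        using generated[OF X z] by (elim exE conjE)
      show ?thesis
        unfolding z str_opn[OF A xs \<sigma>] tup[OF h xs \<sigma>]
        by (rule homomorphism_opn[OF hom symbol[OF \<sigma>] _ xs]) (simp add: arity[OF \<sigma>])
    qed
    then show "h \<in> EM_hom M (underlying A, str A) (underlying B, str B)" using h by (simp add: EM_hom_def)
  next
    assume "h \<in> EM_hom M (underlying A, str A) (underlying B, str B)"
    then have h: "h \<in> nonexpanding ?X ?Y" and hs: "\<And>z. z \<in> pts (T ?X) \<Longrightarrow> h (str A z) = str B (TM ?X ?Y h z)"
      by (auto simp: EM_hom_def)
    show "h \<in> homomorphisms \<Sigma> A B"
    proof (rule homomorphismI[OF h])
      fix s xs assume s: "s \<in> symbols \<Sigma>" and xs: "length xs = arity \<Sigma> s" "set xs \<subseteq> pts ?X"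
      from s obtain n \<sigma> where \<sigma>: "\<sigma> \<in> pts (T (node n))" "s = encode (n, \<sigma>)" by (rule symbol_cases)
      have n: "length xs = n" using xs \<sigma> by simp
      have \<sigma>': "\<sigma> \<in> pts (T (node (length xs)))" using \<sigma> n by simp
      show "h (opn A s xs) = opn B s (map h xs)"
        using hs[OF FM_pts[OF node_UMet X tuple_in[OF X xs(2) refl] \<sigma>']]
        unfolding str_opn[OF A xs(2) \<sigma>'] tup[OF h xs(2) \<sigma>'] by (simp add: \<sigma>(2) n)
    qed
  qed
qed

lemma finitary_variety_Mod: "finitary_variety (\<Sigma>, Mod)"
proof -
  have "E \<subseteq> quant_eqs \<Sigma>" by (auto simp: E_def)
  then show ?thesis
    unfolding finitary_variety_def case_prod_conv Mod_def
    by (intro conjI signature_\<Sigma> exI[of _ E] refl)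
qed

lemma represents_Mod: "represents (\<Sigma>, Mod) M str"
proof -
  have Ob: "Ob (variety_cat (\<Sigma>, Mod)) = Mod" by (auto simp: Ob_variety_cat Mod_def)
  have "bij_betw (\<lambda>A. (underlying A, str A)) Mod (EM M)"
    by (rule bij_betw_byWitness[where f' = "\<lambda>(X, a). alg X a"])
      (auto simp: alg_str str_alg str_EM alg_Mod)
  then show ?thesis unfolding represents_def Ob using enriched_monad homomorphism_iff by simp
qed

end

lemma (in universe) monad_represents:
  assumes "(M :: ('u emetric, 'u \<Rightarrow> 'u) mnd) \<in> Ob Mon_sf"
  shows "\<exists>V s. finitary_variety V \<and> represents V M s"
proof -
  interpret finitary_monad u M using assms by unfold_locales (simp_all add: Mon_sf_simps)
  show ?thesis using finitary_variety_Mod represents_Mod by blast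
qed

theorem theorem5p8:
  assumes "uncountable (UNIV :: 'u set)"
    and "regularCard |UNIV :: 'u set|"
  shows "equivalent_categories
    (op_cat (Var_fp :: ('u variety, 'u alg_functor) cat))
    (Mon_sf :: (('u emetric, 'u \<Rightarrow> 'u) mnd, 'u emetric \<Rightarrow> 'u \<Rightarrow> 'u) cat)"
proof -
  interpret universe "TYPE('u)" using assms by unfold_locales
  show ?thesis by (rule duality_from_representations) (fact variety_represented, fact monad_represents)
qed

end
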